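(* (i) Let $\varphi(t,x)$, $t\in[0,T]$, be a path in $\operatorname{Diff}_{\mathcal S}(\mathbb R)$. Given $k,m,n\in\mathbb N$, there exists for small $\epsilon>0$ a path $\psi(t,x)$ in $\operatorname{Diff}_{\mathcal S}(\mathbb R)$ with the same endpoints, $\psi(0,\cdot)=\varphi(0,\cdot)$ and $\psi(T,\cdot)=\varphi(T,\cdot)$, close to the original path, $$\|\varphi-\psi\|_{\mathcal S^{k,m,n}}<\epsilon,$$ with smaller length, $$L(\psi)<L(\varphi).$$ (ii) The same result holds for the Virasoro-Bott group $\mathbb R\times_c\operatorname{Diff}_{\mathcal S}(\mathbb R)$: if $(\varphi,\alpha)$ is a path in it and $k,m,n\in\mathbb N$, then for small $\epsilon>0$ there exists a path $(\psi,\beta)$ in $\mathbb R\times_c\operatorname{Diff}_{\mathcal S}(\mathbb R)$ with the same endpoints, with $\|\varphi-\psi\|_{\mathcal S^{k,m,n}}+\|\alpha-\beta\|_{C^n}<\epsilon$, and with $L(\psi,\beta)<L(\varphi,\alpha)$.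
   Context: $T>0$ and $0\in\mathbb N$. $\mathcal S(\mathbb R)$ is the space of rapidly decreasing smooth functions on $\mathbb R$, topologized by the seminorms $\sum_{i\le m}\|(1+|x|^2)^k\partial_x^i f\|_\infty$, $k,m\in\mathbb N$. $\operatorname{Diff}_{\mathcal S}(\mathbb R)$ is the group, under composition, of diffeomorphisms of $\mathbb R$ of the form $\operatorname{Id}+f$ with $f\in\mathcal S(\mathbb R)$; all its elements have positive derivative. The Bott cocycle is $c(\varphi,\psi)=\frac12\int_{\mathbb R}\log((\varphi\circ\psi)')\,d\log\psi'$. The Virasoro-Bott group $\mathbb R\times_c\operatorname{Diff}_{\mathcal S}(\mathbb R)$ is the set of pairs $(\varphi,\alpha)$ with $\varphi\in\operatorname{Diff}_{\mathcal S}(\mathbb R)$, $\alpha\in\mathbb R$, with multiplication $(\varphi,\alpha)(\psi,\beta)=(\varphi\circ\psi,\ \alpha+\beta+c(\varphi,\psi))$. A path in $\operatorname{Diff}_{\mathcal S}(\mathbb R)$ is a smooth map $\varphi:[0,T]\times\mathbb R\to\mathbb R$ with $\varphi(t,\cdot)\in\operatorname{Diff}_{\mathcal S}(\mathbb R)$ for every $t$ and $\varphi(t,x)-x\in\mathcal S([0,T]\times\mathbb R)$, where $\mathcal S([0,T]\times\mathbb R)$ is defined by the seminorms $$\|h\|_{\mathcal S^{k,m,n}}=\sum_{i\le m,\ j\le n}\|(1+|x|^2)^k\partial_x^i\partial_t^j h\|_\infty,\qquad k,m,n\in\mathbb N.$$ A path in the Virasoro-Bott group is a pair $(\varphi,\alpha)$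 with $\varphi$ such a path and $\alpha\in C^\infty([0,T])$ real-valued. The length of a path for the right-invariant $L^2$-metric is the integral over $[0,T]$ of the norm of its velocity, $L(\varphi)=\int_0^T|\partial_t\varphi(t)|_{\varphi(t)}\,dt$; explicitly, $$L(\varphi)=\int_0^T\Big(\int_{\mathbb R}\varphi_t^2\varphi_x\,dx\Big)^{1/2}dt$$ on $\operatorname{Diff}_{\mathcal S}(\mathbb R)$, and $$L(\varphi,\alpha)=\int_0^T\Big(\int_{\mathbb R}\varphi_t^2\varphi_x\,dx+\Big(\alpha_t-\int_{\mathbb R}\frac{\varphi_{tx}\varphi_{xx}}{\varphi_x^2}\,dx\Big)^2\Big)^{1/2}dt$$ on the Virasoro-Bott group.
   Formalization: The path is assumed not constant in time (in (i) φ is not constant, in (ii) the pair (φ,α) is not constant on [0,T]), since a constant path has length 0 and no path is shorter. *)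

theory Defs
  imports "HOL-Analysis.Analysis"
begin

section \<open>Rapidly decreasing diffeomorphisms of the line\<close>

definition smooth_line :: "(real \<Rightarrow> real) \<Rightarrow> bool" where
  "smooth_line f \<longleftrightarrow> (\<forall>i x. (deriv ^^ i) f differentiable at x)"

definition schwartz_line :: "(real \<Rightarrow> real) set" where
  "schwartz_line = {f. smooth_line f \<and>
     (\<forall>k i. bounded (range (\<lambda>x. (1 + x\<^sup>2) ^ k * (deriv ^^ i) f x)))}"

definition Diff_S :: "(real \<Rightarrow> real) set" where
  "Diff_S = {\<phi>. bij \<phi> \<and> smooth_line \<phi> \<and> smooth_line (inv \<phi>) \<and>
     (\<exists>f\<in>schwartz_line. \<phi> = (\<lambda>x. x + f x))}"


section \<open>Smooth functions on the closed strip and on the closed interval\<close>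

text \<open>Functions of time and space are curried, time first. Only their values for times in
  \<open>{0..T}\<close> matter: time derivatives are taken within \<open>{0..T}\<close>, hence are one-sided at the two
  end points.\<close>

definition dt :: "real \<Rightarrow> (real \<Rightarrow> real) \<Rightarrow> real \<Rightarrow> real" where
  "dt T a = (\<lambda>t. vector_derivative a (at t within {0..T}))"

definition partial_t :: "real \<Rightarrow> (real \<Rightarrow> real \<Rightarrow> real) \<Rightarrow> real \<Rightarrow> real \<Rightarrow> real" where
  "partial_t T h = (\<lambda>t x. dt T (\<lambda>s. h s x) t)"

definition partial_x :: "(real \<Rightarrow> real \<Rightarrow> real) \<Rightarrow> real \<Rightarrow> real \<Rightarrow> real" where
  "partial_x h = (\<lambda>t. deriv (h t))"

definition smooth_interval :: "real \<Rightarrow> (real \<Rightarrow> real) \<Rightarrow> bool" where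
  "smooth_interval T a \<longleftrightarrow> (\<forall>j. \<forall>t\<in>{0..T}. (dt T ^^ j) a differentiable at t within {0..T})"

text \<open>\<open>C_strip T n h\<close>: all mixed partial derivatives of order at most \<open>n\<close>, in any order of
  differentiation, exist and are jointly continuous on the closed strip.\<close>

primrec C_strip :: "real \<Rightarrow> nat \<Rightarrow> (real \<Rightarrow> real \<Rightarrow> real) \<Rightarrow> bool" where
  "C_strip T 0 h \<longleftrightarrow> continuous_on ({0..T} \<times> UNIV) (\<lambda>(t, x). h t x)"
| "C_strip T (Suc n) h \<longleftrightarrow>
     continuous_on ({0..T} \<times> UNIV) (\<lambda>(t, x). h t x) \<and>
     (\<forall>t\<in>{0..T}. \<forall>x. (\<lambda>s. h s x) differentiable at t within {0..T} \<and> h t differentiable at x) \<and>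
     C_strip T n (partial_t T h) \<and> C_strip T n (partial_x h)"

definition smooth_strip :: "real \<Rightarrow> (real \<Rightarrow> real \<Rightarrow> real) \<Rightarrow> bool" where
  "smooth_strip T h \<longleftrightarrow> (\<forall>n. C_strip T n h)"


section \<open>Rapidly decreasing functions on the strip and their seminorms\<close>

definition weighted_deriv ::
  "real \<Rightarrow> nat \<Rightarrow> nat \<Rightarrow> nat \<Rightarrow> (real \<Rightarrow> real \<Rightarrow> real) \<Rightarrow> real \<times> real \<Rightarrow> real" where
  "weighted_deriv T k i j h = (\<lambda>(t, x). (1 + x\<^sup>2) ^ k * (partial_x ^^ i) ((partial_t T ^^ j) h) t x)"

definition schwartz_strip :: "real \<Rightarrow> (real \<Rightarrow> real \<Rightarrow> real) set" where
  "schwartz_strip T = {h. smooth_strip T h \<and>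
     (\<forall>k i j. bounded (weighted_deriv T k i j h ` ({0..T} \<times> UNIV)))}"

text \<open>The suprema below are meaningful only for bounded functions; for \<open>schwartz_norm\<close> this means
  arguments in \<open>schwartz_strip T\<close>, such as the difference of two paths.\<close>

definition sup_norm :: "'a set \<Rightarrow> ('a \<Rightarrow> real) \<Rightarrow> real" where
  "sup_norm A f = (SUP z\<in>A. \<bar>f z\<bar>)"

definition schwartz_norm :: "real \<Rightarrow> nat \<Rightarrow> nat \<Rightarrow> nat \<Rightarrow> (real \<Rightarrow> real \<Rightarrow> real) \<Rightarrow> real" where
  "schwartz_norm T k m n h =
     (\<Sum>i\<le>m. \<Sum>j\<le>n. sup_norm ({0..T} \<times> UNIV) (weighted_deriv T k i j h))"

definition C_norm :: "real \<Rightarrow> nat \<Rightarrow> (real \<Rightarrow> real) \<Rightarrow> real" where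
  "C_norm T n a = (\<Sum>j\<le>n. sup_norm {0..T} ((dt T ^^ j) a))"


section \<open>Paths and their lengths\<close>

definition Diff_path :: "real \<Rightarrow> (real \<Rightarrow> real \<Rightarrow> real) \<Rightarrow> bool" where
  "Diff_path T \<phi> \<longleftrightarrow> smooth_strip T \<phi> \<and> (\<forall>t\<in>{0..T}. \<phi> t \<in> Diff_S) \<and>
     (\<lambda>t x. \<phi> t x - x) \<in> schwartz_strip T"

text \<open>The Virasoro-Bott group is the set \<open>Diff_S \<times> UNIV\<close> of pairs with the multiplication twisted
  by the Bott cocycle. The multiplication enters here only through the right-invariant metric, that
  is, through the cocycle term in \<open>VB_length\<close>.\<close>

definition VB_path :: "real \<Rightarrow> (real \<Rightarrow> real \<Rightarrow> real) \<Rightarrow> (real \<Rightarrow> real) \<Rightarrow> bool" where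
  "VB_path T \<phi> \<alpha> \<longleftrightarrow> Diff_path T \<phi> \<and> smooth_interval T \<alpha>"

definition Diff_energy_density :: "real \<Rightarrow> (real \<Rightarrow> real \<Rightarrow> real) \<Rightarrow> real \<Rightarrow> real" where
  "Diff_energy_density T \<phi> t = (LINT x|lborel. (partial_t T \<phi> t x)\<^sup>2 * partial_x \<phi> t x)"

definition Diff_length :: "real \<Rightarrow> (real \<Rightarrow> real \<Rightarrow> real) \<Rightarrow> real" where
  "Diff_length T \<phi> = (LINT t:{0..T}|lborel. sqrt (Diff_energy_density T \<phi> t))"

definition VB_length :: "real \<Rightarrow> (real \<Rightarrow> real \<Rightarrow> real) \<Rightarrow> (real \<Rightarrow> real) \<Rightarrow> real" where
  "VB_length T \<phi> \<alpha> = (LINT t:{0..T}|lborel. sqrt (Diff_energy_density T \<phi> t +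
     (dt T \<alpha> t - (LINT x|lborel. partial_x (partial_t T \<phi>) t x * partial_x (partial_x \<phi>) t x
        / (partial_x \<phi> t x)\<^sup>2))\<^sup>2))"

end

theory Submission
  imports Defs "HOL-Probability.Sinc_Integral"
begin

text \<open>For fixed time, let \<open>F\<close> be the integrand under the root in the length. The path is perturbed
  to \<open>\<phi> \<plusminus> s \<eta>\<close> with \<open>\<eta>\<close> supported where \<open>F > 0\<close>, and \<open>\<alpha>\<close> is left unchanged. By concavity of the
  square root, the two lengths add up to at most twice the original length plus
  \<open>\<integral> (F\<^sub>+ + F\<^sub>- - 2 F) / (2 sqrt F)\<close>, in which all odd powers of \<open>s\<close> cancel; hence one of the two
  perturbed paths is shorter as soon as the second variation is negative.

  This is achieved by a short wave \<open>\<eta> = A(t) b((x - x\<^sub>0 + l (t - t\<^sub>0)) / \<delta>)\<close> with \<open>\<delta>\<close> small, which turns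
  the second variation into its leading symbol. If the central velocity
  \<open>a = \<alpha>\<^sub>t - \<integral> \<phi>\<^sub>t\<^sub>x \<phi>\<^sub>x\<^sub>x / \<phi>\<^sub>x\<^sup>2\<close> does not vanish at \<open>t\<^sub>0\<close>, the leading term is
  \<open>- 2 a \<integral> \<eta>\<^sub>t\<^sub>x \<eta>\<^sub>x\<^sub>x / \<phi>\<^sub>x\<^sup>2\<close>, whose sign is that of \<open>- a l\<close>. If \<open>a\<close> vanishes identically (as it does
  in effect on the diffeomorphism group), the leading term is
  \<open>\<integral> \<phi>\<^sub>x \<eta>\<^sub>t\<^sup>2 + 2 \<phi>\<^sub>t \<eta>\<^sub>t \<eta>\<^sub>x\<close>, an indefinite form wherever \<open>\<phi>\<^sub>t \<noteq> 0\<close>.\<close>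

section \<open>Smooth functions on the line and a bump function\<close>

text \<open>A constant path has length zero, so the paths considered are nonconstant. This yields an
  interior time with nonzero velocity, hence \<open>F > 0\<close> nearby, as the division by
  \<open>sqrt F\<close> demands. Averaging over \<open>s\<close> and \<open>- s\<close> removes the
  first variation, so no geodesic equation enters.

  The parameters are fixed in the order \<delta>, then \<open>s\<close>. A small \<delta> makes the
  second variation negative, at the price of large Schwartz norms of \<eta>; a much smaller
  \<open>s\<close> then restores closeness for any given norm.

  The obstacle is the square of the first variation of the cocycle term, a nonnegative part of the
  second variation, naively of order 1/\<delta>^2. For nonzero central velocity the leading term has
  order 1/\<delta>^3 and dominates it. For zero central velocity the leading term has only order
  1/\<delta>, and the naive estimate has to be improved.\<close>

lemma smooth_line_iff: "smooth_line f \<longleftrightarrow> (\<forall>x. f differentiable at x) \<and> smooth_line (deriv f)"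
proof
  assume f: "smooth_line f"
  have "f differentiable at x" for x
    using f unfolding smooth_line_def by (metis funpow_0)
  moreover have "smooth_line (deriv f)"
    using f unfolding smooth_line_def by (metis funpow_Suc_right comp_apply)
  ultimately show "(\<forall>x. f differentiable at x) \<and> smooth_line (deriv f)" by blast
next
  assume f: "(\<forall>x. f differentiable at x) \<and> smooth_line (deriv f)"
  show "smooth_line f" unfolding smooth_line_def
  proof (intro allI)
    fix i x show "(deriv ^^ i) f differentiable at x"
      using f by (cases i) (auto simp: smooth_line_def funpow_Suc_right simp del: funpow.simps(2))
  qed
qed

lemma smooth_line_has_derivative:
  "smooth_line f \<Longrightarrow> (f has_real_derivative deriv f x) (at x)"
  using smooth_line_iff DERIV_deriv_iff_real_differentiable by blast

lemma smooth_line_deriv: "smooth_line f \<Longrightarrow> smooth_line (deriv f)"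
  using smooth_line_iff by blast

lemma smooth_line_funpow: "smooth_line f \<Longrightarrow> smooth_line ((deriv ^^ i) f)"
  by (induction i) (auto intro: smooth_line_deriv)

lemma smooth_line_isCont: "smooth_line f \<Longrightarrow> isCont f x"
  using smooth_line_has_derivative DERIV_isCont by blast

lemma smooth_line_continuous_on: "smooth_line f \<Longrightarrow> continuous_on S f"
  using smooth_line_isCont continuous_at_imp_continuous_on by blast

text \<open>The derivative is quantified existentially, so that closure under products, composition
  and inversion follows by induction after exhibiting one formula; iterates of \<open>deriv\<close>
  would have to be computed instead.\<close>

primrec ndiff :: "nat \<Rightarrow> (real \<Rightarrow> real) \<Rightarrow> bool" where
  "ndiff 0 f \<longleftrightarrow> True"
| "ndiff (Suc n) f \<longleftrightarrow> (\<exists>f'. (\<forall>x. (f has_real_derivative f' x) (at x)) \<and> ndiff n f')"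

lemma ndiff_Suc_deriv:
  "ndiff (Suc n) f \<longleftrightarrow> (\<forall>x. (f has_real_derivative deriv f x) (at x)) \<and> ndiff n (deriv f)"
proof
  assume "ndiff (Suc n) f"
  then obtain f' where f': "\<And>x. (f has_real_derivative f' x) (at x)" "ndiff n f'" by auto
  then have "f' = deriv f" using DERIV_imp_deriv by (metis ext)
  with f' show "(\<forall>x. (f has_real_derivative deriv f x) (at x)) \<and> ndiff n (deriv f)" by auto
qed auto

lemma smooth_line_iff_ndiff: "smooth_line f \<longleftrightarrow> (\<forall>n. ndiff n f)"
proof
  assume "smooth_line f"
  then have "ndiff n f" for n
    by (induction n arbitrary: f)
       (auto intro: smooth_line_has_derivative smooth_line_deriv simp: ndiff_Suc_deriv simp del: ndiff.simps(2))
  then show "\<forall>n. ndiff n f" by blast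
next
  assume a: "\<forall>n. ndiff n f"
  have "(\<forall>n. ndiff n f) \<Longrightarrow> (deriv ^^ i) f differentiable at x" for i x
  proof (induction i arbitrary: f)
    case 0
    then have "ndiff (Suc 0) f" by blast
    then show ?case using real_differentiable_def by auto
  next
    case (Suc i)
    then have "\<forall>n. ndiff n (deriv f)" using ndiff_Suc_deriv by blast
    from Suc.IH[OF this] show ?case by (simp add: funpow_swap1)
  qed
  with a show "smooth_line f" unfolding smooth_line_def by blast
qed

lemma ndiff_less: "ndiff (Suc n) f \<Longrightarrow> ndiff n f"
  by (induction n arbitrary: f) (simp, metis ndiff.simps(2))

lemma ndiff_const: "ndiff n (\<lambda>x. c)"
proof (induction n arbitrary: c)
  case (Suc n)
  have "\<forall>x. ((\<lambda>x. c) has_real_derivative 0) (at x)" by auto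
  with Suc show ?case by (auto intro: exI[of _ "\<lambda>x. 0"])
qed simp

lemma ndiff_id: "ndiff n (\<lambda>x. x)"
proof (cases n)
  case (Suc m)
  have "\<forall>x. ((\<lambda>x. x) has_real_derivative 1) (at x)" by auto
  with ndiff_const Suc show ?thesis by (auto intro: exI[of _ "\<lambda>x. 1"])
qed simp

lemma ndiff_add: "ndiff n f \<Longrightarrow> ndiff n g \<Longrightarrow> ndiff n (\<lambda>x. f x + g x)"
proof (induction n arbitrary: f g)
  case (Suc n)
  then obtain f' g' where "\<And>x. (f has_real_derivative f' x) (at x)" "ndiff n f'"
      "\<And>x. (g has_real_derivative g' x) (at x)" "ndiff n g'" by auto
  with Suc.IH show ?case
    by (auto intro!: exI[of _ "\<lambda>x. f' x + g' x"] derivative_intros)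
qed simp

lemma ndiff_mult: "ndiff n f \<Longrightarrow> ndiff n g \<Longrightarrow> ndiff n (\<lambda>x. f x * g x)"
proof (induction n arbitrary: f g)
  case (Suc n)
  then obtain f' g' where d: "\<And>x. (f has_real_derivative f' x) (at x)" "ndiff n f'"
      "\<And>x. (g has_real_derivative g' x) (at x)" "ndiff n g'" by auto
  have "ndiff n (\<lambda>x. f' x * g x + g' x * f x)"
    using d Suc ndiff_less by (intro ndiff_add Suc.IH) auto
  with d show ?case
    by (auto intro!: exI[of _ "\<lambda>x. f' x * g x + g' x * f x"] DERIV_mult)
qed simp

lemma ndiff_compose: "ndiff n f \<Longrightarrow> ndiff n g \<Longrightarrow> ndiff n (\<lambda>x. f (g x))"
proof (induction n arbitrary: f g)
  case (Suc n)
  then obtain f' g' where d: "\<And>x. (f has_real_derivative f' x) (at x)" "ndiff n f'"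
      "\<And>x. (g has_real_derivative g' x) (at x)" "ndiff n g'" by auto
  have "ndiff n (\<lambda>x. f' (g x) * g' x)"
    using d Suc.prems ndiff_less by (intro ndiff_mult Suc.IH[of f' g]) auto
  with d show ?case
    by (auto intro!: exI[of _ "\<lambda>x. f' (g x) * g' x"] DERIV_chain2[of f])
qed simp

lemma ndiff_inverse: "ndiff n f \<Longrightarrow> (\<And>x. f x \<noteq> 0) \<Longrightarrow> ndiff n (\<lambda>x. inverse (f x))"
proof (induction n)
  case (Suc n)
  then obtain f' where d: "\<And>x. (f has_real_derivative f' x) (at x)" "ndiff n f'" by auto
  have *: "ndiff n (\<lambda>x. inverse (f x))" using Suc ndiff_less by blast
  have "ndiff n (\<lambda>x. - 1 * (inverse (f x) * f' x * inverse (f x)))"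
    by (intro ndiff_mult ndiff_const d *)
  then have "ndiff n (\<lambda>x. - (inverse (f x) * f' x * inverse (f x)))" by simp
  with d Suc.prems show ?case
    by (auto intro!: exI[of _ "\<lambda>x. - (inverse (f x) * f' x * inverse (f x))"] DERIV_inverse')
qed simp

lemma smooth_line_const: "smooth_line (\<lambda>x. c)"
  and smooth_line_id: "smooth_line (\<lambda>x. x)"
  and smooth_line_add: "smooth_line f \<Longrightarrow> smooth_line g \<Longrightarrow> smooth_line (\<lambda>x. f x + g x)"
  and smooth_line_mult: "smooth_line f \<Longrightarrow> smooth_line g \<Longrightarrow> smooth_line (\<lambda>x. f x * g x)"
  and smooth_line_compose: "smooth_line f \<Longrightarrow> smooth_line g \<Longrightarrow> smooth_line (\<lambda>x. f (g x))"
  by (auto simp: smooth_line_iff_ndiff intro: ndiff_const ndiff_id ndiff_add ndiff_mult ndiff_compose)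

text \<open>Bootstrapping: the derivative of the inverse \<open>g\<close> is
  \<open>inverse (deriv f (g y))\<close>, so each order known for \<open>g\<close> yields the next
  one. Continuity of \<open>g\<close> comes first because the rule for the derivative of an inverse
  presupposes it.\<close>

lemma smooth_line_inv:
  assumes bij: "bij f" and f: "smooth_line f" and nz: "\<And>x. deriv f x \<noteq> 0"
  shows "smooth_line (inv f)"
proof -
  define g where "g = inv f"
  have fg: "f (g y) = y" and gf: "g (f x) = x" for x y
    using bij unfolding g_def by (auto simp: bij_inv_eq_iff bij_is_inj bij_is_surj surj_f_inv_f)
  have gc: "isCont g y" for y
  proof -
    have "isCont g (f (g y))"
      by (rule isCont_inverse_function[where d = 1])
         (auto simp: gf smooth_line_isCont[OF f])
    then show ?thesis by (simp add: fg)
  qed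
  have der: "(g has_real_derivative inverse (deriv f (g y))) (at y)" for y
    by (rule DERIV_inverse_function[where f = f and a = "y - 1" and b = "y + 1"])
       (auto simp: fg gc nz intro: smooth_line_has_derivative[OF f])
  have "ndiff n g" for n
  proof (induction n)
    case (Suc n)
    have "ndiff n (\<lambda>y. deriv f (g y))"
      using smooth_line_deriv[OF f] Suc
      by (intro ndiff_compose[of n "deriv f" g]) (auto simp: smooth_line_iff_ndiff)
    then have "ndiff n (\<lambda>y. inverse (deriv f (g y)))"
      using nz by (rule ndiff_inverse)
    with der show ?case by (auto intro!: exI[of _ "\<lambda>y. inverse (deriv f (g y))"])
  qed simp
  then show ?thesis by (simp add: smooth_line_iff_ndiff g_def)
qed

text \<open>The flat function exp(-1/x) with a polynomial factor in 1/x. The factor makes the family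
  closed under differentiation: with y = 1/x, the new factor is y^2 (p(y) - p'(y)).\<close>

definition flat :: "real poly \<Rightarrow> real \<Rightarrow> real" where
  "flat p = (\<lambda>x. if x > 0 then poly p (inverse x) * exp (- inverse x) else 0)"

lemma poly_exp_decay: "((\<lambda>y. poly p y * exp (- y)) \<longlongrightarrow> 0) (at_top :: real filter)"
proof -
  have "((\<lambda>y. \<Sum>i\<le>degree p. coeff p i * (y ^ i / exp y)) \<longlongrightarrow> (\<Sum>i\<le>degree p. coeff p i * 0)) at_top"
    by (intro tendsto_intros tendsto_power_div_exp_0)
  moreover have "(\<Sum>i\<le>degree p. coeff p i * (y ^ i / exp y)) = poly p y * exp (- y)" for y
    by (simp add: poly_altdef sum_distrib_right exp_minus divide_inverse mult.assoc)
  ultimately show ?thesis by simp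
qed

lemma flat_derivative:
  "(flat p has_real_derivative flat ([:0, 0, 1:] * (p - pderiv p)) x) (at x)"
proof -
  let ?q = "[:0, 0, 1:] * (p - pderiv p)"
  consider "x > 0" | "x < 0" | "x = 0" by linarith
  then show ?thesis
  proof cases
    case 1
    have "((\<lambda>x. poly p (inverse x) * exp (- inverse x)) has_real_derivative flat ?q x) (at x)"
      unfolding flat_def using 1
      by (auto intro!: derivative_eq_intros simp: field_simps power2_eq_square)
    moreover have "eventually (\<lambda>y. flat p y = poly p (inverse y) * exp (- inverse y)) (nhds x)"
      using eventually_nhds_in_open[of "{0<..}" x] 1 by (auto simp: flat_def elim: eventually_mono)
    ultimately show ?thesis by (subst DERIV_cong_ev[OF refl _ refl]) auto
  next
    case 2
    have "((\<lambda>x. 0) has_real_derivative flat ?q x) (at x)"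
      unfolding flat_def using 2 by auto
    moreover have "eventually (\<lambda>y. flat p y = 0) (nhds x)"
      using eventually_nhds_in_open[of "{..<0}" x] 2 by (auto simp: flat_def elim: eventually_mono)
    ultimately show ?thesis by (subst DERIV_cong_ev[OF refl _ refl]) auto
  next
    case 3
    \<comment> \<open>Dividing by \<open>h\<close> in the difference quotient multiplies the
      polynomial in 1/h by its variable, hence \<open>pCons 0 p\<close>.\<close>
    have "((\<lambda>h. poly (pCons 0 p) (inverse h) * exp (- inverse h)) \<longlongrightarrow> 0) (at_right 0)"
      by (rule filterlim_compose[OF poly_exp_decay filterlim_inverse_at_top_right])
    then have r: "((\<lambda>h. (flat p (0 + h) - flat p 0) / h) \<longlongrightarrow> 0) (at_right 0)"
      by (rule Lim_transform_eventually)
         (auto simp: flat_def eventually_at_filter field_simps)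
    have l: "((\<lambda>h. (flat p (0 + h) - flat p 0) / h) \<longlongrightarrow> 0) (at_left 0)"
      by (rule Lim_transform_eventually[OF tendsto_const])
         (auto simp: flat_def eventually_at_filter)
    show ?thesis
      using filterlim_split_at[OF l r] by (simp add: DERIV_def 3) (simp add: flat_def)
  qed
qed

lemma smooth_line_flat: "smooth_line (flat p)"
proof -
  have "ndiff n (flat p)" for n
    by (induction n arbitrary: p) (auto intro!: exI flat_derivative)
  then show ?thesis by (simp add: smooth_line_iff_ndiff)
qed

text \<open>The factors vanish left of -1 and right of 1. The spelling \<open>1 + - 1 * x\<close>
  matches the closure rules for \<open>smooth_line\<close>.\<close>

definition bump :: "real \<Rightarrow> real" where
  "bump x = flat 1 (1 + x) * flat 1 (1 + - 1 * x)"

lemma smooth_line_bump: "smooth_line bump"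
  unfolding bump_def[abs_def]
  by (rule smooth_line_mult; rule smooth_line_compose[OF smooth_line_flat])
     (intro smooth_line_add smooth_line_mult smooth_line_const smooth_line_id)+

lemma bump_pos: "\<bar>x\<bar> < 1 \<Longrightarrow> bump x > 0"
  by (auto simp: bump_def flat_def)

lemma bump_zero: "\<bar>x\<bar> \<ge> 1 \<Longrightarrow> bump x = 0"
  by (auto simp: bump_def flat_def)

text \<open>The complement of a closed set is open, so every derivative vanishes on a neighbourhood
  and the induction can continue.\<close>

lemma deriv_funpow_zero_outside:
  assumes f: "smooth_line f" and S: "closed S" and z: "\<And>x. x \<notin> S \<Longrightarrow> f x = 0" and x: "x \<notin> S"
  shows "(deriv ^^ i) f x = 0"
  using x
proof (induction i arbitrary: x)
  case (Suc i)
  have "eventually (\<lambda>y. (deriv ^^ i) f y = 0) (nhds x)"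
    using eventually_nhds_in_open[of "- S" x] S Suc by (auto intro: eventually_mono)
  then have "deriv ((deriv ^^ i) f) x = deriv (\<lambda>y. 0) x"
    by (rule deriv_cong_ev) simp
  then show ?case by simp
qed (use z in simp)

lemma bump_deriv_zero: "\<bar>x\<bar> > 1 \<Longrightarrow> (deriv ^^ i) bump x = 0"
  by (rule deriv_funpow_zero_outside[OF smooth_line_bump, of "{-1..1}"]) (auto simp: bump_zero)

lemma bump_deriv1: "\<exists>x\<in>{-1<..<1}. deriv bump x \<noteq> 0"
proof -
  obtain z where "-1 < z" "z < 0" "bump 0 - bump (-1) = (0 - (-1)) * deriv bump z"
    using MVT2[of "-1" 0 bump "deriv bump"] smooth_line_has_derivative[OF smooth_line_bump] by auto
  with bump_pos[of 0] bump_zero[of "-1"] show ?thesis by (intro bexI[of _ z]) auto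
qed

text \<open>The mean value theorem for \<open>deriv bump\<close> between -2, where it vanishes, and
  a point where it does not gives the point sought. The support puts it into the closed interval; -1
  is excluded because the second derivative vanishes there as a limit from the left.\<close>

lemma bump_deriv2: "\<exists>x\<in>{-1<..<1}. (deriv ^^ 2) bump x \<noteq> 0"
proof -
  obtain w where w: "-1 < w" "w < 1" "deriv bump w \<noteq> 0" using bump_deriv1 by auto
  have s: "smooth_line (deriv bump)" by (rule smooth_line_deriv[OF smooth_line_bump])
  obtain z where z: "-2 < z" "z < w" "deriv bump w - deriv bump (-2) = (w - (-2)) * deriv (deriv bump) z"
    using MVT2[of "-2" w "deriv bump" "deriv (deriv bump)"] smooth_line_has_derivative[OF s] w by auto
  have "deriv bump (-2) = 0" using bump_deriv_zero[of "-2" 1] by simp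
  with z w have nz: "(deriv ^^ 2) bump z \<noteq> 0" by (auto simp: numeral_2_eq_2)
  then have "\<not> \<bar>z\<bar> > 1" using bump_deriv_zero by blast
  have c: "isCont ((deriv ^^ 2) bump) (-1)"
    by (rule smooth_line_isCont[OF smooth_line_funpow[OF smooth_line_bump]])
  have "(deriv ^^ 2) bump (-1) = 0"
  proof (rule tendsto_unique)
    show "((deriv ^^ 2) bump \<longlongrightarrow> (deriv ^^ 2) bump (-1)) (at_left (-1))"
      using c unfolding isCont_def by (rule tendsto_mono[rotated]) (simp add: at_le)
    show "((deriv ^^ 2) bump \<longlongrightarrow> 0) (at_left (-1))"
      by (rule Lim_transform_eventually[OF tendsto_const])
         (auto simp: eventually_at_filter bump_deriv_zero)
  qed simp
  with nz have "z \<noteq> -1" by auto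
  with \<open>\<not> \<bar>z\<bar> > 1\<close> z w have "z \<in> {-1<..<1}" by auto
  with nz show ?thesis by blast
qed


section \<open>Calculus on the strip\<close>

text \<open>A nondegenerate interval makes derivatives within it unique, also at the end
  points.\<close>

lemma dt_eqI:
  assumes "0 < T" "t \<in> {0..T}" "(a has_vector_derivative d) (at t within {0..T})"
  shows "dt T a t = d"
  using vector_derivative_within_cbox[of 0 T t a d] assms by (simp add: dt_def)

lemma dt_has_vector_derivative:
  "a differentiable at t within {0..T} \<Longrightarrow> (a has_vector_derivative dt T a t) (at t within {0..T})"
  by (simp add: dt_def vector_derivative_works)

lemma dt_cong:
  assumes "\<And>s. s \<in> {0..T} \<Longrightarrow> a s = b s" "t \<in> {0..T}"
  shows "dt T a t = dt T b t"
proof -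
  have "(a has_vector_derivative d) (at t within {0..T}) \<longleftrightarrow>
        (b has_vector_derivative d) (at t within {0..T})" for d
    using assms by (intro has_vector_derivative_cong_ev) (auto simp: eventually_at_filter)
  then show ?thesis by (simp add: dt_def vector_derivative_def)
qed

lemma differentiable_within_cong:
  assumes "\<And>s. s \<in> S \<Longrightarrow> a s = b s" "t \<in> S"
  shows "a differentiable at t within S \<longleftrightarrow> b differentiable at t within S"
  using assms by (metis differentiable_transform_within zero_less_one)

lemma partial_t_cong:
  assumes "\<And>s x. s \<in> {0..T} \<Longrightarrow> f s x = g s x" "t \<in> {0..T}"
  shows "partial_t T f t x = partial_t T g t x"
  unfolding partial_t_def by (rule dt_cong) (use assms in auto)

lemma partial_x_cong:
  assumes "\<And>x. f t x = g t x"
  shows "partial_x f t = partial_x g t"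
  unfolding partial_x_def using assms by (metis ext)

text \<open>Formulas for partial derivatives are only available at times in the interval; this
  permits substituting them in the recursion of \<open>C_strip\<close>.\<close>

lemma C_strip_cong:
  assumes "\<And>t x. t \<in> {0..T} \<Longrightarrow> f t x = g t x"
  shows "C_strip T n f \<longleftrightarrow> C_strip T n g"
  using assms
proof (induction n arbitrary: f g)
  case 0
  then show ?case by (auto intro!: continuous_on_cong)
next
  case (Suc n)
  have "f t = g t" if "t \<in> {0..T}" for t using Suc.prems that by auto
  moreover have "continuous_on ({0..T} \<times> UNIV) (\<lambda>(t, x). f t x) \<longleftrightarrow>
      continuous_on ({0..T} \<times> UNIV) (\<lambda>(t, x). g t x)"
    using Suc.prems by (auto intro!: continuous_on_cong)
  moreover have "(\<lambda>s. f s x) differentiable at t within {0..T} \<longleftrightarrow>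
      (\<lambda>s. g s x) differentiable at t within {0..T}" if "t \<in> {0..T}" for t x
    using Suc.prems that by (intro differentiable_within_cong) auto
  moreover have "C_strip T n (partial_t T f) \<longleftrightarrow> C_strip T n (partial_t T g)"
    using Suc.prems by (intro Suc.IH partial_t_cong) auto
  moreover have "C_strip T n (partial_x f) \<longleftrightarrow> C_strip T n (partial_x g)"
    by (intro Suc.IH fun_cong[OF partial_x_cong] Suc.prems)
  ultimately show ?case by simp
qed

lemma
  assumes "C_strip T (Suc n) h" "t \<in> {0..T}"
  shows C_strip_partial_t_derivative:
    "((\<lambda>s. h s x) has_vector_derivative partial_t T h t x) (at t within {0..T})"
  and C_strip_partial_x_derivative: "(h t has_real_derivative partial_x h t x) (at x)"
proof -
  show "((\<lambda>s. h s x) has_vector_derivative partial_t T h t x) (at t within {0..T})"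
    using assms dt_has_vector_derivative by (auto simp: partial_t_def)
  show "(h t has_real_derivative partial_x h t x) (at x)"
    using assms DERIV_deriv_iff_real_differentiable by (auto simp: partial_x_def)
qed

lemma smooth_strip_continuous:
  "smooth_strip T h \<Longrightarrow> continuous_on ({0..T} \<times> UNIV) (\<lambda>(t, x). h t x)"
  unfolding smooth_strip_def by (metis C_strip.simps(1))

lemma smooth_strip_partial_t: "smooth_strip T h \<Longrightarrow> smooth_strip T (partial_t T h)"
  and smooth_strip_partial_x: "smooth_strip T h \<Longrightarrow> smooth_strip T (partial_x h)"
  unfolding smooth_strip_def by (metis C_strip.simps(2))+

lemma smooth_strip_has_partial_t:
  "smooth_strip T h \<Longrightarrow> t \<in> {0..T} \<Longrightarrow>
    ((\<lambda>s. h s x) has_vector_derivative partial_t T h t x) (at t within {0..T})"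
  and smooth_strip_has_partial_x:
  "smooth_strip T h \<Longrightarrow> t \<in> {0..T} \<Longrightarrow> (h t has_real_derivative partial_x h t x) (at x)"
  unfolding smooth_strip_def
  using C_strip_partial_t_derivative C_strip_partial_x_derivative by blast+

lemma smooth_strip_partial_t_funpow: "smooth_strip T h \<Longrightarrow> smooth_strip T ((partial_t T ^^ j) h)"
  by (induction j) (auto intro: smooth_strip_partial_t)

lemma smooth_strip_partial_x_funpow: "smooth_strip T h \<Longrightarrow> smooth_strip T ((partial_x ^^ i) h)"
  by (induction i) (auto intro: smooth_strip_partial_x)

lemma partial_x_eqI: "(h t has_real_derivative d) (at x) \<Longrightarrow> partial_x h t x = d"
  by (simp add: partial_x_def DERIV_imp_deriv)

lemma partial_t_eqI:
  "0 < T \<Longrightarrow> t \<in> {0..T} \<Longrightarrow> ((\<lambda>s. h s x) has_vector_derivative d) (at t within {0..T}) \<Longrightarrow>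
    partial_t T h t x = d"
  by (simp add: partial_t_def dt_eqI)

section \<open>Linear combinations on the strip\<close>

lemma
  assumes T: "0 < T" and f: "C_strip T (Suc n) f" and g: "C_strip T (Suc n) g" and t: "t \<in> {0..T}"
  shows partial_t_lincomb: "partial_t T (\<lambda>t x. f t x + c * g t x) t x = partial_t T f t x + c * partial_t T g t x"
    and partial_x_lincomb: "partial_x (\<lambda>t x. f t x + c * g t x) t x = partial_x f t x + c * partial_x g t x"
proof -
  show "partial_t T (\<lambda>t x. f t x + c * g t x) t x = partial_t T f t x + c * partial_t T g t x"
    by (intro partial_t_eqI T t has_vector_derivative_add has_vector_derivative_mult_right
        C_strip_partial_t_derivative[OF f t] C_strip_partial_t_derivative[OF g t])
  show "partial_x (\<lambda>t x. f t x + c * g t x) t x = partial_x f t x + c * partial_x g t x"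
    by (intro partial_x_eqI DERIV_add DERIV_cmult
        C_strip_partial_x_derivative[OF f t] C_strip_partial_x_derivative[OF g t])
qed

lemma C_strip_lincomb:
  assumes T: "0 < T"
  shows "C_strip T n f \<Longrightarrow> C_strip T n g \<Longrightarrow> C_strip T n (\<lambda>t x. f t x + c * g t x)"
proof (induction n arbitrary: f g)
  case 0
  then show ?case by (auto simp: case_prod_beta intro!: continuous_intros)
next
  case (Suc n)
  have "continuous_on ({0..T} \<times> UNIV) (\<lambda>(t, x). f t x + c * g t x)"
    using Suc.prems by (auto simp: case_prod_beta intro!: continuous_intros)
  moreover have "C_strip T n (partial_t T (\<lambda>t x. f t x + c * g t x))"
    by (subst C_strip_cong[OF partial_t_lincomb[OF T Suc.prems]])
       (use Suc in auto)
  moreover have "C_strip T n (partial_x (\<lambda>t x. f t x + c * g t x))"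
    by (subst C_strip_cong[OF partial_x_lincomb[OF T Suc.prems]])
       (use Suc in auto)
  moreover have "(\<lambda>s. f s x + c * g s x) differentiable at t within {0..T}"
      "(\<lambda>x. f t x + c * g t x) differentiable at x" if "t \<in> {0..T}" for t x
    using Suc.prems that
    by (intro differentiable_add differentiable_mult differentiable_const; simp)+
  ultimately show ?case by simp
qed

lemma smooth_strip_lincomb:
  "0 < T \<Longrightarrow> smooth_strip T f \<Longrightarrow> smooth_strip T g \<Longrightarrow> smooth_strip T (\<lambda>t x. f t x + c * g t x)"
  unfolding smooth_strip_def using C_strip_lincomb by blast

section \<open>Travelling waves\<close>

lemma continuous_on_smooth_line_compose:
  "smooth_line f \<Longrightarrow> continuous_on S g \<Longrightarrow> continuous_on S (\<lambda>x. f (g x))"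
  using continuous_on_compose2[OF smooth_line_continuous_on[of f UNIV]] by blast

lemma continuous_on_travelling:
  assumes "smooth_line A" "smooth_line f"
  shows "continuous_on S (\<lambda>(t, x). A t * f (\<mu> * x + \<nu> * t + \<kappa>))"
  unfolding case_prod_beta
  by (intro continuous_on_mult continuous_on_smooth_line_compose[OF assms(1)]
      continuous_on_smooth_line_compose[OF assms(2)]) (intro continuous_intros)+

text \<open>Amplitude and profile are arbitrary because the induction replaces them by their
  derivatives: both partial derivatives of such a wave are linear combinations of waves with the
  same phase.\<close>

lemma C_strip_travelling:
  assumes T: "0 < T"
  shows "smooth_line A \<Longrightarrow> smooth_line f \<Longrightarrow> C_strip T n (\<lambda>t x. A t * f (\<mu> * x + \<nu> * t + \<kappa>))"
proof (induction n arbitrary: A f)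
  case 0
  then show ?case using continuous_on_travelling by simp
next
  case (Suc n)
  let ?h = "\<lambda>t x. A t * f (\<mu> * x + \<nu> * t + \<kappa>)"
  have dA: "(A has_real_derivative deriv A t) (at t within S)" for t S
    using smooth_line_has_derivative[OF Suc.prems(1)] has_field_derivative_at_within by blast
  have df: "(f has_real_derivative deriv f t) (at t)" for t
    using smooth_line_has_derivative[OF Suc.prems(2)] .
  have ht: "((\<lambda>s. ?h s x) has_real_derivative
      deriv A t * f (\<mu> * x + \<nu> * t + \<kappa>) + \<nu> * (A t * deriv f (\<mu> * x + \<nu> * t + \<kappa>))) (at t within S)" for t x S
    by (rule derivative_eq_intros dA DERIV_chain2[OF df] refl | simp add: algebra_simps)+
  have hx: "(?h t has_real_derivative \<mu> * (A t * deriv f (\<mu> * x + \<nu> * t + \<kappa>))) (at x)" for t x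
    by (rule derivative_eq_intros DERIV_chain2[OF df] refl | simp add: algebra_simps)+
  \<comment> \<open>Needed to present a scalar multiple in the form \<open>f + c * g\<close> of
    \<open>C_strip_lincomb\<close>.\<close>
  have zero: "C_strip T n (\<lambda>t x. 0)"
    using Suc.IH[OF smooth_line_const[of 0] smooth_line_const[of 0]] by simp
  have "continuous_on ({0..T} \<times> UNIV) (\<lambda>(t, x). ?h t x)"
    using Suc.prems by (rule continuous_on_travelling)
  moreover have "(\<lambda>s. ?h s x) differentiable at t within {0..T}" "?h t differentiable at x" for t x
    using ht hx by (meson real_differentiable_def field_differentiable_def
        field_differentiable_imp_differentiable)+
  moreover have "C_strip T n (partial_t T ?h)"
  proof (subst C_strip_cong)
    show "partial_t T ?h t x = deriv A t * f (\<mu> * x + \<nu> * t + \<kappa>) + \<nu> * (A t * deriv f (\<mu> * x + \<nu> * t + \<kappa>))"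
      if "t \<in> {0..T}" for t x
      using ht T that by (intro partial_t_eqI) (auto simp: has_real_derivative_iff_has_vector_derivative)
    show "C_strip T n (\<lambda>t x. deriv A t * f (\<mu> * x + \<nu> * t + \<kappa>) + \<nu> * (A t * deriv f (\<mu> * x + \<nu> * t + \<kappa>)))"
      by (intro C_strip_lincomb T Suc smooth_line_deriv)
  qed
  moreover have "C_strip T n (partial_x ?h)"
  proof (subst C_strip_cong)
    show "partial_x ?h t x = 0 + \<mu> * (A t * deriv f (\<mu> * x + \<nu> * t + \<kappa>))" for t x
      using hx by (simp add: partial_x_eqI)
    show "C_strip T n (\<lambda>t x. 0 + \<mu> * (A t * deriv f (\<mu> * x + \<nu> * t + \<kappa>)))"
      by (intro C_strip_lincomb T Suc smooth_line_deriv zero)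
  qed
  ultimately show ?case by simp
qed

section \<open>Linearity of mixed derivatives, seminorms of perturbations\<close>

lemma partial_funpow_lincomb:
  assumes T: "0 < T" and f: "smooth_strip T f" and g: "smooth_strip T g" and t: "t \<in> {0..T}"
  shows "(partial_x ^^ i) ((partial_t T ^^ j) (\<lambda>t x. f t x + c * g t x)) t x =
    (partial_x ^^ i) ((partial_t T ^^ j) f) t x + c * (partial_x ^^ i) ((partial_t T ^^ j) g) t x"
proof -
  \<comment> \<open>Quantified over all times of the interval, since the next time derivative
    depends on neighbouring times.\<close>
  have lt: "\<forall>t\<in>{0..T}. \<forall>x. (partial_t T ^^ j) (\<lambda>t x. f t x + c * g t x) t x =
      (partial_t T ^^ j) f t x + c * (partial_t T ^^ j) g t x"
  proof (induction j)
    case (Suc j)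
    have "smooth_strip T ((partial_t T ^^ j) f)" "smooth_strip T ((partial_t T ^^ j) g)"
      using f g by (auto intro: smooth_strip_partial_t_funpow)
    then have C: "C_strip T (Suc 0) ((partial_t T ^^ j) f)" "C_strip T (Suc 0) ((partial_t T ^^ j) g)"
      by (auto simp: smooth_strip_def simp del: C_strip.simps)
    show ?case
    proof (intro ballI allI)
      fix t x assume t: "t \<in> {0..T}"
      have "(partial_t T ^^ Suc j) (\<lambda>t x. f t x + c * g t x) t x =
          partial_t T (\<lambda>t x. (partial_t T ^^ j) f t x + c * (partial_t T ^^ j) g t x) t x"
        using partial_t_cong[of T "(partial_t T ^^ j) (\<lambda>t x. f t x + c * g t x)"
            "\<lambda>t x. (partial_t T ^^ j) f t x + c * (partial_t T ^^ j) g t x"] Suc t by simp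
      then show "(partial_t T ^^ Suc j) (\<lambda>t x. f t x + c * g t x) t x =
          (partial_t T ^^ Suc j) f t x + c * (partial_t T ^^ Suc j) g t x"
        using partial_t_lincomb[OF T C t] by simp
    qed
  qed simp
  define F where "F = (partial_t T ^^ j) f"
  define G where "G = (partial_t T ^^ j) g"
  have FG: "smooth_strip T F" "smooth_strip T G"
    using f g by (auto simp: F_def G_def intro: smooth_strip_partial_t_funpow)
  have "\<forall>t\<in>{0..T}. \<forall>x. (partial_x ^^ i) ((partial_t T ^^ j) (\<lambda>t x. f t x + c * g t x)) t x =
      (partial_x ^^ i) F t x + c * (partial_x ^^ i) G t x"
  proof (induction i)
    case 0 then show ?case using lt by (simp add: F_def G_def)
  next
    case (Suc i)
    have "smooth_strip T ((partial_x ^^ i) F)" "smooth_strip T ((partial_x ^^ i) G)"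
      using FG by (auto intro: smooth_strip_partial_x_funpow)
    then have C: "C_strip T (Suc 0) ((partial_x ^^ i) F)" "C_strip T (Suc 0) ((partial_x ^^ i) G)"
      by (auto simp: smooth_strip_def simp del: C_strip.simps)
    show ?case
    proof (intro ballI allI)
      fix t x assume t: "t \<in> {0..T}"
      have "(partial_x ^^ Suc i) ((partial_t T ^^ j) (\<lambda>t x. f t x + c * g t x)) t x =
          partial_x (\<lambda>t x. (partial_x ^^ i) F t x + c * (partial_x ^^ i) G t x) t x"
        using partial_x_cong[of "(partial_x ^^ i) ((partial_t T ^^ j) (\<lambda>t x. f t x + c * g t x))" t
            "\<lambda>t x. (partial_x ^^ i) F t x + c * (partial_x ^^ i) G t x"] Suc t by simp
      then show "(partial_x ^^ Suc i) ((partial_t T ^^ j) (\<lambda>t x. f t x + c * g t x)) t x =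
          (partial_x ^^ Suc i) F t x + c * (partial_x ^^ Suc i) G t x"
        using partial_x_lincomb[OF T C t] by simp
    qed
  qed
  then show ?thesis using t by (simp add: F_def G_def)
qed

lemma weighted_deriv_lincomb:
  assumes "0 < T" "smooth_strip T f" "smooth_strip T g" "z \<in> {0..T} \<times> UNIV"
  shows "weighted_deriv T k i j (\<lambda>t x. f t x + c * g t x) z =
    weighted_deriv T k i j f z + c * weighted_deriv T k i j g z"
  using assms by (auto simp: weighted_deriv_def partial_funpow_lincomb algebra_simps)

lemma schwartz_strip_lincomb:
  assumes T: "0 < T" and f: "f \<in> schwartz_strip T" and g: "g \<in> schwartz_strip T"
  shows "(\<lambda>t x. f t x + c * g t x) \<in> schwartz_strip T"
proof -
  have s: "smooth_strip T f" "smooth_strip T g" using f g by (auto simp: schwartz_strip_def)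
  have "bounded (weighted_deriv T k i j (\<lambda>t x. f t x + c * g t x) ` ({0..T} \<times> UNIV))" for k i j
  proof -
    have "bounded (weighted_deriv T k i j f ` ({0..T} \<times> UNIV))"
        "bounded (weighted_deriv T k i j g ` ({0..T} \<times> UNIV))"
      using f g by (auto simp: schwartz_strip_def)
    then obtain a b where ab: "\<forall>w\<in>weighted_deriv T k i j f ` ({0..T} \<times> UNIV). \<bar>w\<bar> \<le> a"
        "\<forall>w\<in>weighted_deriv T k i j g ` ({0..T} \<times> UNIV). \<bar>w\<bar> \<le> b"
      unfolding bounded_real by blast
    have "\<bar>weighted_deriv T k i j (\<lambda>t x. f t x + c * g t x) z\<bar> \<le> a + \<bar>c\<bar> * b"
      if z: "z \<in> {0..T} \<times> UNIV" for z
    proof -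
      have "\<bar>weighted_deriv T k i j f z\<bar> \<le> a" "\<bar>weighted_deriv T k i j g z\<bar> \<le> b"
        using ab z by blast+
      then have "\<bar>weighted_deriv T k i j f z\<bar> + \<bar>c\<bar> * \<bar>weighted_deriv T k i j g z\<bar> \<le> a + \<bar>c\<bar> * b"
        by (intro add_mono mult_left_mono) auto
      then show ?thesis
        unfolding weighted_deriv_lincomb[OF T s z]
        using abs_triangle_ineq[of "weighted_deriv T k i j f z" "c * weighted_deriv T k i j g z"]
        by (simp add: abs_mult)
    qed
    then show ?thesis unfolding bounded_real by blast
  qed
  then show ?thesis using smooth_strip_lincomb[OF T s] by (simp add: schwartz_strip_def)
qed

text \<open>The constant \<open>M\<close> does not depend on \<open>c\<close>, so shrinking
  \<open>c\<close> brings the perturbed function arbitrarily close in the given norm.\<close>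

lemma schwartz_norm_lincomb_diff:
  assumes T: "0 < T" and f: "smooth_strip T f" and g: "g \<in> schwartz_strip T"
  obtains M where "\<And>c. schwartz_norm T k m n (\<lambda>t x. f t x - (f t x + c * g t x)) \<le> \<bar>c\<bar> * M"
proof -
  have sg: "smooth_strip T g" using g by (auto simp: schwartz_strip_def)
  have "\<exists>b. \<forall>z\<in>{0..T} \<times> UNIV. \<bar>weighted_deriv T k i j g z\<bar> \<le> b" for i j
    using g unfolding schwartz_strip_def bounded_real by blast
  then obtain b where b: "\<And>i j z. z \<in> {0..T} \<times> UNIV \<Longrightarrow> \<bar>weighted_deriv T k i j g z\<bar> \<le> b i j"
    by metis
  \<comment> \<open>This and the next equation bring a multiple of \<open>g\<close> into the shape
    \<open>f + c * g\<close>, so that \<open>weighted_deriv_lincomb\<close> computes its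
    derivatives.\<close>
  have *: "(\<lambda>t x. f t x - (f t x + c * g t x)) = (\<lambda>t x. (-c) * g t x + 0 * f t x)" for c by auto
  have **: "(\<lambda>t x. (-c) * g t x) = (\<lambda>t x. g t x + (-c-1) * g t x)" for c
    by (auto simp: algebra_simps)
  have w: "weighted_deriv T k i j (\<lambda>t x. f t x - (f t x + c * g t x)) z = -c * weighted_deriv T k i j g z"
    if z: "z \<in> {0..T} \<times> UNIV" for i j c z
    using weighted_deriv_lincomb[OF T _ f z, of "\<lambda>t x. g t x + (-c-1) * g t x" k i j 0]
      weighted_deriv_lincomb[OF T sg sg z, of k i j "-c-1"]
      smooth_strip_lincomb[OF T sg sg, of "-c-1"]
    unfolding * ** by (simp add: algebra_simps)
  have "schwartz_norm T k m n (\<lambda>t x. f t x - (f t x + c * g t x)) \<le> (\<Sum>i\<le>m. \<Sum>j\<le>n. \<bar>c\<bar> * b i j)" for c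
    unfolding schwartz_norm_def sup_norm_def
  proof (intro sum_mono cSUP_least)
    fix i j z assume "z \<in> {0..T} \<times> (UNIV :: real set)"
    then show "\<bar>weighted_deriv T k i j (\<lambda>t x. f t x - (f t x + c * g t x)) z\<bar> \<le> \<bar>c\<bar> * b i j"
      using w b by (simp add: abs_mult mult_left_mono)
  qed (use T in auto)
  then show ?thesis by (intro that[of "\<Sum>i\<le>m. \<Sum>j\<le>n. b i j"]) (simp add: sum_distrib_left)
qed

text \<open>Weighted derivatives are bounded on the compact rectangle by continuity and vanish
  outside it: for time derivatives because the whole line of times at \<open>x\<close> carries
  zeros, for space derivatives because the complement of \<open>{c..d}\<close> is open.\<close>

lemma smooth_strip_compact_support:
  assumes T: "0 < T" and h: "smooth_strip T h"
    and z: "\<And>t x. t \<in> {0..T} \<Longrightarrow> x \<notin> {c..d} \<Longrightarrow> h t x = 0"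
  shows "h \<in> schwartz_strip T"
proof -
  have zt: "\<forall>t\<in>{0..T}. \<forall>x. x \<notin> {c..d} \<longrightarrow> (partial_t T ^^ j) h t x = 0" for j
  proof (induction j)
    case (Suc j)
    show ?case
    proof (intro ballI allI impI)
      fix t x assume t: "t \<in> {0..T}" "x \<notin> {c..d}"
      have "dt T (\<lambda>s. (partial_t T ^^ j) h s x) t = dt T (\<lambda>s. 0) t"
        using Suc t by (intro dt_cong) auto
      also have "\<dots> = 0" using T t by (intro dt_eqI) auto
      finally show "(partial_t T ^^ Suc j) h t x = 0" by (simp add: partial_t_def)
    qed
  qed (use z in auto)
  have zx: "\<forall>t\<in>{0..T}. \<forall>x. x \<notin> {c..d} \<longrightarrow> (partial_x ^^ i) ((partial_t T ^^ j) h) t x = 0" for i j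
  proof (induction i)
    case (Suc i)
    show ?case
    proof (intro ballI allI impI)
      fix t x assume t: "t \<in> {0..T}" "x \<notin> {c..d}"
      have "eventually (\<lambda>y. y \<in> - {c..d}) (nhds x)"
        using t by (intro eventually_nhds_in_open) auto
      then have "eventually (\<lambda>y. (partial_x ^^ i) ((partial_t T ^^ j) h) t y = 0) (nhds x)"
        using Suc t by (auto intro: eventually_mono)
      then have "deriv ((partial_x ^^ i) ((partial_t T ^^ j) h) t) x = deriv (\<lambda>y. 0) x"
        by (rule deriv_cong_ev) simp
      then show "(partial_x ^^ Suc i) ((partial_t T ^^ j) h) t x = 0" by (simp add: partial_x_def)
    qed
  qed (use zt in auto)
  have "bounded (weighted_deriv T k i j h ` ({0..T} \<times> UNIV))" for k i j
  proof -
    have "smooth_strip T ((partial_x ^^ i) ((partial_t T ^^ j) h))"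
      by (intro smooth_strip_partial_x_funpow smooth_strip_partial_t_funpow h)
    from smooth_strip_continuous[OF this]
    have "continuous_on ({0..T} \<times> {c..d}) (\<lambda>(t, x). (partial_x ^^ i) ((partial_t T ^^ j) h) t x)"
      by (rule continuous_on_subset) auto
    then have "continuous_on ({0..T} \<times> {c..d}) (weighted_deriv T k i j h)"
      by (auto simp: weighted_deriv_def case_prod_beta intro!: continuous_intros)
    then have "compact (weighted_deriv T k i j h ` ({0..T} \<times> {c..d}))"
      by (intro compact_continuous_image compact_Times) auto
    then have "bounded (insert 0 (weighted_deriv T k i j h ` ({0..T} \<times> {c..d})))"
      by (simp add: compact_imp_bounded)
    moreover have "weighted_deriv T k i j h ` ({0..T} \<times> UNIV) \<subseteq>
        insert 0 (weighted_deriv T k i j h ` ({0..T} \<times> {c..d}))"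
      using zx by (fastforce simp: weighted_deriv_def)
    ultimately show ?thesis by (rule bounded_subset)
  qed
  with h show ?thesis by (simp add: schwartz_strip_def)
qed

section \<open>Rapidly decreasing functions on the line and membership in
  \<open>Diff_S\<close>\<close>

lemma schwartz_line_add:
  assumes f: "f \<in> schwartz_line" and g: "g \<in> schwartz_line"
  shows "(\<lambda>x. f x + g x) \<in> schwartz_line"
proof -
  have s: "smooth_line f" "smooth_line g" using f g by (auto simp: schwartz_line_def)
  have d: "(deriv ^^ i) (\<lambda>x. f x + g x) = (\<lambda>x. (deriv ^^ i) f x + (deriv ^^ i) g x)" for i
  proof (induction i)
    case (Suc i)
    have "deriv (\<lambda>x. (deriv ^^ i) f x + (deriv ^^ i) g x) x =
        deriv ((deriv ^^ i) f) x + deriv ((deriv ^^ i) g) x" for x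
      using s by (intro DERIV_imp_deriv DERIV_add smooth_line_has_derivative smooth_line_funpow)
    with Suc show ?case by auto
  qed simp
  have "bounded (range (\<lambda>x. (1 + x\<^sup>2) ^ k * (deriv ^^ i) (\<lambda>x. f x + g x) x))" for k i
    unfolding d distrib_left
    by (rule bounded_plus_comp) (use f g in \<open>auto simp: schwartz_line_def\<close>)
  then show ?thesis using smooth_line_add[OF s] by (simp add: schwartz_line_def)
qed

lemma schwartz_line_compact_support:
  assumes f: "smooth_line f" and z: "\<And>x. x \<notin> {c..d} \<Longrightarrow> f x = 0"
  shows "f \<in> schwartz_line"
proof -
  have "bounded (range (\<lambda>x. (1 + x\<^sup>2) ^ k * (deriv ^^ i) f x))" for k i
  proof -
    let ?w = "\<lambda>x. (1 + x\<^sup>2) ^ k * (deriv ^^ i) f x"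
    have "continuous_on {c..d} ?w"
      by (intro continuous_intros smooth_line_continuous_on smooth_line_funpow f)
    then have "compact (?w ` {c..d})" by (intro compact_continuous_image) auto
    then have "bounded (insert 0 (?w ` {c..d}))" by (simp add: compact_imp_bounded)
    moreover have "range ?w \<subseteq> insert 0 (?w ` {c..d})"
      using deriv_funpow_zero_outside[OF f, of "{c..d}"] z by fastforce
    ultimately show ?thesis by (rule bounded_subset)
  qed
  with f show ?thesis by (simp add: schwartz_line_def)
qed

lemma schwartz_line_bounded_weight:
  assumes "f \<in> schwartz_line"
  obtains C where "\<And>x. \<bar>(deriv ^^ i) f x\<bar> \<le> C / (1 + x\<^sup>2)"
proof -
  have "bounded (range (\<lambda>x. (1 + x\<^sup>2) ^ 1 * (deriv ^^ i) f x))"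
    using assms unfolding schwartz_line_def by blast
  then obtain C where C: "\<And>x. \<bar>(1 + x\<^sup>2) * (deriv ^^ i) f x\<bar> \<le> C"
    unfolding bounded_real by auto
  have "\<bar>(deriv ^^ i) f x\<bar> \<le> C / (1 + x\<^sup>2)" for x
  proof -
    have "0 < 1 + x\<^sup>2" by (simp add: add_pos_nonneg)
    with C[of x] show ?thesis by (simp add: abs_mult pos_le_divide_eq mult.commute)
  qed
  then show ?thesis by (rule that)
qed

text \<open>Injectivity comes from monotonicity; surjectivity from the intermediate value theorem on
  \<open>y - C\<close> to \<open>y + C\<close>, where \<open>C\<close> bounds \<open>f\<close>;
  smoothness of the inverse from the nonvanishing derivative.\<close>

lemma Diff_S_I:
  assumes f: "f \<in> schwartz_line" and pos: "\<And>x. 0 < 1 + deriv f x"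
  shows "(\<lambda>x. x + f x) \<in> Diff_S"
proof -
  let ?g = "\<lambda>x. x + f x"
  have sf: "smooth_line f" using f by (simp add: schwartz_line_def)
  have sg: "smooth_line ?g" by (intro smooth_line_add smooth_line_id sf)
  have dg: "(?g has_real_derivative 1 + deriv f x) (at x)" for x
    by (intro derivative_intros smooth_line_has_derivative sf)
  then have dg': "deriv ?g x = 1 + deriv f x" for x by (rule DERIV_imp_deriv)
  have mono: "?g x < ?g y" if "x < y" for x y
    using DERIV_pos_imp_increasing[OF that, of ?g] dg pos by blast
  obtain C where C: "\<And>x. \<bar>f x\<bar> \<le> C / (1 + x\<^sup>2)"
    using schwartz_line_bounded_weight[OF f, of 0] by (metis funpow_0)
  have C0: "C \<ge> 0" using C[of 0] by simp
  have Cb: "\<bar>f x\<bar> \<le> C" for x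
    by (rule order_trans[OF C]) (use C0 in \<open>simp add: divide_le_eq add_pos_nonneg mult_left_le algebra_simps\<close>)
  have "\<exists>x. ?g x = y" for y
  proof -
    have "\<exists>x\<ge>y - C. x \<le> y + C \<and> ?g x = y"
      using Cb[of "y - C"] Cb[of "y + C"] C0
      by (intro IVT) (auto simp: smooth_line_isCont[OF sg])
    then show ?thesis by blast
  qed
  then have "bij ?g"
    unfolding bij_def surj_def using mono
    by (intro conjI linorder_injI) (auto simp: less_imp_neq, metis)
  then show ?thesis
    unfolding Diff_S_def using sg f pos smooth_line_inv[OF \<open>bij ?g\<close> sg]
    by (auto simp: dg' less_imp_neq[OF pos, symmetric] dest: less_imp_neq)
qed

text \<open>The chain rule with the smooth inverse shows that the derivative has no zero. By decay
  of \<open>deriv f\<close> it is positive somewhere, so by continuity it is positive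
  everywhere.\<close>

lemma Diff_S_deriv_pos:
  assumes "\<phi> \<in> Diff_S"
  shows "0 < deriv \<phi> x"
proof -
  obtain f where f: "f \<in> schwartz_line" "\<phi> = (\<lambda>x. x + f x)" and b: "bij \<phi>"
    and s: "smooth_line \<phi>" "smooth_line (inv \<phi>)"
    using assms by (auto simp: Diff_S_def)
  have nz: "deriv \<phi> y \<noteq> 0" for y
  proof -
    have "((\<lambda>x. inv \<phi> (\<phi> x)) has_real_derivative deriv (inv \<phi>) (\<phi> y) * deriv \<phi> y) (at y)"
      by (rule DERIV_chain2) (auto intro: smooth_line_has_derivative s)
    moreover have "inv \<phi> (\<phi> x) = x" for x using b by (simp add: bij_is_inj)
    ultimately have "deriv (inv \<phi>) (\<phi> y) * deriv \<phi> y = 1"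
      using DERIV_unique[OF _ DERIV_ident] by auto
    then show ?thesis by auto
  qed
  have df: "deriv \<phi> y = 1 + deriv f y" for y
    unfolding f(2) using f(1)
    by (intro DERIV_imp_deriv derivative_intros smooth_line_has_derivative) (simp add: schwartz_line_def)
  obtain C where C: "\<And>x. \<bar>deriv f x\<bar> \<le> C / (1 + x\<^sup>2)"
    using schwartz_line_bounded_weight[OF f(1), of 1] by auto
  have "C \<ge> 0" using C[of 0] by simp
  \<comment> \<open>The constant itself serves as the point far enough out: C < 1 + C^2 by
    completing the square.\<close>
  then have "C / (1 + C\<^sup>2) < 1"
    using zero_le_power2[of "C - 1/2"] by (simp add: divide_less_eq add_pos_nonneg power2_eq_square algebra_simps)
  with C[of C] have posC: "deriv \<phi> C > 0" by (simp add: df abs_le_iff)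
  have ct: "isCont (deriv \<phi>) y" for y by (intro smooth_line_isCont smooth_line_deriv s)
  show ?thesis
  proof (rule ccontr)
    assume "\<not> 0 < deriv \<phi> x"
    then have n: "deriv \<phi> x < 0" using nz[of x] by auto
    have "\<exists>y. deriv \<phi> y = 0"
    proof (cases "x \<le> C")
      case True then show ?thesis using IVT[of "deriv \<phi>" x 0 C] n posC ct by auto
    next
      case False then show ?thesis using IVT2[of "deriv \<phi>" x 0 C] n posC ct by auto
    qed
    with nz show False by blast
  qed
qed


section \<open>Decay along a path\<close>

lemma integrable_inverse_one_plus_square: "integrable lborel (\<lambda>x::real. C / (1 + x\<^sup>2))"
proof -
  have "integrable lborel (\<lambda>x::real. inverse (1 + x\<^sup>2))"
    using integrable_inverse_1_plus_square by (simp add: set_integrable_def)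
  then have "integrable lborel (\<lambda>x::real. C * inverse (1 + x\<^sup>2))" by simp
  then show ?thesis by (simp add: divide_inverse)
qed

lemma continuous_on_slice:
  assumes "continuous_on (S \<times> UNIV) (\<lambda>(t, x). f t x)" "t \<in> S"
  shows "continuous_on A (f t)"
proof -
  have "continuous_on A (\<lambda>x. (t, x))" by (intro continuous_intros)
  from continuous_on_compose2[OF assms(1) this] assms(2) show ?thesis by auto
qed

lemma continuous_on_slice_time:
  assumes "continuous_on (S \<times> UNIV) (\<lambda>(t, x). f t x)"
  shows "continuous_on S (\<lambda>t. f t x)"
proof -
  have "continuous_on S (\<lambda>t. (t, x))" by (intro continuous_intros)
  from continuous_on_compose2[OF assms(1) this] show ?thesis by auto
qed

text \<open>The integrable majorant is uniform in \<open>t\<close>, so dominated convergence along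
  sequences gives continuity of the integral in \<open>t\<close>.\<close>

lemma
  fixes f :: "real \<Rightarrow> real \<Rightarrow> real"
  assumes cont: "continuous_on (S \<times> UNIV) (\<lambda>(t, x). f t x)"
    and bound: "\<And>t x. t \<in> S \<Longrightarrow> \<bar>f t x\<bar> \<le> C / (1 + x\<^sup>2)"
  shows integrable_decaying: "t \<in> S \<Longrightarrow> integrable lborel (f t)"
    and continuous_on_LINT_decaying: "continuous_on S (\<lambda>t. LINT x|lborel. f t x)"
proof -
  have meas: "f t \<in> borel_measurable lborel" if "t \<in> S" for t
    using borel_measurable_continuous_onI[OF continuous_on_slice[OF cont that]] by simp
  show int: "integrable lborel (f t)" if "t \<in> S" for t
    by (rule Bochner_Integration.integrable_bound[OF integrable_inverse_one_plus_square[of C] meas[OF that]])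
       (unfold real_norm_def, rule AE_I2, rule order_trans[OF bound[OF that] abs_ge_self])
  show "continuous_on S (\<lambda>t. LINT x|lborel. f t x)"
    unfolding continuous_on_sequentially
  proof (intro allI ballI impI, elim conjE)
    fix u a assume a: "a \<in> S" and u: "\<forall>n. u n \<in> S" "u \<longlonglongrightarrow> a"
    have "(\<lambda>n. LINT x|lborel. f (u n) x) \<longlonglongrightarrow> (LINT x|lborel. f a x)"
    proof (rule integral_dominated_convergence[OF meas[OF a] meas integrable_inverse_one_plus_square[of C]])
      show "AE x in lborel. (\<lambda>n. f (u n) x) \<longlonglongrightarrow> f a x"
      proof (rule AE_I2)
        fix x
        show "(\<lambda>n. f (u n) x) \<longlonglongrightarrow> f a x"
          using continuous_on_slice_time[OF cont, of x] u a
          unfolding continuous_on_sequentially comp_def by blast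
      qed
      show "AE x in lborel. norm (f (u n) x) \<le> C / (1 + x\<^sup>2)" for n
        using u bound by auto
    qed (use u in auto)
    then show "((\<lambda>t. LINT x|lborel. f t x) \<circ> u) \<longlonglongrightarrow> (LINT x|lborel. f a x)"
      by (simp add: comp_def)
  qed
qed

text \<open>Lengths are defined by Lebesgue integrals over the line; the gauge integral over a
  compact interval depends continuously on parameters as soon as the integrand is jointly
  continuous.\<close>

lemma LINT_compact_support_eq:
  fixes g :: "real \<Rightarrow> real"
  assumes cont: "continuous_on {c..d} g" and z: "\<And>x. x \<notin> {c..d} \<Longrightarrow> g x = 0"
  shows "(LINT x|lborel. g x) = integral {c..d} g"
proof -
  have si: "set_integrable lborel {c..d} g"
    using cont by (rule borel_integrable_atLeastAtMost')
  have eq: "(\<lambda>x. indicator {c..d} x *\<^sub>R g x) = g"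
    using z by (intro ext) (auto simp: indicator_def)
  show ?thesis
    using set_borel_integral_eq_integral(2)[OF si] unfolding set_lebesgue_integral_def eq .
qed

definition cocycle_density :: "real \<Rightarrow> (real \<Rightarrow> real \<Rightarrow> real) \<Rightarrow> real \<Rightarrow> real" where
  "cocycle_density T \<phi> t = (LINT x|lborel. partial_x (partial_t T \<phi>) t x * partial_x (partial_x \<phi>) t x
        / (partial_x \<phi> t x)\<^sup>2)"

text \<open>The weight with exponent 1 already gives a majorant that is integrable over the
  line.\<close>

lemma schwartz_strip_weight:
  assumes "h \<in> schwartz_strip T"
  obtains C where "0 \<le> C"
    "\<And>t x. t \<in> {0..T} \<Longrightarrow> \<bar>(partial_x ^^ i) ((partial_t T ^^ j) h) t x\<bar> \<le> C / (1 + x\<^sup>2)"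
proof -
  have "bounded (weighted_deriv T 1 i j h ` ({0..T} \<times> UNIV))"
    using assms unfolding schwartz_strip_def by blast
  then obtain C where C: "\<forall>w\<in>weighted_deriv T 1 i j h ` ({0..T} \<times> UNIV). \<bar>w\<bar> \<le> C"
    unfolding bounded_real by blast
  show ?thesis
  proof (rule that[of "\<bar>C\<bar>"])
    fix t x assume "t \<in> {0..T}"
    then have "\<bar>weighted_deriv T 1 i j h (t, x)\<bar> \<le> C" using C by blast
    then have "(1 + x\<^sup>2) * \<bar>(partial_x ^^ i) ((partial_t T ^^ j) h) t x\<bar> \<le> \<bar>C\<bar>"
      by (simp add: weighted_deriv_def abs_mult)
    moreover have "0 < 1 + x\<^sup>2" by (simp add: add_pos_nonneg)
    ultimately show "\<bar>(partial_x ^^ i) ((partial_t T ^^ j) h) t x\<bar> \<le> \<bar>C\<bar> / (1 + x\<^sup>2)"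
      by (simp add: pos_le_divide_eq mult.commute)
  qed simp
qed

locale diff_path =
  fixes T :: real and \<phi> :: "real \<Rightarrow> real \<Rightarrow> real"
  assumes T: "0 < T" and path: "Diff_path T \<phi>"
begin

definition "U = partial_t T \<phi>"
definition "X = partial_x \<phi>"
definition "P = partial_x (partial_t T \<phi>)"
definition "Q = partial_x (partial_x \<phi>)"

lemma smooth: "smooth_strip T \<phi>"
  using path by (simp add: Diff_path_def)

lemma smooth_UXPQ: "smooth_strip T U" "smooth_strip T X" "smooth_strip T P" "smooth_strip T Q"
  by (auto simp: U_def X_def P_def Q_def intro!: smooth_strip_partial_t smooth_strip_partial_x smooth)

lemmas cont_UXPQ = smooth_UXPQ[THEN smooth_strip_continuous]

lemma X_pos: "t \<in> {0..T} \<Longrightarrow> 0 < X t x"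
  using path Diff_S_deriv_pos by (simp add: Diff_path_def X_def partial_x_def)

text \<open>The Schwartz bounds concern \<open>\<phi> t x - x\<close>. Subtracting the identity
  changes only the first space derivative, which tends to 1 instead of 0.\<close>

lemma decay:
  obtains C where "0 \<le> C"
    "\<And>t x. t \<in> {0..T} \<Longrightarrow> \<bar>U t x\<bar> \<le> C / (1 + x\<^sup>2)"
    "\<And>t x. t \<in> {0..T} \<Longrightarrow> \<bar>X t x - 1\<bar> \<le> C / (1 + x\<^sup>2)"
    "\<And>t x. t \<in> {0..T} \<Longrightarrow> \<bar>P t x\<bar> \<le> C / (1 + x\<^sup>2)"
    "\<And>t x. t \<in> {0..T} \<Longrightarrow> \<bar>Q t x\<bar> \<le> C / (1 + x\<^sup>2)"
proof -
  let ?h = "\<lambda>t x. \<phi> t x - x"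
  have h: "?h \<in> schwartz_strip T" using path by (simp add: Diff_path_def)
  have ht: "partial_t T ?h t x = U t x" if t: "t \<in> {0..T}" for t x
  proof (rule partial_t_eqI[OF T t])
    show "((\<lambda>s. \<phi> s x - x) has_vector_derivative U t x) (at t within {0..T})"
      using has_vector_derivative_diff[OF smooth_strip_has_partial_t[OF smooth t] has_vector_derivative_const]
      by (simp add: U_def)
  qed
  have hx: "partial_x ?h t x = X t x - 1" if t: "t \<in> {0..T}" for t x
    unfolding X_def
    by (intro partial_x_eqI derivative_intros smooth_strip_has_partial_x[OF smooth t])
  have htx: "partial_x (partial_t T ?h) t x = P t x" if t: "t \<in> {0..T}" for t x
    using partial_x_cong[of "partial_t T ?h" t U] ht[OF t] by (simp add: P_def U_def)
  have hxx: "partial_x (partial_x ?h) t x = Q t x" if t: "t \<in> {0..T}" for t x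
  proof -
    have "partial_x (partial_x ?h) t x = partial_x (\<lambda>t x. X t x - 1) t x"
      using partial_x_cong[of "partial_x ?h" t "\<lambda>t x. X t x - 1"] hx[OF t] by simp
    also have "\<dots> = Q t x - 0"
      unfolding Q_def X_def
      by (intro partial_x_eqI DERIV_diff DERIV_const smooth_strip_has_partial_x[OF smooth_UXPQ(2)[unfolded X_def] t])
    finally show ?thesis by simp
  qed
  obtain C1 where C1: "0 \<le> C1" "\<And>t x. t \<in> {0..T} \<Longrightarrow> \<bar>partial_t T ?h t x\<bar> \<le> C1 / (1 + x\<^sup>2)"
    using schwartz_strip_weight[OF h, of 0 1] by auto
  obtain C2 where C2: "0 \<le> C2" "\<And>t x. t \<in> {0..T} \<Longrightarrow> \<bar>partial_x ?h t x\<bar> \<le> C2 / (1 + x\<^sup>2)"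
    using schwartz_strip_weight[OF h, of 1 0] by auto
  obtain C3 where C3: "0 \<le> C3" "\<And>t x. t \<in> {0..T} \<Longrightarrow> \<bar>partial_x (partial_t T ?h) t x\<bar> \<le> C3 / (1 + x\<^sup>2)"
    using schwartz_strip_weight[OF h, of 1 1] by auto
  obtain C4 where C4: "0 \<le> C4" "\<And>t x. t \<in> {0..T} \<Longrightarrow> \<bar>partial_x (partial_x ?h) t x\<bar> \<le> C4 / (1 + x\<^sup>2)"
    using schwartz_strip_weight[OF h, of 2 0] by (auto simp: numeral_2_eq_2)
  have mono: "C' / (1 + x\<^sup>2) \<le> (C1 + C2 + C3 + C4) / (1 + x\<^sup>2)" if "C' \<in> {C1, C2, C3, C4}" for C' x
    using that C1(1) C2(1) C3(1) C4(1) by (intro divide_right_mono) auto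
  show ?thesis
  proof (rule that[of "C1 + C2 + C3 + C4"])
    fix t x assume t: "t \<in> {0..T}"
    show "\<bar>U t x\<bar> \<le> (C1 + C2 + C3 + C4) / (1 + x\<^sup>2)"
      using order_trans[OF C1(2)[OF t] mono] ht[OF t] by simp
    show "\<bar>X t x - 1\<bar> \<le> (C1 + C2 + C3 + C4) / (1 + x\<^sup>2)"
      using order_trans[OF C2(2)[OF t] mono] hx[OF t] by simp
    show "\<bar>P t x\<bar> \<le> (C1 + C2 + C3 + C4) / (1 + x\<^sup>2)"
      using order_trans[OF C3(2)[OF t] mono] htx[OF t] by simp
    show "\<bar>Q t x\<bar> \<le> (C1 + C2 + C3 + C4) / (1 + x\<^sup>2)"
      using order_trans[OF C4(2)[OF t] mono] hxx[OF t] by simp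
  qed (use C1 C2 C3 C4 in simp)
qed

text \<open>Far out \<open>X\<close> is close to 1; on the remaining compact rectangle it attains a
  positive minimum. A uniform bound is needed both for the denominators and for the admissible size
  of perturbations.\<close>

lemma X_bounded_below:
  obtains c where "0 < c" "\<And>t x. t \<in> {0..T} \<Longrightarrow> c \<le> X t x"
proof -
  obtain C where C: "0 \<le> C" "\<And>t x. t \<in> {0..T} \<Longrightarrow> \<bar>X t x - 1\<bar> \<le> C / (1 + x\<^sup>2)"
    using decay by metis
  \<comment> \<open>Since \<open>1 \<le> R\<close>, a point with
    \<open>R \<le> \<bar>x\<bar>\<close> has x^2 at least \<open>R\<close>, which makes C/(1 + x^2)
    at most 1/2.\<close>
  define R where "R = 1 + 2 * C"
  have out: "1 / 2 \<le> X t x" if t: "t \<in> {0..T}" and x: "x \<notin> {-R..R}" for t x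
  proof -
    have "R \<le> \<bar>x\<bar>" using x by auto
    moreover have "1 \<le> R" using C by (simp add: R_def)
    ultimately have "R \<le> \<bar>x\<bar> * \<bar>x\<bar>" by (smt (verit) mult_le_cancel_left1)
    then have "2 * C \<le> 1 + x\<^sup>2" by (simp add: R_def power2_eq_square)
    then have "C / (1 + x\<^sup>2) \<le> 1 / 2" by (simp add: divide_le_eq add_pos_nonneg)
    with C(2)[OF t, of x] show ?thesis by linarith
  qed
  have "compact ({0..T} \<times> {-R..R})" by (intro compact_Times) auto
  moreover have "{0..T} \<times> {-R..R} \<noteq> {}" using T C by (auto simp: R_def)
  moreover have "continuous_on ({0..T} \<times> {-R..R}) (\<lambda>(t, x). X t x)"
    using cont_UXPQ(2) by (rule continuous_on_subset) auto
  ultimately obtain z where z: "z \<in> {0..T} \<times> {-R..R}"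
    "\<And>y. y \<in> {0..T} \<times> {-R..R} \<Longrightarrow> (\<lambda>(t, x). X t x) z \<le> (\<lambda>(t, x). X t x) y"
    using continuous_attains_inf by metis
  obtain t0 x0 where tx: "z = (t0, x0)" by (cases z)
  show ?thesis
  proof (rule that[of "min (1/2) (X t0 x0)"])
    show "0 < min (1 / 2) (X t0 x0)" using X_pos z tx by auto
    fix t x assume t: "t \<in> {0..T}"
    show "min (1 / 2) (X t0 x0) \<le> X t x"
    proof (cases "x \<in> {-R..R}")
      case True then show ?thesis using z(2)[of "(t, x)"] t tx by auto
    next
      case False then show ?thesis by (intro min.coboundedI1 out[OF t])
    qed
  qed
qed

section \<open>Energy and cocycle density along a path\<close>

lemma continuous_energy_integrand:
  "continuous_on ({0..T} \<times> UNIV) (\<lambda>(t, x). (U t x)\<^sup>2 * X t x)"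
  using cont_UXPQ by (auto simp: case_prod_beta intro!: continuous_intros)

lemma continuous_cocycle_integrand:
  "continuous_on ({0..T} \<times> UNIV) (\<lambda>(t, x). P t x * Q t x / (X t x)\<^sup>2)"
  using cont_UXPQ unfolding case_prod_beta
  by (intro continuous_on_divide continuous_on_mult continuous_on_power)
     (auto simp: less_imp_neq[OF X_pos, symmetric])

text \<open>One decaying factor suffices; the others are merely bounded.\<close>

lemma energy_integrand_decay:
  obtains C where "\<And>t x. t \<in> {0..T} \<Longrightarrow> \<bar>(U t x)\<^sup>2 * X t x\<bar> \<le> C / (1 + x\<^sup>2)"
proof -
  obtain C where C: "0 \<le> C" "\<And>t x. t \<in> {0..T} \<Longrightarrow> \<bar>U t x\<bar> \<le> C / (1 + x\<^sup>2)"
    "\<And>t x. t \<in> {0..T} \<Longrightarrow> \<bar>X t x - 1\<bar> \<le> C / (1 + x\<^sup>2)"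
    using decay by metis
  have le: "C / (1 + x\<^sup>2) \<le> C" for x
    using C(1) by (simp add: divide_le_eq add_pos_nonneg mult_left_mono algebra_simps)
  show ?thesis
  proof (rule that)
    fix t x assume t: "t \<in> {0..T}"
    have "\<bar>X t x\<bar> \<le> 1 + C" using C(3)[OF t, of x] le[of x] by linarith
    moreover have "\<bar>U t x\<bar> \<le> C" using C(2)[OF t, of x] le[of x] by linarith
    ultimately have "\<bar>U t x\<bar> * (\<bar>U t x\<bar> * \<bar>X t x\<bar>) \<le> C / (1 + x\<^sup>2) * (C * (1 + C))"
      using C by (intro mult_mono C(2)[OF t]) auto
    then show "\<bar>(U t x)\<^sup>2 * X t x\<bar> \<le> (C * C * (1 + C)) / (1 + x\<^sup>2)"
      by (simp add: abs_mult power2_eq_square algebra_simps)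
  qed
qed

lemma cocycle_integrand_decay:
  obtains C where "\<And>t x. t \<in> {0..T} \<Longrightarrow> \<bar>P t x * Q t x / (X t x)\<^sup>2\<bar> \<le> C / (1 + x\<^sup>2)"
proof -
  obtain C where C: "0 \<le> C" "\<And>t x. t \<in> {0..T} \<Longrightarrow> \<bar>P t x\<bar> \<le> C / (1 + x\<^sup>2)"
    "\<And>t x. t \<in> {0..T} \<Longrightarrow> \<bar>Q t x\<bar> \<le> C / (1 + x\<^sup>2)"
    using decay by metis
  obtain c where c: "0 < c" "\<And>t x. t \<in> {0..T} \<Longrightarrow> c \<le> X t x" using X_bounded_below by metis
  have le: "C / (1 + x\<^sup>2) \<le> C" for x
    using C(1) by (simp add: divide_le_eq add_pos_nonneg mult_left_mono algebra_simps)
  show ?thesis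
  proof (rule that)
    fix t x assume t: "t \<in> {0..T}"
    have "\<bar>Q t x\<bar> \<le> C" using C(3)[OF t, of x] le[of x] by linarith
    then have "\<bar>P t x\<bar> * \<bar>Q t x\<bar> \<le> C / (1 + x\<^sup>2) * C"
      using C by (intro mult_mono C(2)[OF t]) auto
    moreover have "c\<^sup>2 \<le> (X t x)\<^sup>2" using c(2)[OF t] c(1) by (intro power_mono) auto
    ultimately have "\<bar>P t x\<bar> * \<bar>Q t x\<bar> / (X t x)\<^sup>2 \<le> (C / (1 + x\<^sup>2) * C) / c\<^sup>2"
      using C(1) c(1) by (intro frac_le) (auto simp: add_pos_nonneg)
    then show "\<bar>P t x * Q t x / (X t x)\<^sup>2\<bar> \<le> (C * C / c\<^sup>2) / (1 + x\<^sup>2)"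
      by (simp add: abs_mult field_simps)
  qed
qed

lemma energy_eq: "Diff_energy_density T \<phi> t = (LINT x|lborel. (U t x)\<^sup>2 * X t x)"
  by (simp add: Diff_energy_density_def U_def X_def)

lemma cocycle_eq: "cocycle_density T \<phi> t = (LINT x|lborel. P t x * Q t x / (X t x)\<^sup>2)"
  by (simp add: cocycle_density_def P_def Q_def X_def)

lemma integrable_energy: "t \<in> {0..T} \<Longrightarrow> integrable lborel (\<lambda>x. (U t x)\<^sup>2 * X t x)"
  by (rule energy_integrand_decay) (rule integrable_decaying[OF continuous_energy_integrand])

lemma continuous_energy: "continuous_on {0..T} (Diff_energy_density T \<phi>)"
proof -
  have "Diff_energy_density T \<phi> = (\<lambda>t. LINT x|lborel. (U t x)\<^sup>2 * X t x)" by (rule ext) (rule energy_eq)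
  moreover obtain C where "\<And>t x. t \<in> {0..T} \<Longrightarrow> \<bar>(U t x)\<^sup>2 * X t x\<bar> \<le> C / (1 + x\<^sup>2)"
    using energy_integrand_decay by blast
  ultimately show ?thesis
    using continuous_on_LINT_decaying[OF continuous_energy_integrand, of C] by simp
qed

lemma integrable_cocycle: "t \<in> {0..T} \<Longrightarrow> integrable lborel (\<lambda>x. P t x * Q t x / (X t x)\<^sup>2)"
  by (rule cocycle_integrand_decay) (rule integrable_decaying[OF continuous_cocycle_integrand])

lemma continuous_cocycle: "continuous_on {0..T} (cocycle_density T \<phi>)"
proof -
  have "cocycle_density T \<phi> = (\<lambda>t. LINT x|lborel. P t x * Q t x / (X t x)\<^sup>2)" by (rule ext) (rule cocycle_eq)
  moreover obtain C where "\<And>t x. t \<in> {0..T} \<Longrightarrow> \<bar>P t x * Q t x / (X t x)\<^sup>2\<bar> \<le> C / (1 + x\<^sup>2)"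
    using cocycle_integrand_decay by blast
  ultimately show ?thesis
    using continuous_on_LINT_decaying[OF continuous_cocycle_integrand, of C] by simp
qed

lemma energy_nonneg: "t \<in> {0..T} \<Longrightarrow> 0 \<le> Diff_energy_density T \<phi> t"
  unfolding energy_eq
  by (intro integral_nonneg_AE AE_I2 mult_nonneg_nonneg zero_le_power2 less_imp_le[OF X_pos])

text \<open>If the integral of this nonnegative function were zero, \<open>U t\<close> would vanish
  almost everywhere; its zero set is closed, and a closed set of full measure contains every
  point.\<close>

lemma energy_pos:
  assumes t: "t \<in> {0..T}" and x: "U t x \<noteq> 0"
  shows "0 < Diff_energy_density T \<phi> t"
proof -
  have "Diff_energy_density T \<phi> t \<noteq> 0"
  proof
    assume "Diff_energy_density T \<phi> t = 0"
    then have "AE x in lborel. (U t x)\<^sup>2 * X t x = 0"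
      using integral_nonneg_eq_0_iff_AE[OF integrable_energy[OF t]] X_pos[OF t]
      by (simp add: energy_eq less_imp_le)
    then have "AE y in lborel. y \<in> {y. U t y = 0}"
      using less_imp_neq[OF X_pos[OF t], symmetric] by simp
    then have "AE y in lebesgue. y \<in> {y. U t y = 0}" by (rule AE_completion)
    moreover have "closed {y. U t y = 0}"
      by (intro closed_Collect_eq continuous_on_slice[OF cont_UXPQ(1) t] continuous_on_const)
    ultimately have "x \<in> {y. U t y = 0}" by (rule mem_closed_if_AE_lebesgue[rotated])
    with x show False by auto
  qed
  with energy_nonneg[OF t] show ?thesis by simp
qed

end


section \<open>Compactly supported perturbations\<close>

lemma partial_x_zero_near:
  assumes "open S" "x \<in> S" "\<And>y. y \<in> S \<Longrightarrow> h t y = 0"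
  shows "partial_x h t x = 0"
proof -
  have "eventually (\<lambda>y. h t y = 0) (nhds x)"
    using eventually_nhds_in_open[OF assms(1,2)] assms(3) by (rule eventually_mono)
  then have "deriv (h t) x = deriv (\<lambda>y. 0) x" by (rule deriv_cong_ev) simp
  then show ?thesis by (simp add: partial_x_def)
qed

lemma partial_t_zero_near:
  assumes T: "0 < T" and t: "t \<in> {0..T}" and S: "open S" "t \<in> S"
    and z: "\<And>s. s \<in> S \<Longrightarrow> s \<in> {0..T} \<Longrightarrow> h s x = 0"
  shows "partial_t T h t x = 0"
proof (rule partial_t_eqI[OF T t])
  have "eventually (\<lambda>s. s \<in> S) (nhds t)" using S by (rule eventually_nhds_in_open)
  then have ev: "\<forall>\<^sub>F s in nhds t. s \<in> {0..T} \<longrightarrow> (\<lambda>s. 0) s = h s x"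
    by (rule eventually_mono) (use z in auto)
  show "((\<lambda>s. h s x) has_vector_derivative 0) (at t within {0..T})"
    by (rule iffD1[OF has_vector_derivative_cong_ev[OF ev] has_vector_derivative_const])
       (use z S t in simp)
qed

lemma smooth_strip_smooth_line:
  assumes h: "smooth_strip T h" and t: "t \<in> {0..T}"
  shows "smooth_line (h t)"
proof -
  have eq: "(deriv ^^ i) (h t) = (partial_x ^^ i) h t" for i
    by (induction i) (auto simp: partial_x_def)
  have "(partial_x ^^ i) h t differentiable at x" for i x
    using smooth_strip_has_partial_x[OF smooth_strip_partial_x_funpow[OF h] t]
    by (meson real_differentiable_def)
  then show ?thesis unfolding smooth_line_def eq by blast
qed

lemma continuous_on_strip_compose:
  assumes "continuous_on ({0..T} \<times> UNIV) (\<lambda>(t, x). h t x)"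
    and "continuous_on A g1" "continuous_on A g2" "\<And>z. z \<in> A \<Longrightarrow> g1 z \<in> {0..T}"
  shows "continuous_on A (\<lambda>z. h (g1 z) (g2 z))"
proof -
  have "continuous_on A (\<lambda>z. (g1 z, g2 z))" using assms by (intro continuous_intros)
  moreover have "(\<lambda>z. (g1 z, g2 z)) ` A \<subseteq> {0..T} \<times> UNIV" using assms(4) by blast
  ultimately show ?thesis using continuous_on_compose2[OF assms(1), of A "\<lambda>z. (g1 z, g2 z)"] by simp
qed

text \<open>Support strictly inside the time interval keeps the end points of the path fixed.
  Because the supporting rectangle is closed, the derivatives of \<eta> also vanish outside it. The
  letters \<open>V\<close>, \<open>Y\<close>, \<open>p\<close>, \<open>R\<close> correspond to
  \<open>U\<close>, \<open>X\<close>, \<open>P\<close>, \<open>Q\<close>.\<close>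

locale perturbation = diff_path +
  fixes \<eta> :: "real \<Rightarrow> real \<Rightarrow> real" and c d t1 t2 :: real
  assumes smooth_eta: "smooth_strip T \<eta>"
    and J: "0 < t1" "t1 < t2" "t2 < T"
    and supp: "\<And>t x. t \<in> {0..T} \<Longrightarrow> t \<notin> {t1..t2} \<or> x \<notin> {c..d} \<Longrightarrow> \<eta> t x = 0"
begin

definition "V = partial_t T \<eta>"
definition "Y = partial_x \<eta>"
definition "p = partial_x (partial_t T \<eta>)"
definition "R = partial_x (partial_x \<eta>)"

lemma smooth_VYpR: "smooth_strip T V" "smooth_strip T Y" "smooth_strip T p" "smooth_strip T R"
  by (auto simp: V_def Y_def p_def R_def intro!: smooth_strip_partial_t smooth_strip_partial_x smooth_eta)

lemmas cont_VYpR = smooth_VYpR[THEN smooth_strip_continuous]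

lemma vanish_partial_x:
  assumes z: "\<And>t x. t \<in> {0..T} \<Longrightarrow> t \<notin> {t1..t2} \<or> x \<notin> {c..d} \<Longrightarrow> h t x = 0"
    and t: "t \<in> {0..T}" "t \<notin> {t1..t2} \<or> x \<notin> {c..d}"
  shows "partial_x h t x = 0"
proof (cases "t \<in> {t1..t2}")
  case True
  then show ?thesis
    using t z by (intro partial_x_zero_near[of "- {c..d}"]) auto
next
  case False
  then show ?thesis using t z by (intro partial_x_zero_near[of UNIV]) auto
qed

lemma vanish_partial_t:
  assumes z: "\<And>t x. t \<in> {0..T} \<Longrightarrow> t \<notin> {t1..t2} \<or> x \<notin> {c..d} \<Longrightarrow> h t x = 0"
    and t: "t \<in> {0..T}" "t \<notin> {t1..t2} \<or> x \<notin> {c..d}"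
  shows "partial_t T h t x = 0"
proof (cases "x \<in> {c..d}")
  case True
  then show ?thesis
    using t z T by (intro partial_t_zero_near[of _ _ "- {t1..t2}"]) auto
next
  case False
  then show ?thesis using t z T by (intro partial_t_zero_near[of _ _ UNIV]) auto
qed

lemma vanish_VYpR:
  assumes "t \<in> {0..T}" "t \<notin> {t1..t2} \<or> x \<notin> {c..d}"
  shows "V t x = 0" "Y t x = 0" "p t x = 0" "R t x = 0"
  unfolding V_def Y_def p_def R_def
  by (rule vanish_partial_x vanish_partial_t supp assms | assumption)+

definition \<psi> where "\<psi> s = (\<lambda>t x. \<phi> t x + s * \<eta> t x)"

lemma psi_partials:
  assumes t: "t \<in> {0..T}"
  shows "partial_t T (\<psi> s) t x = U t x + s * V t x"
    and "partial_x (\<psi> s) t x = X t x + s * Y t x"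
    and "partial_x (partial_t T (\<psi> s)) t x = P t x + s * p t x"
    and "partial_x (partial_x (\<psi> s)) t x = Q t x + s * R t x"
proof -
  have pt: "partial_t T (\<psi> s) t x = U t x + s * V t x" for x
    using partial_funpow_lincomb[OF T smooth smooth_eta t, of 0 1] by (simp add: \<psi>_def U_def V_def)
  then show "partial_t T (\<psi> s) t x = U t x + s * V t x" .
  show "partial_x (\<psi> s) t x = X t x + s * Y t x"
    using partial_funpow_lincomb[OF T smooth smooth_eta t, of 1 0] by (simp add: \<psi>_def X_def Y_def)
  show "partial_x (partial_t T (\<psi> s)) t x = P t x + s * p t x"
    using partial_funpow_lincomb[OF T smooth smooth_eta t, of 1 1] by (simp add: \<psi>_def P_def p_def)
  show "partial_x (partial_x (\<psi> s)) t x = Q t x + s * R t x"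
    using partial_funpow_lincomb[OF T smooth smooth_eta t, of 2 0]
    by (simp add: \<psi>_def Q_def R_def numeral_2_eq_2)
qed

lemma eta_schwartz: "\<eta> \<in> schwartz_strip T"
  using smooth_strip_compact_support[OF T smooth_eta, of c d] supp by blast

lemma psi_path_if_pos:
  assumes pos: "\<And>t x. t \<in> {0..T} \<Longrightarrow> 0 < X t x + s * Y t x"
  shows "Diff_path T (\<psi> s)"
proof -
  have sm: "smooth_strip T (\<psi> s)" unfolding \<psi>_def by (rule smooth_strip_lincomb[OF T smooth smooth_eta])
  have "(\<lambda>t x. \<phi> t x - x) \<in> schwartz_strip T" using path by (simp add: Diff_path_def)
  from schwartz_strip_lincomb[OF T this eta_schwartz, of s]
  have sch: "(\<lambda>t x. \<psi> s t x - x) \<in> schwartz_strip T" by (simp add: \<psi>_def algebra_simps)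
  have "\<psi> s t \<in> Diff_S" if t: "t \<in> {0..T}" for t
  proof -
    have "\<phi> t \<in> Diff_S" using path t by (simp add: Diff_path_def)
    then obtain f where f: "f \<in> schwartz_line" "\<phi> t = (\<lambda>x. x + f x)" by (auto simp: Diff_S_def)
    have se: "smooth_line (\<lambda>x. s * \<eta> t x)"
      by (intro smooth_line_mult smooth_line_const smooth_strip_smooth_line[OF smooth_eta t])
    have "(\<lambda>x. s * \<eta> t x) \<in> schwartz_line"
      by (rule schwartz_line_compact_support[OF se, of c d]) (use supp t in auto)
    with f(1) have g: "(\<lambda>x. f x + s * \<eta> t x) \<in> schwartz_line" by (rule schwartz_line_add)
    have eq: "\<psi> s t = (\<lambda>x. x + (f x + s * \<eta> t x))" using f(2) by (auto simp: \<psi>_def)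
    have "0 < 1 + deriv (\<lambda>x. f x + s * \<eta> t x) x" for x
    proof -
      have "((\<lambda>x. x + (f x + s * \<eta> t x)) has_real_derivative 1 + deriv (\<lambda>x. f x + s * \<eta> t x) x) (at x)"
        using g by (intro derivative_intros smooth_line_has_derivative) (simp add: schwartz_line_def)
      then have "partial_x (\<psi> s) t x = 1 + deriv (\<lambda>x. f x + s * \<eta> t x) x"
        by (intro partial_x_eqI) (simp add: eq)
      with pos[OF t, of x] psi_partials(2)[OF t] show ?thesis by simp
    qed
    with g show ?thesis unfolding eq by (rule Diff_S_I)
  qed
  with sm sch show ?thesis by (simp add: Diff_path_def)
qed

lemma psi_path:
  obtains s0 where "0 < s0" "\<And>s t x. \<bar>s\<bar> \<le> s0 \<Longrightarrow> t \<in> {0..T} \<Longrightarrow> 0 < X t x + s * Y t x"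
    "\<And>s. \<bar>s\<bar> \<le> s0 \<Longrightarrow> Diff_path T (\<psi> s)"
proof -
  obtain C where C: "0 < C" "\<And>t x. t \<in> {0..T} \<Longrightarrow> C \<le> X t x" using X_bounded_below by metis
  obtain M where M: "0 \<le> M" "\<And>t x. t \<in> {0..T} \<Longrightarrow> \<bar>Y t x\<bar> \<le> M / (1 + x\<^sup>2)"
    using schwartz_strip_weight[OF eta_schwartz, of 1 0] by (auto simp: Y_def)
  have le: "M / (1 + x\<^sup>2) \<le> M" for x
    using M(1) by (simp add: divide_le_eq add_pos_nonneg mult_left_mono algebra_simps)
  \<comment> \<open>Chosen so that \<open>s * Y\<close> uses at most half of the lower bound
    \<open>C\<close> of \<open>X\<close>; adding 1 avoids a zero denominator. The range of
    \<open>s\<close> is symmetric because both signs are compared later.\<close>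
  define s0 where "s0 = C / (2 * (M + 1))"
  have s0: "0 < s0" using C M by (simp add: s0_def)
  have pos: "0 < X t x + s * Y t x" if "\<bar>s\<bar> \<le> s0" and t: "t \<in> {0..T}" for s t x
  proof -
    have "\<bar>Y t x\<bar> \<le> M + 1" using order_trans[OF M(2)[OF t] le] by (rule order_trans) simp
    then have "\<bar>s * Y t x\<bar> \<le> s0 * (M + 1)"
      unfolding abs_mult using that by (intro mult_mono) auto
    also have "\<dots> = C / 2" using M by (simp add: s0_def field_simps)
    finally show ?thesis using C(2)[OF t, of x] C(1) by linarith
  qed
  show ?thesis by (rule that[OF s0 pos psi_path_if_pos[OF pos]])
qed

text \<open>Over the common denominator, the numerator of the difference of cocycle integrands of
  \<open>\<psi> s\<close> and \<phi> is \<open>s * (n0 t x + s * n1 t x)\<close>.\<close>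

definition "n0 t x = (X t x)\<^sup>2 * (P t x * R t x + Q t x * p t x) - 2 * P t x * Q t x * X t x * Y t x"
definition "n1 t x = (X t x)\<^sup>2 * p t x * R t x - P t x * Q t x * (Y t x)\<^sup>2"

text \<open>With \<open>f\<^sub>s\<close> the integrand of the cocycle term along \<open>\<psi> s\<close>, \<open>f\<^sub>s - f\<^sub>0 = s * \<kappa> s\<close> and
  \<open>\<kappa> s - \<kappa> (- s) = s * \<kappa>2 s\<close>; both quotients make sense at \<open>s = 0\<close>.\<close>

definition "\<kappa> s t x = (n0 t x + s * n1 t x) / ((X t x)\<^sup>2 * (X t x + s * Y t x)\<^sup>2)"
definition "\<kappa>2 s t x = (2 * n1 t x * ((X t x)\<^sup>2 + s\<^sup>2 * (Y t x)\<^sup>2) - 4 * n0 t x * X t x * Y t x) /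
  ((X t x)\<^sup>2 * ((X t x)\<^sup>2 - s\<^sup>2 * (Y t x)\<^sup>2)\<^sup>2)"

definition "e2 t = integral {c..d} (\<lambda>x. (V t x)\<^sup>2 * X t x + 2 * U t x * V t x * Y t x)"
definition "k1 s t = integral {c..d} (\<kappa> s t)"
definition "k2 s t = integral {c..d} (\<kappa>2 s t)"

text \<open>The symmetric second difference of the squared speed divided by s^2, written so that it
  makes sense at \<open>s = 0\<close>, where it is the second variation. Here \<open>a\<close>
  stands for the central velocity.\<close>

definition "W \<theta> a s t = 2 * e2 t + \<theta> * (- 2 * a t * k2 s t + (k1 s t)\<^sup>2 + (k1 (- s) t)\<^sup>2)"

lemma kappa_difference:
  assumes "X t x \<noteq> 0" "X t x + s * Y t x \<noteq> 0"
  shows "(P t x + s * p t x) * (Q t x + s * R t x) / (X t x + s * Y t x)\<^sup>2 - P t x * Q t x / (X t x)\<^sup>2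
    = s * \<kappa> s t x"
proof -
  have "((P t x + s * p t x) * (Q t x + s * R t x)) * (X t x)\<^sup>2 - P t x * Q t x * (X t x + s * Y t x)\<^sup>2
      = s * (n0 t x + s * n1 t x)"
    unfolding n0_def n1_def by (simp add: power2_eq_square algebra_simps)
  with assms show ?thesis by (simp add: \<kappa>_def diff_frac_eq mult.commute)
qed

text \<open>With denominators \<open>A\<close> and \<open>B\<close> for \<open>s\<close> and
  \<open>- s\<close>, the terms of even order in \<open>s\<close> cancel in the cross-multiplied
  numerators, which leaves the factor \<open>s\<close>.\<close>

lemma kappa2_difference:
  assumes "X t x \<noteq> 0" "X t x + s * Y t x \<noteq> 0" "X t x - s * Y t x \<noteq> 0"
  shows "\<kappa> s t x - \<kappa> (- s) t x = s * \<kappa>2 s t x"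
proof -
  define A where "A = X t x + s * Y t x"
  define B where "B = X t x - s * Y t x"
  define Z where "Z = X t x"
  have Z: "Z \<noteq> 0" "A \<noteq> 0" "B \<noteq> 0" using assms by (auto simp: A_def B_def Z_def)
  have AB: "(X t x)\<^sup>2 - s\<^sup>2 * (Y t x)\<^sup>2 = A * B" by (simp add: A_def B_def power2_eq_square algebra_simps)
  have "(n0 t x + s * n1 t x) * B\<^sup>2 - (n0 t x - s * n1 t x) * A\<^sup>2 =
      s * (2 * n1 t x * ((X t x)\<^sup>2 + s\<^sup>2 * (Y t x)\<^sup>2) - 4 * n0 t x * X t x * Y t x)"
    unfolding A_def B_def by (simp add: power2_eq_square algebra_simps)
  then have "s * \<kappa>2 s t x = ((n0 t x + s * n1 t x) * B\<^sup>2 - (n0 t x - s * n1 t x) * A\<^sup>2) / (Z\<^sup>2 * (A * B)\<^sup>2)"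
    unfolding \<kappa>2_def AB Z_def by simp
  also have "\<dots> = (n0 t x + s * n1 t x) / (Z\<^sup>2 * A\<^sup>2) - (n0 t x - s * n1 t x) / (Z\<^sup>2 * B\<^sup>2)"
    using Z by (simp add: field_simps power_mult_distrib)
  finally show ?thesis unfolding \<kappa>_def Z_def A_def B_def by simp
qed

section \<open>Differences of energy and cocycle density along the perturbed paths\<close>

lemma psi_diff_path: "Diff_path T (\<psi> s) \<Longrightarrow> diff_path T (\<psi> s)"
  using T by unfold_locales

lemma psi_energy:
  assumes "Diff_path T (\<psi> s)" and t: "t \<in> {0..T}"
  shows "integrable lborel (\<lambda>x. (U t x + s * V t x)\<^sup>2 * (X t x + s * Y t x))"
    and "Diff_energy_density T (\<psi> s) t = (LINT x|lborel. (U t x + s * V t x)\<^sup>2 * (X t x + s * Y t x))"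
proof -
  interpret S: diff_path T "\<psi> s" using assms(1) by (rule psi_diff_path)
  show "integrable lborel (\<lambda>x. (U t x + s * V t x)\<^sup>2 * (X t x + s * Y t x))"
    using S.integrable_energy[OF t] unfolding S.U_def S.X_def psi_partials[OF t] .
  show "Diff_energy_density T (\<psi> s) t = (LINT x|lborel. (U t x + s * V t x)\<^sup>2 * (X t x + s * Y t x))"
    using S.energy_eq[of t] unfolding S.U_def S.X_def psi_partials[OF t] .
qed

lemma psi_cocycle:
  assumes "Diff_path T (\<psi> s)" and t: "t \<in> {0..T}"
  shows "integrable lborel (\<lambda>x. (P t x + s * p t x) * (Q t x + s * R t x) / (X t x + s * Y t x)\<^sup>2)"
    and "cocycle_density T (\<psi> s) t =
      (LINT x|lborel. (P t x + s * p t x) * (Q t x + s * R t x) / (X t x + s * Y t x)\<^sup>2)"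
proof -
  interpret S: diff_path T "\<psi> s" using assms(1) by (rule psi_diff_path)
  show "integrable lborel (\<lambda>x. (P t x + s * p t x) * (Q t x + s * R t x) / (X t x + s * Y t x)\<^sup>2)"
    using S.integrable_cocycle[OF t] unfolding S.P_def S.Q_def S.X_def psi_partials[OF t] .
  show "cocycle_density T (\<psi> s) t =
      (LINT x|lborel. (P t x + s * p t x) * (Q t x + s * R t x) / (X t x + s * Y t x)\<^sup>2)"
    using S.cocycle_eq[of t] unfolding S.P_def S.Q_def S.X_def psi_partials[OF t] .
qed

lemma cont_slice:
  assumes t: "t \<in> {0..T}"
  shows "continuous_on A (U t)" "continuous_on A (X t)" "continuous_on A (P t)" "continuous_on A (Q t)"
    "continuous_on A (V t)" "continuous_on A (Y t)" "continuous_on A (p t)" "continuous_on A (R t)"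
  using cont_UXPQ[THEN continuous_on_slice, OF t] cont_VYpR[THEN continuous_on_slice, OF t] by auto

text \<open>Exact, without remainder: the integrand is cubic in \<open>s\<close>, and the linear and
  cubic terms cancel between \<open>s\<close> and \<open>- s\<close>.\<close>

lemma energy_second_difference:
  assumes s: "Diff_path T (\<psi> s)" "Diff_path T (\<psi> (- s))" and t: "t \<in> {0..T}"
  shows "Diff_energy_density T (\<psi> s) t + Diff_energy_density T (\<psi> (- s)) t
    - 2 * Diff_energy_density T \<phi> t = 2 * s\<^sup>2 * e2 t"
proof -
  let ?f = "\<lambda>s x. (U t x + s * V t x)\<^sup>2 * (X t x + s * Y t x)"
  let ?g = "\<lambda>x. (V t x)\<^sup>2 * X t x + 2 * U t x * V t x * Y t x"
  have e2: "e2 t = (LINT x|lborel. ?g x)"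
    unfolding e2_def
    by (rule LINT_compact_support_eq[symmetric])
       (use vanish_VYpR[OF t] in \<open>auto intro!: continuous_intros cont_slice[OF t]\<close>)
  have "Diff_energy_density T (\<psi> s) t + Diff_energy_density T (\<psi> (- s)) t - 2 * Diff_energy_density T \<phi> t
     = (LINT x|lborel. ?f s x + ?f (- s) x - 2 * ((U t x)\<^sup>2 * X t x))"
    using psi_energy[OF s(1) t] psi_energy[OF s(2) t] integrable_energy[OF t] energy_eq[of t]
    by simp
  also have "\<dots> = (LINT x|lborel. 2 * s\<^sup>2 * ?g x)"
    by (intro Bochner_Integration.integral_cong refl) (simp add: power2_eq_square algebra_simps)
  finally show ?thesis by (simp add: e2)
qed

text \<open>Stated along arbitrary parametrisations of \<open>s\<close>, \<open>t\<close>,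
  \<open>x\<close>, to cover both slices and joint continuity. The denominator of
  \<open>\<kappa>2\<close> factors into the space derivatives for \<open>s\<close> and
  \<open>- s\<close>, both positive by the symmetric range.\<close>

lemma kappa_continuous:
  assumes pos: "\<And>s t x. \<bar>s\<bar> \<le> s0 \<Longrightarrow> t \<in> {0..T} \<Longrightarrow> 0 < X t x + s * Y t x"
    and g: "continuous_on A g0" "continuous_on A g1" "continuous_on A g2"
    "\<And>z. z \<in> A \<Longrightarrow> \<bar>g0 z\<bar> \<le> s0" "\<And>z. z \<in> A \<Longrightarrow> g1 z \<in> {0..T}"
  shows "continuous_on A (\<lambda>z. \<kappa> (g0 z) (g1 z) (g2 z))" "continuous_on A (\<lambda>z. \<kappa>2 (g0 z) (g1 z) (g2 z))"
proof -
  note c = cont_UXPQ[THEN continuous_on_strip_compose, OF g(2,3,5)]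
    cont_VYpR[THEN continuous_on_strip_compose, OF g(2,3,5)]
  have nz: "X (g1 z) (g2 z) \<noteq> 0" "X (g1 z) (g2 z) + g0 z * Y (g1 z) (g2 z) \<noteq> 0"
    "X (g1 z) (g2 z) - g0 z * Y (g1 z) (g2 z) \<noteq> 0" if "z \<in> A" for z
    using pos[OF g(4)[OF that] g(5)[OF that], of "g2 z"] pos[of "- g0 z", OF _ g(5)[OF that], of "g2 z"]
      g(4)[OF that] X_pos[OF g(5)[OF that], of "g2 z"] by auto
  have nz2: "(X (g1 z) (g2 z))\<^sup>2 - (g0 z)\<^sup>2 * (Y (g1 z) (g2 z))\<^sup>2 \<noteq> 0" if "z \<in> A" for z
  proof -
    have "(X (g1 z) (g2 z))\<^sup>2 - (g0 z)\<^sup>2 * (Y (g1 z) (g2 z))\<^sup>2 =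
        (X (g1 z) (g2 z) + g0 z * Y (g1 z) (g2 z)) * (X (g1 z) (g2 z) - g0 z * Y (g1 z) (g2 z))"
      by (simp add: power2_eq_square algebra_simps)
    then show ?thesis using nz[OF that] by simp
  qed
  show "continuous_on A (\<lambda>z. \<kappa> (g0 z) (g1 z) (g2 z))"
    unfolding \<kappa>_def n0_def n1_def
    by (intro continuous_on_divide continuous_on_mult continuous_on_add continuous_on_diff
        continuous_on_power continuous_on_const c g(1) ballI no_zero_divisors power_not_zero nz)
  show "continuous_on A (\<lambda>z. \<kappa>2 (g0 z) (g1 z) (g2 z))"
    unfolding \<kappa>2_def n0_def n1_def
    by (intro continuous_on_divide continuous_on_mult continuous_on_add continuous_on_diff
        continuous_on_power continuous_on_const c g(1) ballI no_zero_divisors power_not_zero nz nz2)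
qed

lemma kappa_zero_outside:
  assumes "t \<in> {0..T}" "x \<notin> {c..d}"
  shows "\<kappa> s t x = 0" "\<kappa>2 s t x = 0"
  using assms vanish_VYpR[of t x] by (auto simp: \<kappa>_def \<kappa>2_def n0_def n1_def)

context
  fixes s0 :: real
  assumes s0: "0 < s0" and pos: "\<And>s t x. \<bar>s\<bar> \<le> s0 \<Longrightarrow> t \<in> {0..T} \<Longrightarrow> 0 < X t x + s * Y t x"
    and paths: "\<And>s. \<bar>s\<bar> \<le> s0 \<Longrightarrow> Diff_path T (\<psi> s)"
begin

lemma kappa_continuous_slice:
  assumes "\<bar>s\<bar> \<le> s0" "t \<in> {0..T}"
  shows "continuous_on A (\<kappa> s t)" "continuous_on A (\<kappa>2 s t)"
  using kappa_continuous[OF pos, where A = A and ?g0.0 = "\<lambda>x. s" and ?g1.0 = "\<lambda>x. t" and ?g2.0 = "\<lambda>x. x"]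
    assms by auto

text \<open>Neither density is an integral over a compact set, but the integrands agree outside
  \<open>{c..d}\<close>, so their difference is.\<close>

lemma cocycle_difference:
  assumes s: "\<bar>s\<bar> \<le> s0" and t: "t \<in> {0..T}"
  shows "cocycle_density T (\<psi> s) t - cocycle_density T \<phi> t = s * k1 s t"
proof -
  have "cocycle_density T (\<psi> s) t - cocycle_density T \<phi> t = (LINT x|lborel.
      (P t x + s * p t x) * (Q t x + s * R t x) / (X t x + s * Y t x)\<^sup>2 - P t x * Q t x / (X t x)\<^sup>2)"
    using psi_cocycle[OF paths[OF s] t] integrable_cocycle[OF t] cocycle_eq[of t] by simp
  also have "\<dots> = (LINT x|lborel. s * \<kappa> s t x)"
    using pos[OF s t] X_pos[OF t]
    by (intro Bochner_Integration.integral_cong refl kappa_difference) (auto simp: less_imp_neq[symmetric])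
  also have "\<dots> = s * k1 s t"
    using LINT_compact_support_eq[OF kappa_continuous_slice(1)[OF s t], of c d] kappa_zero_outside(1)[OF t]
    by (simp add: k1_def)
  finally show ?thesis .
qed

lemma k1_difference:
  assumes s: "\<bar>s\<bar> \<le> s0" and t: "t \<in> {0..T}"
  shows "k1 s t - k1 (- s) t = s * k2 s t"
proof -
  have s': "\<bar>- s\<bar> \<le> s0" using s by simp
  have "k1 s t - k1 (- s) t = integral {c..d} (\<lambda>x. \<kappa> s t x - \<kappa> (- s) t x)"
    unfolding k1_def
    by (intro Henstock_Kurzweil_Integration.integral_diff[symmetric] integrable_continuous_real
        kappa_continuous_slice s s' t)
  also have "\<dots> = integral {c..d} (\<lambda>x. s * \<kappa>2 s t x)"
    using pos[OF s t] pos[OF s' t] X_pos[OF t]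
    by (intro Henstock_Kurzweil_Integration.integral_cong kappa2_difference)
       (auto simp: less_imp_neq[symmetric])
  finally show ?thesis by (simp add: k2_def)
qed

lemma k_continuous:
  "continuous_on ({-s0..s0} \<times> {0..T}) (\<lambda>z. k1 (fst z) (snd z))"
  "continuous_on ({-s0..s0} \<times> {0..T}) (\<lambda>z. k2 (fst z) (snd z))"
proof -
  let ?A = "({-s0..s0} \<times> {0..T}) \<times> cbox c d"
  have "continuous_on ?A (\<lambda>z. \<kappa> (fst (fst z)) (snd (fst z)) (snd z))"
    by (rule kappa_continuous[OF pos]) (auto intro!: continuous_intros)
  then show "continuous_on ({-s0..s0} \<times> {0..T}) (\<lambda>z. k1 (fst z) (snd z))"
    unfolding k1_def box_real[symmetric]
    by (intro integral_continuous_on_param) (simp add: case_prod_beta)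
  have "continuous_on ?A (\<lambda>z. \<kappa>2 (fst (fst z)) (snd (fst z)) (snd z))"
    by (rule kappa_continuous[OF pos]) (auto intro!: continuous_intros)
  then show "continuous_on ({-s0..s0} \<times> {0..T}) (\<lambda>z. k2 (fst z) (snd z))"
    unfolding k2_def box_real[symmetric]
    by (intro integral_continuous_on_param) (simp add: case_prod_beta)
qed

end

lemma e2_continuous: "continuous_on {0..T} e2"
proof -
  have "continuous_on ({0..T} \<times> cbox c d) (\<lambda>(t, x). (V t x)\<^sup>2 * X t x + 2 * U t x * V t x * Y t x)"
    using cont_UXPQ cont_VYpR unfolding case_prod_beta
    by (intro continuous_intros) (auto elim: continuous_on_subset)
  then show ?thesis
    unfolding e2_def[abs_def] box_real[symmetric] by (rule integral_continuous_on_param)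
qed

end


section \<open>Concavity of the length\<close>

text \<open>Treats both groups at once: \<theta> = 0 gives the length on the diffeomorphism group,
  \<theta> = 1 with \<open>g\<close> the derivative of \<alpha> the length on the Virasoro-Bott
  group.\<close>

definition weighted_length :: "real \<Rightarrow> real \<Rightarrow> (real \<Rightarrow> real) \<Rightarrow> (real \<Rightarrow> real \<Rightarrow> real) \<Rightarrow> real" where
  "weighted_length T \<theta> g \<phi> = (LINT t:{0..T}|lborel.
     sqrt (Diff_energy_density T \<phi> t + \<theta> * (g t - cocycle_density T \<phi> t)\<^sup>2))"

text \<open>Expand the square of \<open>sqrt y - sqrt x\<close>. Only the base point has to be
  positive; the perturbed value may be zero.\<close>

lemma sqrt_le_tangent:
  assumes "0 < x" "0 \<le> y"
  shows "sqrt y \<le> sqrt x + (y - x) / (2 * sqrt x)"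
proof -
  have "0 \<le> (sqrt y - sqrt x)\<^sup>2" by simp
  then have "2 * sqrt x * sqrt y \<le> x + y"
    using assms by (simp add: power2_diff algebra_simps)
  moreover have "sqrt x * (2 * sqrt x) = 2 * x" using assms by simp
  ultimately have "sqrt y * (2 * sqrt x) \<le> sqrt x * (2 * sqrt x) + (y - x)"
    by (simp only: mult.assoc mult.commute mult.left_commute)
  then have "sqrt y \<le> (sqrt x * (2 * sqrt x) + (y - x)) / (2 * sqrt x)"
    using assms by (subst pos_le_divide_eq) auto
  then show ?thesis using assms by (simp add: add_divide_distrib)
qed

text \<open>Serves the amplitude \<open>s\<close>, where 0 is an interior point, and the width
  \<delta>, where 0 is the left end point; hence \<open>a \<le> 0\<close>.\<close>

lemma small_point_negative:
  fixes G :: "real \<Rightarrow> real"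
  assumes "continuous_on {a..b} G" "a \<le> 0" "0 < b" "G 0 < 0" "0 < \<epsilon>"
  obtains s where "0 < s" "s \<le> b" "s < \<epsilon>" "G s < 0"
proof -
  have "0 \<in> {a..b}" using assms by simp
  then obtain e where e: "0 < e" "\<And>s. s \<in> {a..b} \<Longrightarrow> dist s 0 < e \<Longrightarrow> dist (G s) (G 0) < - G 0"
    using assms(1,4) unfolding continuous_on_iff by (metis neg_0_less_iff_less)
  define s where "s = min b (min e \<epsilon> / 2)"
  have s: "0 < s" "s \<le> b" "s < \<epsilon>" "s < e"
    unfolding s_def using e assms by linarith+
  moreover have "dist (G s) (G 0) < - G 0" using e(2)[of s] s assms by auto
  then have "G s < 0" by (simp add: dist_real_def abs_less_iff)
  ultimately show ?thesis by (intro that)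
qed

context diff_path
begin

abbreviation "F \<theta> g t \<equiv> Diff_energy_density T \<phi> t + \<theta> * (g t - cocycle_density T \<phi> t)\<^sup>2"

lemma F_continuous: "continuous_on {0..T} g \<Longrightarrow> continuous_on {0..T} (F \<theta> g)"
  by (intro continuous_intros continuous_energy continuous_cocycle)

lemma F_nonneg: "0 \<le> \<theta> \<Longrightarrow> t \<in> {0..T} \<Longrightarrow> 0 \<le> F \<theta> g t"
  using energy_nonneg by (intro add_nonneg_nonneg mult_nonneg_nonneg) auto

lemma weighted_length_eq:
  assumes "continuous_on {0..T} g"
  shows "weighted_length T \<theta> g \<phi> = integral {0..T} (\<lambda>t. sqrt (F \<theta> g t))"
proof -
  have "set_integrable lborel {0..T} (\<lambda>t. sqrt (F \<theta> g t))"
    using F_continuous[OF assms, of \<theta>] by (intro borel_integrable_atLeastAtMost' continuous_on_real_sqrt)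
  then show ?thesis unfolding weighted_length_def by (rule set_borel_integral_eq_integral(2))
qed

end

context perturbation
begin

text \<open>Confines the change of length to the times in \<open>{t1..t2}\<close>, so that
  \<open>F\<close> need be positive only there.\<close>

lemma psi_outside:
  assumes t: "t \<in> {0..T}" "t \<notin> {t1..t2}"
  shows "Diff_energy_density T (\<psi> s) t = Diff_energy_density T \<phi> t"
    and "cocycle_density T (\<psi> s) t = cocycle_density T \<phi> t"
  using vanish_VYpR[OF t(1)] t
  unfolding energy_eq cocycle_eq Diff_energy_density_def cocycle_density_def psi_partials[OF t(1)]
  by (simp_all add: U_def X_def P_def Q_def)

lemma W_continuous:
  assumes s0: "0 < s0" "\<And>s t x. \<bar>s\<bar> \<le> s0 \<Longrightarrow> t \<in> {0..T} \<Longrightarrow> 0 < X t x + s * Y t x"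
    "\<And>s. \<bar>s\<bar> \<le> s0 \<Longrightarrow> Diff_path T (\<psi> s)"
    and a: "continuous_on {0..T} a"
  shows "continuous_on ({-s0..s0} \<times> {0..T}) (\<lambda>z. W \<theta> a (fst z) (snd z))"
proof -
  let ?A = "{-s0..s0} \<times> {0..T}"
  note k = k_continuous[OF s0]
  have "continuous_on ?A (\<lambda>z. (- fst z, snd z))" by (intro continuous_intros)
  moreover have "(\<lambda>z. (- fst z, snd z)) ` ?A \<subseteq> ?A" by auto
  ultimately have k': "continuous_on ?A (\<lambda>z. k1 (- fst z) (snd z))"
    using continuous_on_compose2[OF k(1), of ?A "\<lambda>z. (- fst z, snd z)"] by simp
  have e: "continuous_on ?A (\<lambda>z. e2 (snd z))"
    by (rule continuous_on_compose2[OF e2_continuous]) (auto intro: continuous_intros)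
  have a': "continuous_on ?A (\<lambda>z. a (snd z))"
    by (rule continuous_on_compose2[OF a]) (auto intro: continuous_intros)
  show ?thesis unfolding W_def by (intro continuous_intros k k' e a')
qed

text \<open>The path is not assumed critical: adding the lengths for \<open>s\<close> and
  \<open>- s\<close> eliminates the first variation. The sign of the second variation at
  \<open>s = 0\<close> persists for small \<open>s > 0\<close> by continuity.\<close>

lemma shortening:
  assumes \<theta>: "0 \<le> \<theta>" and g: "continuous_on {0..T} g"
    and Fpos: "\<And>t. t \<in> {t1..t2} \<Longrightarrow> 0 < F \<theta> g t"
    and neg: "integral {t1..t2} (\<lambda>t. W \<theta> (\<lambda>t. g t - cocycle_density T \<phi> t) 0 t / (2 * sqrt (F \<theta> g t))) < 0"
    and \<epsilon>: "0 < \<epsilon>"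
  obtains s where "\<bar>s\<bar> < \<epsilon>" "Diff_path T (\<psi> s)" "weighted_length T \<theta> g (\<psi> s) < weighted_length T \<theta> g \<phi>"
proof -
  obtain s0 where s0: "0 < s0" "\<And>s t x. \<bar>s\<bar> \<le> s0 \<Longrightarrow> t \<in> {0..T} \<Longrightarrow> 0 < X t x + s * Y t x"
    "\<And>s. \<bar>s\<bar> \<le> s0 \<Longrightarrow> Diff_path T (\<psi> s)"
    using psi_path by blast
  define a where "a = (\<lambda>t. g t - cocycle_density T \<phi> t)"
  define w where "w = (\<lambda>t. 1 / (2 * sqrt (F \<theta> g t)))"
  \<comment> \<open>s^2 times \<open>G s\<close> will bound the sum of the two changes of length,
    and \<open>G 0\<close> is the integral assumed negative.\<close>
  define G where "G = (\<lambda>s. integral {t1..t2} (\<lambda>t. W \<theta> a s t * w t))"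
  have a: "continuous_on {0..T} a" unfolding a_def by (intro continuous_intros g continuous_cocycle)
  have J0: "{t1..t2} \<subseteq> {0..T}" using J by auto
  have wJ: "continuous_on {t1..t2} w"
    unfolding w_def
    using Fpos by (intro continuous_intros continuous_on_subset[OF F_continuous[OF g] J0])
      (force simp: less_imp_neq[symmetric])
  have WJ: "continuous_on ({-s0..s0} \<times> {t1..t2}) (\<lambda>z. W \<theta> a (fst z) (snd z))"
    using J0 by (intro continuous_on_subset[OF W_continuous[OF s0 a]]) auto
  have "continuous_on ({-s0..s0} \<times> {t1..t2}) (\<lambda>z. w (snd z))"
    by (rule continuous_on_compose2[OF wJ]) (auto intro: continuous_intros)
  with WJ have "continuous_on ({-s0..s0} \<times> cbox t1 t2) (\<lambda>(s, t). W \<theta> a s t * w t)"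
    unfolding case_prod_beta box_real by (intro continuous_intros)
  then have "continuous_on {-s0..s0} G"
    unfolding G_def box_real[symmetric] by (rule integral_continuous_on_param)
  moreover have "G 0 < 0" using neg unfolding G_def a_def w_def by simp
  ultimately obtain s where s: "0 < s" "s \<le> s0" "s < \<epsilon>" "G s < 0"
    using small_point_negative[of "-s0" s0 G \<epsilon>] s0(1) \<epsilon> by auto
  have s1: "\<bar>s\<bar> \<le> s0" "\<bar>- s\<bar> \<le> s0" using s by auto
  interpret Sp: diff_path T "\<psi> s" by (rule psi_diff_path[OF s0(3)[OF s1(1)]])
  interpret Sm: diff_path T "\<psi> (- s)" by (rule psi_diff_path[OF s0(3)[OF s1(2)]])
  have second: "Sp.F \<theta> g t + Sm.F \<theta> g t - 2 * F \<theta> g t = s\<^sup>2 * W \<theta> a s t" if t: "t \<in> {0..T}" for t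
  proof -
    define K where "K = cocycle_density T \<phi> t"
    have Kp: "cocycle_density T (\<psi> s) t = K + s * k1 s t"
      using cocycle_difference[OF s0 s1(1) t] by (simp add: K_def)
    have Km: "cocycle_density T (\<psi> (- s)) t = K - s * k1 (- s) t"
      using cocycle_difference[OF s0 s1(2) t] by (simp add: K_def)
    have E: "Diff_energy_density T (\<psi> s) t + Diff_energy_density T (\<psi> (- s)) t
        - 2 * Diff_energy_density T \<phi> t = 2 * s\<^sup>2 * e2 t"
      by (rule energy_second_difference[OF s0(3)[OF s1(1)] s0(3)[OF s1(2)] t])
    have k: "s * (s * k2 s t) = s * k1 s t - s * k1 (- s) t"
      using arg_cong[OF k1_difference[OF s0 s1(1) t], of "\<lambda>x. s * x"] by (simp add: algebra_simps)
    have "(g t - (K + s * k1 s t))\<^sup>2 + (g t - (K - s * k1 (- s) t))\<^sup>2 - 2 * (g t - K)\<^sup>2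
        = - 2 * (g t - K) * (s * k1 s t - s * k1 (- s) t) + s\<^sup>2 * ((k1 s t)\<^sup>2 + (k1 (- s) t)\<^sup>2)"
      by (simp add: power2_eq_square algebra_simps)
    also have "\<dots> = s\<^sup>2 * (- 2 * a t * k2 s t + (k1 s t)\<^sup>2 + (k1 (- s) t)\<^sup>2)"
      unfolding k[symmetric] a_def K_def by (simp add: power2_eq_square algebra_simps)
    finally have A: "(g t - (K + s * k1 s t))\<^sup>2 + (g t - (K - s * k1 (- s) t))\<^sup>2 - 2 * (g t - K)\<^sup>2
        = s\<^sup>2 * (- 2 * a t * k2 s t + (k1 s t)\<^sup>2 + (k1 (- s) t)\<^sup>2)" .
    have "Sp.F \<theta> g t + Sm.F \<theta> g t - 2 * F \<theta> g t = 2 * s\<^sup>2 * e2 t + \<theta> *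
       ((g t - (K + s * k1 s t))\<^sup>2 + (g t - (K - s * k1 (- s) t))\<^sup>2 - 2 * (g t - K)\<^sup>2)"
      unfolding Kp Km E[symmetric] K_def[symmetric] by (simp add: algebra_simps)
    then show ?thesis unfolding A W_def by (simp add: algebra_simps)
  qed
  define D where "D = (\<lambda>t. sqrt (Sp.F \<theta> g t) + sqrt (Sm.F \<theta> g t) - 2 * sqrt (F \<theta> g t))"
  have cD: "continuous_on {0..T} D"
    unfolding D_def
    by (intro continuous_on_add continuous_on_diff continuous_on_mult continuous_on_const
        continuous_on_real_sqrt F_continuous Sp.F_continuous Sm.F_continuous g)
  have "weighted_length T \<theta> g (\<psi> s) + weighted_length T \<theta> g (\<psi> (- s)) - 2 * weighted_length T \<theta> g \<phi>
      = integral {0..T} D"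
    unfolding D_def weighted_length_eq[OF g] Sp.weighted_length_eq[OF g] Sm.weighted_length_eq[OF g]
    by (subst Henstock_Kurzweil_Integration.integral_diff Henstock_Kurzweil_Integration.integral_add;
        (intro integrable_continuous_real continuous_on_add continuous_on_mult continuous_on_const
        continuous_on_real_sqrt F_continuous Sp.F_continuous Sm.F_continuous g)?)+ simp
  also have "\<dots> = integral {0..T} (\<lambda>t. if t \<in> {t1..t2} then D t else 0)"
    by (intro Henstock_Kurzweil_Integration.integral_cong) (simp add: D_def psi_outside)
  also have "\<dots> = integral {t1..t2} D"
    unfolding integral_restrict_Int Int_absorb2[OF J0] ..
  also have "\<dots> \<le> integral {t1..t2} (\<lambda>t. s\<^sup>2 * (W \<theta> a s t * w t))"
  proof (rule integral_le)
    show "D integrable_on {t1..t2}"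
      using continuous_on_subset[OF cD J0] by (rule integrable_continuous_real)
    have "continuous_on {t1..t2} (\<lambda>t. (s, t))" by (intro continuous_intros)
    moreover have "(\<lambda>t. (s, t)) ` {t1..t2} \<subseteq> {-s0..s0} \<times> {t1..t2}" using s by auto
    ultimately have "continuous_on {t1..t2} (W \<theta> a s)"
      using continuous_on_compose2[OF WJ, of "{t1..t2}" "\<lambda>t. (s, t)"] by simp
    then show "(\<lambda>t. s\<^sup>2 * (W \<theta> a s t * w t)) integrable_on {t1..t2}"
      by (intro integrable_continuous_real continuous_intros wJ)
    fix t assume tJ: "t \<in> {t1..t2}"
    then have t: "t \<in> {0..T}" using J0 by blast
    \<comment> \<open>Both square roots lie below the tangent at the same base point, so only the
      second difference of \<open>F\<close> remains.\<close>
    have "D t \<le> (Sp.F \<theta> g t - F \<theta> g t) / (2 * sqrt (F \<theta> g t)) + (Sm.F \<theta> g t - F \<theta> g t) / (2 * sqrt (F \<theta> g t))"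
      using sqrt_le_tangent[OF Fpos[OF tJ] Sp.F_nonneg[OF \<theta> t, of g]]
        sqrt_le_tangent[OF Fpos[OF tJ] Sm.F_nonneg[OF \<theta> t, of g]]
      unfolding D_def by linarith
    also have "\<dots> = (Sp.F \<theta> g t + Sm.F \<theta> g t - 2 * F \<theta> g t) * w t"
      unfolding w_def by (simp add: add_divide_distrib[symmetric])
    finally show "D t \<le> s\<^sup>2 * (W \<theta> a s t * w t)" unfolding second[OF t] by simp
  qed
  also have "\<dots> = s\<^sup>2 * G s" by (simp add: G_def)
  also have "\<dots> < 0" using s by (simp add: mult_pos_neg)
  finally have "weighted_length T \<theta> g (\<psi> s) < weighted_length T \<theta> g \<phi> \<or>
      weighted_length T \<theta> g (\<psi> (- s)) < weighted_length T \<theta> g \<phi>" by linarith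
  then show ?thesis
  proof
    assume "weighted_length T \<theta> g (\<psi> s) < weighted_length T \<theta> g \<phi>"
    then show ?thesis using s Sp.path by (intro that[of s]) auto
  next
    assume "weighted_length T \<theta> g (\<psi> (- s)) < weighted_length T \<theta> g \<phi>"
    then show ?thesis using s Sm.path by (intro that[of "- s"]) auto
  qed
qed

end


section \<open>Short waves\<close>

context perturbation
begin

lemma shortening_close:
  assumes "0 \<le> \<theta>" "continuous_on {0..T} g" "\<And>t. t \<in> {t1..t2} \<Longrightarrow> 0 < F \<theta> g t"
    and "integral {t1..t2} (\<lambda>t. W \<theta> (\<lambda>t. g t - cocycle_density T \<phi> t) 0 t / (2 * sqrt (F \<theta> g t))) < 0"
    and \<epsilon>: "0 < \<epsilon>"
  shows "\<exists>\<psi>. Diff_path T \<psi> \<and> \<psi> 0 = \<phi> 0 \<and> \<psi> T = \<phi> T \<and>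
    schwartz_norm T k m n (\<lambda>t x. \<phi> t x - \<psi> t x) < \<epsilon> \<and> weighted_length T \<theta> g \<psi> < weighted_length T \<theta> g \<phi>"
proof -
  obtain M where M: "\<And>s. schwartz_norm T k m n (\<lambda>t x. \<phi> t x - (\<phi> t x + s * \<eta> t x)) \<le> \<bar>s\<bar> * M"
    using schwartz_norm_lincomb_diff[OF T smooth eta_schwartz, of k m n] by blast
  \<comment> \<open>\<open>M\<close> was fixed together with \<eta>, before \<open>s\<close>; the
    form \<open>\<bar>M\<bar> + 1\<close> allows any real \<open>M\<close>.\<close>
  have "0 < \<epsilon> / (\<bar>M\<bar> + 1)" using \<epsilon> by simp
  then obtain s where s: "\<bar>s\<bar> < \<epsilon> / (\<bar>M\<bar> + 1)" "Diff_path T (\<psi> s)"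
    "weighted_length T \<theta> g (\<psi> s) < weighted_length T \<theta> g \<phi>"
    using shortening[OF assms(1-4)] by blast
  have "schwartz_norm T k m n (\<lambda>t x. \<phi> t x - \<psi> s t x) \<le> \<bar>s\<bar> * M" using M by (simp add: \<psi>_def)
  also have "\<dots> \<le> \<bar>s\<bar> * (\<bar>M\<bar> + 1)" by (intro mult_left_mono) auto
  also have "\<dots> < \<epsilon>" using s(1) by (subst (asm) pos_less_divide_eq) auto
  finally have "schwartz_norm T k m n (\<lambda>t x. \<phi> t x - \<psi> s t x) < \<epsilon>" .
  moreover have "\<psi> s 0 = \<phi> 0" "\<psi> s T = \<phi> T"
    using supp J T by (auto simp: \<psi>_def)
  ultimately show ?thesis using s by blast
qed

end

text \<open>After the substitution the domain no longer depends on the width, centre or support box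
  of the wave, so the limit of width zero can be taken under the integral.\<close>

lemma integral_rescale:
  fixes f :: "real \<Rightarrow> real"
  assumes f: "continuous_on UNIV f" "\<And>x. x \<notin> {c..d} \<Longrightarrow> f x = 0"
    and \<delta>: "0 < \<delta>" and z: "\<And>z. 1 < \<bar>z\<bar> \<Longrightarrow> f (y + \<delta> * z) = 0"
  shows "integral {c..d} f = \<delta> * integral {-1..1} (\<lambda>z. f (y + \<delta> * z))"
proof -
  have "integral {c..d} f = (LINT x|lborel. f x)"
    using LINT_compact_support_eq[of c d f] f continuous_on_subset by (metis subset_UNIV)
  also have "\<dots> = \<delta> * (LINT z|lborel. f (y + \<delta> * z))"
    using lborel_integral_real_affine[of \<delta> f y] \<delta> by simp
  also have "(LINT z|lborel. f (y + \<delta> * z)) = integral {-1..1} (\<lambda>z. f (y + \<delta> * z))"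
  proof (rule LINT_compact_support_eq)
    show "continuous_on {-1..1} (\<lambda>z. f (y + \<delta> * z))"
      by (rule continuous_on_compose2[OF f(1)]) (auto intro: continuous_intros)
    show "f (y + \<delta> * z) = 0" if "z \<notin> {-1..1}" for z using that by (intro z) auto
  qed
  finally show ?thesis .
qed

lemma integral_negative:
  fixes f :: "real \<Rightarrow> real"
  assumes f: "continuous_on {a..b} f" and "a < b" and le: "\<And>x. x \<in> {a..b} \<Longrightarrow> f x \<le> 0"
    and x: "x \<in> {a..b}" "f x < 0"
  shows "integral {a..b} f < 0"
proof -
  have cm: "continuous_on {a..b} (\<lambda>x. - f x)" using f by (intro continuous_intros)
  have "integral {a..b} (\<lambda>x. - f x) \<noteq> 0"
    using integral_eq_0_iff[OF cm \<open>a < b\<close>] le x by force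
  moreover have "0 \<le> integral {a..b} (\<lambda>x. - f x)"
    using le by (intro Henstock_Kurzweil_Integration.integral_nonneg integrable_continuous_real cm) auto
  ultimately show ?thesis by simp
qed

lemma bump_square_integral:
  assumes "\<exists>x\<in>{-1<..<1}. (deriv ^^ i) bump x \<noteq> 0"
  shows "0 < integral {-1..1} (\<lambda>z. ((deriv ^^ i) bump z)\<^sup>2)"
proof -
  obtain x where x: "x \<in> {-1<..<1}" "(deriv ^^ i) bump x \<noteq> 0" using assms by blast
  have "continuous_on {-1..1} ((deriv ^^ i) bump)"
    by (intro smooth_line_continuous_on smooth_line_funpow smooth_line_bump)
  then have "integral {-1..1} (\<lambda>z. - ((deriv ^^ i) bump z)\<^sup>2) < 0"
    by (intro integral_negative[of _ _ _ x] continuous_intros) (use x in auto)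
  then show ?thesis by simp
qed

lemma DERIV_quotient_square:
  fixes f h :: "real \<Rightarrow> real"
  assumes "(f has_real_derivative f') (at x)" "(h has_real_derivative h') (at x)" "h x \<noteq> 0"
  shows "((\<lambda>x. f x / (h x)\<^sup>2) has_real_derivative f' / (h x)\<^sup>2 - 2 * f x * h' / (h x) ^ 3) (at x)"
proof -
  have "((\<lambda>x. f x / (h x)\<^sup>2) has_real_derivative
      (f' * (h x)\<^sup>2 - f x * (2 * h x * h')) / ((h x)\<^sup>2 * (h x)\<^sup>2)) (at x)"
    using assms by (auto intro!: derivative_eq_intros)
  also have "(f' * (h x)\<^sup>2 - f x * (2 * h x * h')) / ((h x)\<^sup>2 * (h x)\<^sup>2) =
      f' / (h x)\<^sup>2 - 2 * f x * h' / (h x) ^ 3"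
    using assms(3) by (simp add: field_simps eval_nat_numeral)
  finally show ?thesis .
qed

text \<open>The wave is centred at \<open>x0\<close> at time \<open>t0\<close>, lives for
  \<open>r\<close> before and after, and moves with velocity \<open>- l\<close>. To leading order
  its time derivative is \<open>l\<close> times its space derivative; this ratio is the free
  parameter that decides the sign of the symbol.\<close>

locale wave = diff_path +
  fixes t0 x0 l r :: real
  assumes r: "0 < r" "0 < t0 - r" "t0 + r < T"
begin

definition "A t = bump (1 / r * t + (- t0 / r))"

lemma smooth_A: "smooth_line A"
  unfolding A_def[abs_def]
  by (rule smooth_line_compose[OF smooth_line_bump])
     (intro smooth_line_add smooth_line_mult smooth_line_const smooth_line_id)

lemma A_arg: "1 / r * t + (- t0 / r) = (t - t0) / r"
  by (simp add: diff_divide_distrib)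

lemma A_zero: "t \<notin> {t0 - r..t0 + r} \<Longrightarrow> A t = 0"
proof -
  assume "t \<notin> {t0 - r..t0 + r}"
  then have "r \<le> \<bar>t - t0\<bar>" by auto
  then have "1 \<le> \<bar>(t - t0) / r\<bar>" using r by (simp add: abs_divide)
  then show "A t = 0" unfolding A_def A_arg by (rule bump_zero)
qed

lemma A_t0: "A t0 \<noteq> 0"
  using bump_pos[of 0] by (simp add: A_def)

abbreviation "b1 \<equiv> deriv bump"
abbreviation "b2 \<equiv> deriv (deriv bump)"

lemma smooth_b: "smooth_line b1" "smooth_line b2"
  by (auto intro: smooth_line_deriv smooth_line_bump)

definition "y t = x0 - l * (t - t0)"

text \<open>For \<open>\<delta> > 0\<close> and \<open>x = y t + \<delta> * z\<close>, the following are \<open>\<delta> V\<close>, \<open>\<delta> Y\<close>, \<open>\<delta>\<^sup>2 R\<close>, \<open>\<delta>\<^sup>2 p\<close>, \<open>\<delta>\<^sup>2 n0\<close> and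
  \<open>\<delta>\<^sup>4 n1\<close> of the wave of width \<open>\<delta>\<close>. Being continuous up to \<open>\<delta> = 0\<close>, they give the leading terms.\<close>

definition "v \<delta> t z = \<delta> * deriv A t * bump z + l * A t * b1 z"
definition "yy t z = A t * b1 z"
definition "rr t z = A t * b2 z"
definition "pp \<delta> t z = \<delta> * deriv A t * b1 z + l * A t * b2 z"

definition "Px = partial_x P"
definition "Qx = partial_x Q"

definition "N0 \<delta> t z = (let x = y t + \<delta> * z in
  (X t x)\<^sup>2 * (P t x * rr t z + Q t x * pp \<delta> t z) - 2 * P t x * Q t x * X t x * (\<delta> * yy t z))"
definition "N1 \<delta> t z = (let x = y t + \<delta> * z in
  (X t x)\<^sup>2 * pp \<delta> t z * rr t z - P t x * Q t x * (\<delta> * yy t z)\<^sup>2)"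

text \<open>For \<delta> > 0 these become \<open>\<delta> * e2 t\<close>,
  \<open>\<delta> * k1 0 t\<close>, \<open>\<delta> ^ 3 * k2 0 t\<close> and, for times in the
  support, \<open>- k1 0 t\<close> after integration by parts. At \<delta> = 0 they are the
  limits.\<close>

definition "E2 \<delta> t = integral {-1..1} (\<lambda>z.
  (v \<delta> t z)\<^sup>2 * X t (y t + \<delta> * z) + 2 * U t (y t + \<delta> * z) * v \<delta> t z * yy t z)"
definition "K1 \<delta> t = integral {-1..1} (\<lambda>z. N0 \<delta> t z / (X t (y t + \<delta> * z)) ^ 4)"
definition "K2 \<delta> t = integral {-1..1} (\<lambda>z.
  (2 * N1 \<delta> t z * (X t (y t + \<delta> * z))\<^sup>2 - 4 * N0 \<delta> t z * X t (y t + \<delta> * z) * (\<delta> * yy t z)) /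
    (X t (y t + \<delta> * z)) ^ 6)"
definition "L1 \<delta> t = integral {-1..1} (\<lambda>z.
  Px t (y t + \<delta> * z) / (X t (y t + \<delta> * z))\<^sup>2 * yy t z +
  (Qx t (y t + \<delta> * z) / (X t (y t + \<delta> * z))\<^sup>2
    - 2 * (Q t (y t + \<delta> * z))\<^sup>2 / (X t (y t + \<delta> * z)) ^ 3) * v \<delta> t z)"

lemma smooth_PQx: "smooth_strip T Px" "smooth_strip T Qx"
  by (auto simp: Px_def Qx_def intro: smooth_strip_partial_x smooth_UXPQ)

text \<open>No power of \<delta> is left in a denominator; only \<open>X\<close> is, and it never
  vanishes. Hence continuity includes \<delta> = 0.\<close>

lemma scaled_continuous:
  "continuous_on ({0..1} \<times> {0..T}) (\<lambda>z. E2 (fst z) (snd z))"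
  "continuous_on ({0..1} \<times> {0..T}) (\<lambda>z. K1 (fst z) (snd z))"
  "continuous_on ({0..1} \<times> {0..T}) (\<lambda>z. K2 (fst z) (snd z))"
  "continuous_on ({0..1} \<times> {0..T}) (\<lambda>z. L1 (fst z) (snd z))"
proof -
  let ?B = "({0..1} \<times> {0..T}) \<times> cbox (-1) (1::real)"
  have g: "continuous_on ?B (\<lambda>z. snd (fst z))"
    "continuous_on ?B (\<lambda>z. y (snd (fst z)) + fst (fst z) * snd z)"
    "\<And>z. z \<in> ?B \<Longrightarrow> snd (fst z) \<in> {0..T}"
    unfolding y_def by (auto intro!: continuous_intros)
  note c = cont_UXPQ[THEN continuous_on_strip_compose, OF g]
    smooth_PQx[THEN smooth_strip_continuous, THEN continuous_on_strip_compose, OF g]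
  have cb: "continuous_on ?B (\<lambda>z. bump (snd z))" "continuous_on ?B (\<lambda>z. b1 (snd z))"
    "continuous_on ?B (\<lambda>z. b2 (snd z))"
    by (rule continuous_on_smooth_line_compose, rule smooth_line_bump smooth_b, intro continuous_intros)+
  have cA: "continuous_on ?B (\<lambda>z. A (snd (fst z)))" "continuous_on ?B (\<lambda>z. deriv A (snd (fst z)))"
    by (rule continuous_on_smooth_line_compose[OF smooth_A g(1)]
        continuous_on_smooth_line_compose[OF smooth_line_deriv[OF smooth_A] g(1)])+
  have c0: "continuous_on ?B (\<lambda>z. fst (fst z))" by (intro continuous_intros)
  have nz: "X (snd (fst z)) (y (snd (fst z)) + fst (fst z) * snd z) \<noteq> 0" if "z \<in> ?B" for z
    using X_pos[OF g(3)[OF that]] by (simp add: less_imp_neq[symmetric])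
  note ci = continuous_on_divide continuous_on_mult continuous_on_add continuous_on_diff
    continuous_on_power continuous_on_const c cb cA c0 ballI power_not_zero nz
  have par: "continuous_on ({0..1} \<times> {0..T}) (\<lambda>z. integral {-1..1} (f (fst z) (snd z)))"
    if "continuous_on ?B (\<lambda>z. f (fst (fst z)) (snd (fst z)) (snd z))" for f :: "real \<Rightarrow> real \<Rightarrow> real \<Rightarrow> real"
    using that unfolding box_real[symmetric]
    by (intro integral_continuous_on_param) (simp add: case_prod_beta)
  show "continuous_on ({0..1} \<times> {0..T}) (\<lambda>z. E2 (fst z) (snd z))"
    unfolding E2_def v_def yy_def by (rule par) (intro ci)
  show "continuous_on ({0..1} \<times> {0..T}) (\<lambda>z. K1 (fst z) (snd z))"
    unfolding K1_def N0_def Let_def rr_def pp_def yy_def by (rule par) (intro ci)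
  show "continuous_on ({0..1} \<times> {0..T}) (\<lambda>z. K2 (fst z) (snd z))"
    unfolding K2_def N0_def N1_def Let_def rr_def pp_def yy_def by (rule par) (intro ci)
  show "continuous_on ({0..1} \<times> {0..T}) (\<lambda>z. L1 (fst z) (snd z))"
    unfolding L1_def v_def yy_def by (rule par) (intro ci)
qed

lemma E2_zero: "E2 0 t = (A t)\<^sup>2 * (l\<^sup>2 * X t (y t) + 2 * l * U t (y t)) * integral {-1..1} (\<lambda>z. (b1 z)\<^sup>2)"
proof -
  have "E2 0 t = integral {-1..1} (\<lambda>z. ((A t)\<^sup>2 * (l\<^sup>2 * X t (y t) + 2 * l * U t (y t))) * (b1 z)\<^sup>2)"
    unfolding E2_def v_def yy_def
    by (intro Henstock_Kurzweil_Integration.integral_cong) (simp add: power2_eq_square algebra_simps)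
  then show ?thesis by simp
qed

text \<open>In the limit only the product of the two second derivatives of the wave survives; both
  are multiples of \<open>b2\<close>, so the sign is that of \<open>l\<close>.\<close>

lemma K2_zero:
  assumes "t \<in> {0..T}"
  shows "K2 0 t = 2 * l * (A t)\<^sup>2 / (X t (y t))\<^sup>2 * integral {-1..1} (\<lambda>z. (b2 z)\<^sup>2)"
proof -
  have "X t (y t) \<noteq> 0" using X_pos[OF assms, of "y t"] by simp
  then have "K2 0 t = integral {-1..1} (\<lambda>z. (2 * l * (A t)\<^sup>2 / (X t (y t))\<^sup>2) * (b2 z)\<^sup>2)"
    unfolding K2_def N1_def N0_def Let_def pp_def rr_def yy_def
    by (intro Henstock_Kurzweil_Integration.integral_cong) (simp add: field_simps eval_nat_numeral)
  then show ?thesis by simp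
qed

end

locale wave_at = wave +
  fixes \<delta> :: real
  assumes \<delta>: "0 < \<delta>" "\<delta> \<le> 1"
begin

text \<open>The phase is spelled out in the affine form of \<open>C_strip_travelling\<close>;
  \<open>phase\<close> restores the readable quotient.\<close>

definition "\<eta> t x = A t * bump (1 / \<delta> * x + l / \<delta> * t + (- (x0 + l * t0) / \<delta>))"

lemma phase: "1 / \<delta> * x + l / \<delta> * t + (- (x0 + l * t0) / \<delta>) = (x - y t) / \<delta>"
  unfolding y_def by (simp add: add_divide_distrib diff_divide_distrib algebra_simps)

lemma smooth_eta': "smooth_strip T \<eta>"
  unfolding smooth_strip_def \<eta>_def[abs_def]
  by (intro allI C_strip_travelling T smooth_A smooth_line_bump)

text \<open>The centre moves by at most \<open>\<bar>l\<bar> * r\<close> and the half-width is at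
  most 1. The margin 2 makes the inequality strict even on the sides of the box, so that boundary
  terms vanish.\<close>

lemma phase_large:
  assumes "t \<in> {t0 - r..t0 + r}" "x \<le> x0 - \<bar>l\<bar> * r - 2 \<or> x0 + \<bar>l\<bar> * r + 2 \<le> x"
  shows "1 < \<bar>(x - y t) / \<delta>\<bar>"
proof -
  have "\<bar>l * (t - t0)\<bar> \<le> \<bar>l\<bar> * r"
    unfolding abs_mult using assms(1) by (intro mult_left_mono) auto
  then have "2 \<le> \<bar>x - y t\<bar>" unfolding y_def using assms(2) by linarith
  then have "\<delta> < \<bar>x - y t\<bar>" using \<delta> by linarith
  then show ?thesis using \<delta> by (simp add: abs_divide)
qed

sublocale perturbation T \<phi> \<eta> "x0 - \<bar>l\<bar> * r - 2" "x0 + \<bar>l\<bar> * r + 2" "t0 - r" "t0 + r"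
proof
  show "\<eta> t x = 0" if "t \<in> {0..T}" "t \<notin> {t0 - r..t0 + r} \<or> x \<notin> {x0 - \<bar>l\<bar> * r - 2..x0 + \<bar>l\<bar> * r + 2}" for t x
  proof (cases "t \<in> {t0 - r..t0 + r}")
    case True
    with that(2) have "1 < \<bar>(x - y t) / \<delta>\<bar>" by (intro phase_large) auto
    then show ?thesis unfolding \<eta>_def phase by (simp add: bump_zero)
  next
    case False then show ?thesis by (simp add: \<eta>_def A_zero)
  qed
qed (use smooth_eta' r in auto)

lemma eta_partials:
  assumes t: "t \<in> {0..T}"
  shows "V t x = v \<delta> t ((x - y t) / \<delta>) / \<delta>"
    and "Y t x = yy t ((x - y t) / \<delta>) / \<delta>"
    and "p t x = pp \<delta> t ((x - y t) / \<delta>) / \<delta>\<^sup>2"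
    and "R t x = rr t ((x - y t) / \<delta>) / \<delta>\<^sup>2"
proof -
  have dA: "(A has_real_derivative deriv A t) (at t within S)" for t S
    using smooth_line_has_derivative[OF smooth_A] has_field_derivative_at_within by blast
  have db: "(bump has_real_derivative b1 z) (at z)" "(b1 has_real_derivative b2 z) (at z)" for z
    by (auto intro: smooth_line_has_derivative smooth_line_bump smooth_b)
  have dx: "((\<lambda>x. (x - y t) / \<delta>) has_real_derivative 1 / \<delta>) (at x)" for x t
    using \<delta> by (auto intro!: derivative_eq_intros)
  have dy: "((\<lambda>t. (x - y t) / \<delta>) has_real_derivative l / \<delta>) (at t within S)" for x t S
    unfolding y_def using \<delta> by (auto intro!: derivative_eq_intros)
  have eta: "\<eta> = (\<lambda>t x. A t * bump ((x - y t) / \<delta>))"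
    unfolding \<eta>_def phase ..
  have V: "V t x = v \<delta> t ((x - y t) / \<delta>) / \<delta>" for x
    unfolding V_def
  proof (rule partial_t_eqI[OF T t])
    have "((\<lambda>s. A s * bump ((x - y s) / \<delta>)) has_real_derivative
        deriv A t * bump ((x - y t) / \<delta>) + b1 ((x - y t) / \<delta>) * (l / \<delta>) * A t) (at t within {0..T})"
      by (intro DERIV_mult dA DERIV_chain2[OF db(1)] dy)
    also have "deriv A t * bump ((x - y t) / \<delta>) + b1 ((x - y t) / \<delta>) * (l / \<delta>) * A t =
        v \<delta> t ((x - y t) / \<delta>) / \<delta>"
      using \<delta> by (simp add: v_def field_simps)
    finally show "((\<lambda>s. \<eta> s x) has_vector_derivative v \<delta> t ((x - y t) / \<delta>) / \<delta>) (at t within {0..T})"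
      by (simp add: eta has_real_derivative_iff_has_vector_derivative)
  qed
  then show "V t x = v \<delta> t ((x - y t) / \<delta>) / \<delta>" .
  have Y: "Y t x = yy t ((x - y t) / \<delta>) / \<delta>" for x
    unfolding Y_def
  proof (rule partial_x_eqI)
    have "((\<lambda>x. A t * bump ((x - y t) / \<delta>)) has_real_derivative A t * (b1 ((x - y t) / \<delta>) * (1 / \<delta>))) (at x)"
      by (intro DERIV_cmult DERIV_chain2[OF db(1)] dx)
    then show "(\<eta> t has_real_derivative yy t ((x - y t) / \<delta>) / \<delta>) (at x)"
      by (simp add: eta yy_def)
  qed
  then show "Y t x = yy t ((x - y t) / \<delta>) / \<delta>" .
  show "p t x = pp \<delta> t ((x - y t) / \<delta>) / \<delta>\<^sup>2"
    unfolding p_def V_def[symmetric]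
  proof (rule partial_x_eqI)
    have "((\<lambda>x. (\<delta> * deriv A t * bump ((x - y t) / \<delta>) + l * A t * b1 ((x - y t) / \<delta>)) / \<delta>) has_real_derivative
       (\<delta> * deriv A t * (b1 ((x - y t) / \<delta>) * (1 / \<delta>)) + l * A t * (b2 ((x - y t) / \<delta>) * (1 / \<delta>))) / \<delta>) (at x)"
      by (intro DERIV_cdivide DERIV_add DERIV_cmult DERIV_chain2[OF db(1)] DERIV_chain2[OF db(2)] dx)
    moreover have "V t = (\<lambda>x. (\<delta> * deriv A t * bump ((x - y t) / \<delta>) + l * A t * b1 ((x - y t) / \<delta>)) / \<delta>)"
      using V by (auto simp: v_def)
    moreover have "(\<delta> * deriv A t * (b1 ((x - y t) / \<delta>) * (1 / \<delta>)) + l * A t * (b2 ((x - y t) / \<delta>) * (1 / \<delta>))) / \<delta>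
        = pp \<delta> t ((x - y t) / \<delta>) / \<delta>\<^sup>2"
      by (simp add: pp_def power2_eq_square add_divide_distrib)
    ultimately show "(V t has_real_derivative pp \<delta> t ((x - y t) / \<delta>) / \<delta>\<^sup>2) (at x)" by simp
  qed
  show "R t x = rr t ((x - y t) / \<delta>) / \<delta>\<^sup>2"
    unfolding R_def Y_def[symmetric]
  proof (rule partial_x_eqI)
    have "((\<lambda>x. A t * b1 ((x - y t) / \<delta>) / \<delta>) has_real_derivative A t * (b2 ((x - y t) / \<delta>) * (1 / \<delta>)) / \<delta>) (at x)"
      by (intro DERIV_cdivide DERIV_cmult DERIV_chain2[OF db(2)] dx)
    moreover have "Y t = (\<lambda>x. A t * b1 ((x - y t) / \<delta>) / \<delta>)" using Y by (auto simp: yy_def)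
    ultimately show "(Y t has_real_derivative rr t ((x - y t) / \<delta>) / \<delta>\<^sup>2) (at x)"
      by (simp add: rr_def power2_eq_square)
  qed
qed

section \<open>Powers of the width in the second variation\<close>

lemma scaled_partials:
  assumes t: "t \<in> {0..T}"
  shows "V t (y t + \<delta> * z) = v \<delta> t z / \<delta>" "Y t (y t + \<delta> * z) = yy t z / \<delta>"
    "p t (y t + \<delta> * z) = pp \<delta> t z / \<delta>\<^sup>2" "R t (y t + \<delta> * z) = rr t z / \<delta>\<^sup>2"
  using \<delta> by (simp_all add: eta_partials[OF t])

lemma scaled_vanish:
  assumes "1 < \<bar>z\<bar>"
  shows "v \<delta> t z = 0" "yy t z = 0" "pp \<delta> t z = 0" "rr t z = 0"
  using bump_deriv_zero[OF assms, of 0] bump_deriv_zero[OF assms, of 1] bump_deriv_zero[OF assms, of 2]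
  by (simp_all add: v_def yy_def pp_def rr_def numeral_2_eq_2)

lemma partials_vanish:
  assumes t: "t \<in> {0..T}" and "1 < \<bar>z\<bar>"
  shows "V t (y t + \<delta> * z) = 0" "Y t (y t + \<delta> * z) = 0"
    "p t (y t + \<delta> * z) = 0" "R t (y t + \<delta> * z) = 0"
  using scaled_vanish[OF assms(2)] by (simp_all add: scaled_partials[OF t])

lemma scaled_numerators:
  assumes t: "t \<in> {0..T}"
  shows "n0 t (y t + \<delta> * z) = N0 \<delta> t z / \<delta>\<^sup>2" "n1 t (y t + \<delta> * z) = N1 \<delta> t z / \<delta> ^ 4"
  using \<delta> unfolding n0_def n1_def N0_def N1_def Let_def scaled_partials[OF t]
  by (simp_all add: field_simps eval_nat_numeral)

text \<open>Each space or time derivative of the wave costs a factor 1/\<delta> and the substitution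
  gains \<delta>. Thus \<open>e2\<close> with two first derivatives and \<open>k1\<close> with one
  second derivative have order 1/\<delta>, \<open>k2\<close> with two second derivatives
  1/\<delta>^3.\<close>

lemma e2_scaled:
  assumes t: "t \<in> {0..T}"
  shows "\<delta> * e2 t = E2 \<delta> t"
proof -
  have "e2 t = \<delta> * integral {-1..1} (\<lambda>z. (V t (y t + \<delta> * z))\<^sup>2 * X t (y t + \<delta> * z)
      + 2 * U t (y t + \<delta> * z) * V t (y t + \<delta> * z) * Y t (y t + \<delta> * z))"
    unfolding e2_def
    by (rule integral_rescale)
       (use vanish_VYpR[OF t] partials_vanish[OF t] \<delta> in \<open>auto intro!: continuous_intros cont_slice[OF t]\<close>)
  also have "\<dots> = \<delta> * integral {-1..1} (\<lambda>z. (1 / \<delta>\<^sup>2) *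
     ((v \<delta> t z)\<^sup>2 * X t (y t + \<delta> * z) + 2 * U t (y t + \<delta> * z) * v \<delta> t z * yy t z))"
    unfolding scaled_partials[OF t] by (simp add: field_simps power2_eq_square)
  also have "\<dots> = \<delta> * ((1 / \<delta>\<^sup>2) * E2 \<delta> t)"
    unfolding E2_def by (subst Henstock_Kurzweil_Integration.integral_mult_right) simp
  finally show ?thesis using \<delta> by (simp add: power2_eq_square)
qed

text \<open>With the range of \<open>s\<close> reduced to 0, the positivity premise is just
  \<open>X_pos\<close>.\<close>

lemma kappa0_continuous:
  assumes t: "t \<in> {0..T}"
  shows "continuous_on UNIV (\<kappa> 0 t)" "continuous_on UNIV (\<kappa>2 0 t)"
  using kappa_continuous[where ?s0.0 = 0 and A = UNIV and ?g0.0 = "\<lambda>x. 0" and ?g1.0 = "\<lambda>x. t" and ?g2.0 = "\<lambda>x. x"]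
    X_pos t by auto

lemma kappa_vanish:
  assumes "t \<in> {0..T}" and "1 < \<bar>z\<bar>"
  shows "\<kappa> 0 t (y t + \<delta> * z) = 0" "\<kappa>2 0 t (y t + \<delta> * z) = 0"
  by (simp_all add: \<kappa>_def \<kappa>2_def n0_def n1_def partials_vanish[OF assms])

lemma k1_scaled:
  assumes t: "t \<in> {0..T}"
  shows "\<delta> * k1 0 t = K1 \<delta> t"
proof -
  have "k1 0 t = \<delta> * integral {-1..1} (\<lambda>z. \<kappa> 0 t (y t + \<delta> * z))"
    unfolding k1_def
    by (rule integral_rescale[OF kappa0_continuous(1)[OF t]])
       (rule kappa_zero_outside[OF t] kappa_vanish[OF t] \<delta> | assumption)+
  also have "\<dots> = \<delta> * integral {-1..1} (\<lambda>z. (1 / \<delta>\<^sup>2) * (N0 \<delta> t z / (X t (y t + \<delta> * z)) ^ 4))"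
    unfolding \<kappa>_def by (simp add: scaled_numerators[OF t] eval_nat_numeral mult.assoc)
  also have "\<dots> = \<delta> * ((1 / \<delta>\<^sup>2) * K1 \<delta> t)"
    unfolding K1_def by (subst Henstock_Kurzweil_Integration.integral_mult_right) simp
  finally show ?thesis using \<delta> by (simp add: power2_eq_square)
qed

lemma k2_scaled:
  assumes t: "t \<in> {0..T}"
  shows "\<delta> ^ 3 * k2 0 t = K2 \<delta> t"
proof -
  have "k2 0 t = \<delta> * integral {-1..1} (\<lambda>z. \<kappa>2 0 t (y t + \<delta> * z))"
    unfolding k2_def
    by (rule integral_rescale[OF kappa0_continuous(2)[OF t]])
       (rule kappa_zero_outside[OF t] kappa_vanish[OF t] \<delta> | assumption)+
  also have "(\<lambda>z. \<kappa>2 0 t (y t + \<delta> * z)) = (\<lambda>z. (1 / \<delta> ^ 4) *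
     ((2 * N1 \<delta> t z * (X t (y t + \<delta> * z))\<^sup>2 - 4 * N0 \<delta> t z * X t (y t + \<delta> * z) * (\<delta> * yy t z)) /
    (X t (y t + \<delta> * z)) ^ 6))"
  proof
    fix z
    have "X t (y t + \<delta> * z) \<noteq> 0" using X_pos[OF t, of "y t + \<delta> * z"] by simp
    then show "\<kappa>2 0 t (y t + \<delta> * z) = (1 / \<delta> ^ 4) *
     ((2 * N1 \<delta> t z * (X t (y t + \<delta> * z))\<^sup>2 - 4 * N0 \<delta> t z * X t (y t + \<delta> * z) * (\<delta> * yy t z)) /
    (X t (y t + \<delta> * z)) ^ 6)"
      using \<delta> unfolding \<kappa>2_def scaled_numerators[OF t] scaled_partials[OF t]
      by (simp add: field_simps eval_nat_numeral)
  qed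
  also have "\<delta> * integral {-1..1} \<dots> = \<delta> * ((1 / \<delta> ^ 4) * K2 \<delta> t)"
    unfolding K2_def by (subst Henstock_Kurzweil_Integration.integral_mult_right) simp
  finally show ?thesis using \<delta> by (simp add: eval_nat_numeral)
qed

text \<open>Bounding \<open>k1\<close> through \<open>K1\<close> only gives \<open>k1 = O(1/\<delta>)\<close>. Integrating by parts once moves a
  derivative from the wave onto the coefficients and yields \<open>k1 = O(1)\<close>.\<close>

lemma k1_by_parts:
  assumes t: "t \<in> {t0 - r..t0 + r}"
  shows "k1 0 t = - L1 \<delta> t"
proof -
  let ?c = "x0 - \<bar>l\<bar> * r - 2" and ?d = "x0 + \<bar>l\<bar> * r + 2"
  have tT: "t \<in> {0..T}" using t r by auto
  have cd: "?c \<le> ?d" using r by (simp add: add_nonneg_nonneg)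
  have Xnz: "X t x \<noteq> 0" for x using X_pos[OF tT, of x] by simp
  \<comment> \<open>\<open>\<kappa> 0\<close> is
    \<open>P R / X^2 + Q p / X^2 - 2 P Q Y / X^3\<close>. The last term is exactly what
    differentiating the coefficient 1/X^2 of \<open>P * Y\<close> in \<open>B\<close> produces, so
    \<open>B\<close> has derivative \<open>\<kappa> 0 + H\<close>, and \<open>H\<close> contains
    only first derivatives of the wave.\<close>
  define H where "H = (\<lambda>x. Px t x / (X t x)\<^sup>2 * Y t x + (Qx t x / (X t x)\<^sup>2 - 2 * (Q t x)\<^sup>2 / (X t x) ^ 3) * V t x)"
  define B where "B = (\<lambda>x. P t x / (X t x)\<^sup>2 * Y t x + Q t x / (X t x)\<^sup>2 * V t x)"
  have dX: "(X t has_real_derivative Q t x) (at x)" for x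
    using smooth_strip_has_partial_x[OF smooth_UXPQ(2) tT] by (simp add: Q_def X_def)
  have dP: "(P t has_real_derivative Px t x) (at x)" for x
    using smooth_strip_has_partial_x[OF smooth_UXPQ(3) tT] by (simp add: Px_def)
  have dQ: "(Q t has_real_derivative Qx t x) (at x)" for x
    using smooth_strip_has_partial_x[OF smooth_UXPQ(4) tT] by (simp add: Qx_def)
  have dV: "(V t has_real_derivative p t x) (at x)" for x
    using smooth_strip_has_partial_x[OF smooth_VYpR(1) tT] by (simp add: p_def V_def)
  have dY: "(Y t has_real_derivative R t x) (at x)" for x
    using smooth_strip_has_partial_x[OF smooth_VYpR(2) tT] by (simp add: R_def Y_def)
  have dB: "(B has_real_derivative \<kappa> 0 t x + H x) (at x)" for x
  proof -
    have "(B has_real_derivative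
        (Px t x / (X t x)\<^sup>2 - 2 * P t x * Q t x / (X t x) ^ 3) * Y t x + R t x * (P t x / (X t x)\<^sup>2) +
        ((Qx t x / (X t x)\<^sup>2 - 2 * Q t x * Q t x / (X t x) ^ 3) * V t x + p t x * (Q t x / (X t x)\<^sup>2))) (at x)"
      unfolding B_def
      by (intro DERIV_add DERIV_mult DERIV_quotient_square dX dP dQ dV dY Xnz)
    moreover have "\<kappa> 0 t x = P t x * R t x / (X t x)\<^sup>2 + Q t x * p t x / (X t x)\<^sup>2
        - 2 * P t x * Q t x / (X t x) ^ 3 * Y t x"
      using Xnz[of x] by (simp add: \<kappa>_def n0_def field_simps eval_nat_numeral)
    ultimately show ?thesis
      by (elim DERIV_cong) (simp add: H_def algebra_simps power2_eq_square)
  qed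
  have zero: "V t x = 0" "Y t x = 0" if "x \<in> {?c, ?d}" for x
  proof -
    have *: "y t + \<delta> * ((x - y t) / \<delta>) = x" using \<delta> by simp
    have "1 < \<bar>(x - y t) / \<delta>\<bar>" using t that by (intro phase_large) auto
    from partials_vanish(1,2)[OF tT this, unfolded *] show "V t x = 0" "Y t x = 0" .
  qed
  have "((\<lambda>x. \<kappa> 0 t x + H x) has_integral B ?d - B ?c) {?c..?d}"
    using dB by (intro fundamental_theorem_of_calculus cd)
      (auto simp: has_real_derivative_iff_has_vector_derivative[symmetric] intro: has_field_derivative_at_within)
  moreover have "B ?d - B ?c = 0" using zero by (simp add: B_def)
  ultimately have "integral {?c..?d} (\<lambda>x. \<kappa> 0 t x + H x) = 0" by (metis integral_unique)
  moreover have cH: "continuous_on UNIV H"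
    unfolding H_def
    by (intro continuous_on_divide continuous_on_mult continuous_on_add continuous_on_diff
      continuous_on_power continuous_on_const cont_slice[OF tT]
      smooth_PQx[THEN smooth_strip_continuous, THEN continuous_on_slice, OF tT] ballI power_not_zero Xnz)
  moreover have "integral {?c..?d} (\<lambda>x. \<kappa> 0 t x + H x) = k1 0 t + integral {?c..?d} H"
    unfolding k1_def
    by (intro Henstock_Kurzweil_Integration.integral_add integrable_continuous_real
        continuous_on_subset[OF kappa0_continuous(1)[OF tT]] continuous_on_subset[OF cH]) auto
  moreover have "integral {?c..?d} H = \<delta> * integral {-1..1} (\<lambda>z. H (y t + \<delta> * z))"
    by (rule integral_rescale[OF cH])
       (use vanish_VYpR[OF tT] partials_vanish[OF tT] \<delta> in \<open>auto simp: H_def\<close>)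
  moreover have "\<delta> * integral {-1..1} (\<lambda>z. H (y t + \<delta> * z)) = L1 \<delta> t"
  proof -
    have "\<delta> * H (y t + \<delta> * z) = Px t (y t + \<delta> * z) / (X t (y t + \<delta> * z))\<^sup>2 * yy t z +
       (Qx t (y t + \<delta> * z) / (X t (y t + \<delta> * z))\<^sup>2
        - 2 * (Q t (y t + \<delta> * z))\<^sup>2 / (X t (y t + \<delta> * z)) ^ 3) * v \<delta> t z" for z
      using \<delta> unfolding H_def scaled_partials[OF tT] by (simp add: distrib_left)
    then show ?thesis
      unfolding L1_def by (subst Henstock_Kurzweil_Integration.integral_mult_right[symmetric]) simp
  qed
  ultimately show ?thesis by simp
qed

end


section \<open>Shorter paths\<close>

context wave
begin

abbreviation "J \<equiv> {t0 - r..t0 + r}"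

lemma J_subset: "J \<subseteq> {0..T}"
  using r by auto

lemma weight_continuous:
  assumes "continuous_on {0..T} g" "\<And>t. t \<in> J \<Longrightarrow> 0 < F \<theta> g t"
  shows "continuous_on J (\<lambda>t. 1 / (2 * sqrt (F \<theta> g t)))"
  using assms(2) by (intro continuous_intros continuous_on_subset[OF F_continuous[OF assms(1)] J_subset])
    (force simp: less_imp_neq[symmetric])

text \<open>At \<delta> = 0 the integrand is nonpositive and negative at \<open>t0\<close>, so the
  integral is negative; continuity in \<delta> passes this to a genuine wave. Nonpositivity is
  demanded only in the limit.\<close>

lemma negative_for_small:
  fixes H :: "real \<Rightarrow> real \<Rightarrow> real" and w :: "real \<Rightarrow> real"
  assumes H: "continuous_on ({0..1} \<times> {0..T}) (\<lambda>z. H (fst z) (snd z))"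
    and w: "continuous_on J w" "\<And>t. t \<in> J \<Longrightarrow> 0 < w t"
    and le: "\<And>t. t \<in> J \<Longrightarrow> H 0 t \<le> 0" and neg: "H 0 t0 < 0"
  obtains \<delta> :: real where "0 < \<delta>" "\<delta> \<le> 1" "integral J (\<lambda>t. H \<delta> t * w t) < 0"
proof -
  have HJ: "continuous_on ({0..1} \<times> J) (\<lambda>z. H (fst z) (snd z))"
    by (rule continuous_on_subset[OF H]) (use J_subset in auto)
  moreover have "continuous_on ({0..1} \<times> J) (\<lambda>z. w (snd z))"
    by (rule continuous_on_compose2[OF w(1)]) (auto intro: continuous_intros)
  ultimately have Hw: "continuous_on ({0..1} \<times> J) (\<lambda>z. H (fst z) (snd z) * w (snd z))"
    by (rule continuous_on_mult)
  then have c: "continuous_on {0..1} (\<lambda>\<delta>. integral J (\<lambda>t. H \<delta> t * w t))"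
    unfolding box_real[symmetric]
    by (intro integral_continuous_on_param) (simp add: case_prod_beta)
  have "continuous_on J (\<lambda>t. (0::real, t))" by (intro continuous_intros)
  moreover have "(\<lambda>t. (0::real, t)) ` J \<subseteq> {0..1} \<times> J" by auto
  ultimately have c0: "continuous_on J (\<lambda>t. H 0 t * w t)"
    using continuous_on_compose2[OF Hw, of J "\<lambda>t. (0, t)"] by simp
  have "integral J (\<lambda>t. H 0 t * w t) < 0"
  proof (rule integral_negative[OF c0])
    show "t0 \<in> J" "t0 - r < t0 + r" using r by auto
    then show "H 0 t0 * w t0 < 0" using neg w(2) by (intro mult_neg_pos) auto
    show "H 0 t * w t \<le> 0" if "t \<in> J" for t
      using le[OF that] w(2)[OF that] by (intro mult_nonpos_nonneg) auto
  qed
  then show ?thesis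
    by (rule small_point_negative[OF c order_refl zero_less_one _ zero_less_one]) (rule that)
qed

text \<open>Here \<open>k2\<close> dominates, so the second variation is multiplied by \<delta>^3.
  The energy part and the square of \<open>k1\<close> then carry positive powers of \<delta>, and
  the crude bound through \<open>K1\<close> suffices.\<close>

lemma central_shortening:
  assumes \<theta>: "0 \<le> \<theta>" and g: "continuous_on {0..T} g" and Fpos: "\<And>t. t \<in> J \<Longrightarrow> 0 < F \<theta> g t"
    and sgn: "\<And>t. t \<in> J \<Longrightarrow> 0 < \<theta> * (g t - cocycle_density T \<phi> t) * l" and \<epsilon>: "0 < \<epsilon>"
  shows "\<exists>\<psi>. Diff_path T \<psi> \<and> \<psi> 0 = \<phi> 0 \<and> \<psi> T = \<phi> T \<and>
    schwartz_norm T k m n (\<lambda>t x. \<phi> t x - \<psi> t x) < \<epsilon> \<and> weighted_length T \<theta> g \<psi> < weighted_length T \<theta> g \<phi>"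
proof -
  define a where "a = (\<lambda>t. g t - cocycle_density T \<phi> t)"
  define w where "w = (\<lambda>t. 1 / (2 * sqrt (F \<theta> g t)))"
  define H where "H = (\<lambda>\<delta> t. 2 * \<delta>\<^sup>2 * E2 \<delta> t + \<theta> * (- 2 * a t * K2 \<delta> t + 2 * \<delta> * (K1 \<delta> t)\<^sup>2))"
  have a: "continuous_on {0..T} a" unfolding a_def by (intro continuous_intros g continuous_cocycle)
  have a': "continuous_on ({0..1} \<times> {0..T}) (\<lambda>z. a (snd z))"
    by (rule continuous_on_compose2[OF a]) (auto intro: continuous_intros)
  have H: "continuous_on ({0..1} \<times> {0..T}) (\<lambda>z. H (fst z) (snd z))"
    unfolding H_def by (intro continuous_intros scaled_continuous a')
  have w: "continuous_on J w" unfolding w_def by (rule weight_continuous[OF g Fpos])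
  have wpos: "0 < w t" if "t \<in> J" for t unfolding w_def using Fpos[OF that] by simp
  define B where "B = integral {-1..1} (\<lambda>z. (b2 z)\<^sup>2)"
  have B: "0 < B"
    using bump_square_integral[OF bump_deriv2] by (simp add: B_def numeral_2_eq_2)
  have H0: "H 0 t = - (4 * (\<theta> * a t * l) * ((A t)\<^sup>2 / (X t (y t))\<^sup>2 * B))" if "t \<in> J" for t
    using K2_zero[of t] J_subset that unfolding H_def B_def by auto
  have t0J: "t0 \<in> J" using r by auto
  have sgn': "0 < \<theta> * a t * l" if "t \<in> J" for t using sgn[OF that] by (simp add: a_def)
  have le: "H 0 t \<le> 0" if "t \<in> J" for t
    unfolding H0[OF that] using sgn'[OF that] B by (simp add: less_imp_le)
  have neg: "H 0 t0 < 0"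
  proof -
    have "X t0 (y t0) \<noteq> 0" using X_pos[of t0 "y t0"] t0J J_subset by force
    then have "0 < (A t0)\<^sup>2 / (X t0 (y t0))\<^sup>2 * B" using A_t0 B by simp
    with sgn'[OF t0J] have "0 < (\<theta> * a t0 * l) * ((A t0)\<^sup>2 / (X t0 (y t0))\<^sup>2 * B)"
      by (rule mult_pos_pos)
    then show ?thesis unfolding H0[OF t0J] by linarith
  qed
  obtain \<delta> where \<delta>: "0 < \<delta>" "\<delta> \<le> 1" "integral J (\<lambda>t. H \<delta> t * w t) < 0"
    using negative_for_small[OF H w wpos le neg] by blast
  interpret D: wave_at T \<phi> t0 x0 l r \<delta> using \<delta> by unfold_locales
  have W: "\<delta> ^ 3 * D.W \<theta> a 0 t = H \<delta> t" if "t \<in> J" for t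
  proof -
    have t: "t \<in> {0..T}" using that J_subset by blast
    show ?thesis
      unfolding H_def D.W_def D.e2_scaled[OF t, symmetric] D.k1_scaled[OF t, symmetric] D.k2_scaled[OF t, symmetric]
      by (simp add: algebra_simps eval_nat_numeral)
  qed
  have "\<delta> ^ 3 * integral J (\<lambda>t. D.W \<theta> a 0 t * w t) = integral J (\<lambda>t. \<delta> ^ 3 * (D.W \<theta> a 0 t * w t))"
    by simp
  also have "\<dots> = integral J (\<lambda>t. H \<delta> t * w t)"
    by (intro Henstock_Kurzweil_Integration.integral_cong) (simp add: W[symmetric] mult.assoc)
  finally have "\<delta> ^ 3 * integral J (\<lambda>t. D.W \<theta> a 0 t * w t) < 0" using \<delta> by simp
  then have "integral J (\<lambda>t. D.W \<theta> a 0 t * w t) < 0"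
    using \<delta> by (simp add: mult_less_0_iff)
  then show ?thesis
    by (intro D.shortening_close[OF \<theta> g Fpos] \<epsilon>) (simp_all add: w_def a_def)
qed

text \<open>The term with \<open>k2\<close> is absent, so the second variation is multiplied by
  \<delta> alone. The square of \<open>k1\<close> disappears in the limit only because
  \<open>L1\<close> keeps it bounded, which leaves twice \<open>E2\<close>.\<close>

lemma horizontal_shortening:
  assumes \<theta>: "0 \<le> \<theta>" and g: "continuous_on {0..T} g" and Fpos: "\<And>t. t \<in> J \<Longrightarrow> 0 < F \<theta> g t"
    and hor: "\<And>t. t \<in> J \<Longrightarrow> \<theta> * (g t - cocycle_density T \<phi> t) = 0"
    and sgn: "\<And>t. t \<in> J \<Longrightarrow> l\<^sup>2 * X t (y t) + 2 * l * U t (y t) < 0" and \<epsilon>: "0 < \<epsilon>"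
  shows "\<exists>\<psi>. Diff_path T \<psi> \<and> \<psi> 0 = \<phi> 0 \<and> \<psi> T = \<phi> T \<and>
    schwartz_norm T k m n (\<lambda>t x. \<phi> t x - \<psi> t x) < \<epsilon> \<and> weighted_length T \<theta> g \<psi> < weighted_length T \<theta> g \<phi>"
proof -
  define a where "a = (\<lambda>t. g t - cocycle_density T \<phi> t)"
  define w where "w = (\<lambda>t. 1 / (2 * sqrt (F \<theta> g t)))"
  define H where "H = (\<lambda>\<delta> t. 2 * E2 \<delta> t + 2 * \<theta> * \<delta> * (L1 \<delta> t)\<^sup>2)"
  have H: "continuous_on ({0..1} \<times> {0..T}) (\<lambda>z. H (fst z) (snd z))"
    unfolding H_def by (intro continuous_intros scaled_continuous)
  have w: "continuous_on J w" unfolding w_def by (rule weight_continuous[OF g Fpos])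
  have wpos: "0 < w t" if "t \<in> J" for t unfolding w_def using Fpos[OF that] by simp
  define B where "B = integral {-1..1} (\<lambda>z. (b1 z)\<^sup>2)"
  have B: "0 < B"
    using bump_square_integral[of 1] bump_deriv1 by (simp add: B_def)
  have H0: "H 0 t = 2 * ((l\<^sup>2 * X t (y t) + 2 * l * U t (y t)) * ((A t)\<^sup>2 * B))" for t
    unfolding H_def E2_zero B_def by simp
  have t0J: "t0 \<in> J" using r by auto
  have le: "H 0 t \<le> 0" if "t \<in> J" for t
    unfolding H0 using mult_nonpos_nonneg[OF less_imp_le[OF sgn[OF that]], of "(A t)\<^sup>2 * B"] B
    by (simp add: mult.commute mult.left_commute)
  have neg: "H 0 t0 < 0"
    unfolding H0 using mult_neg_pos[OF sgn[OF t0J], of "(A t0)\<^sup>2 * B"] A_t0 B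
    by (simp add: mult.commute mult.left_commute)
  obtain \<delta> where \<delta>: "0 < \<delta>" "\<delta> \<le> 1" "integral J (\<lambda>t. H \<delta> t * w t) < 0"
    using negative_for_small[OF H w wpos le neg] by blast
  interpret D: wave_at T \<phi> t0 x0 l r \<delta> using \<delta> by unfold_locales
  have W: "\<delta> * D.W \<theta> a 0 t = H \<delta> t" if tJ: "t \<in> J" for t
  proof -
    have t: "t \<in> {0..T}" using that J_subset by blast
    have "\<delta> * D.W \<theta> a 0 t = 2 * (\<delta> * D.e2 t) + \<delta> * (- 2 * (\<theta> * a t) * D.k2 0 t + 2 * \<theta> * (D.k1 0 t)\<^sup>2)"
      unfolding D.W_def by (simp add: algebra_simps)
    also have "\<dots> = H \<delta> t"
      using hor[OF tJ] unfolding H_def D.e2_scaled[OF t] D.k1_by_parts[OF tJ] a_def by simp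
    finally show ?thesis .
  qed
  have "\<delta> * integral J (\<lambda>t. D.W \<theta> a 0 t * w t) = integral J (\<lambda>t. \<delta> * (D.W \<theta> a 0 t * w t))"
    by simp
  also have "\<dots> = integral J (\<lambda>t. H \<delta> t * w t)"
    by (intro Henstock_Kurzweil_Integration.integral_cong) (simp add: W[symmetric] mult.assoc)
  finally have "\<delta> * integral J (\<lambda>t. D.W \<theta> a 0 t * w t) < 0" using \<delta> by simp
  then have "integral J (\<lambda>t. D.W \<theta> a 0 t * w t) < 0"
    using \<delta> by (simp add: mult_less_0_iff)
  then show ?thesis
    by (intro D.shortening_close[OF \<theta> g Fpos] \<epsilon>) (simp_all add: w_def a_def)
qed

end

text \<open>Positivity is stated for all smaller radii too, so that radii from two applications can
  be combined by their minimum.\<close>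

lemma positive_near:
  fixes f :: "real \<Rightarrow> real"
  assumes f: "continuous_on {0..T} f" and t0: "0 < t0" "t0 < T" "0 < f t0"
  obtains r where "0 < r" "0 < t0 - r" "t0 + r < T" "\<And>t r'. r' \<le> r \<Longrightarrow> t \<in> {t0 - r'..t0 + r'} \<Longrightarrow> 0 < f t"
proof -
  have "t0 \<in> {0..T}" using t0 by simp
  then obtain e where e: "0 < e" "\<And>s. s \<in> {0..T} \<Longrightarrow> dist s t0 < e \<Longrightarrow> dist (f s) (f t0) < f t0"
    using f t0(3) unfolding continuous_on_iff by meson
  define d where "d = min e (min t0 (T - t0))"
  have d: "0 < d" "d \<le> e" "d \<le> t0" "d \<le> T - t0" using e(1) t0 by (auto simp: d_def)
  define r where "r = d / 2"
  have r: "0 < r" "r < e" "0 < t0 - r" "t0 + r < T" unfolding r_def using d by simp_all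
  have "0 < f t" if "r' \<le> r" "t \<in> {t0 - r'..t0 + r'}" for t r'
  proof -
    have "dist t t0 \<le> r" "t \<in> {0..T}" using that r by (auto simp: dist_real_def abs_le_iff)
    then have "dist (f t) (f t0) < f t0" using e(2) r by auto
    then show ?thesis by (simp add: dist_real_def abs_less_iff)
  qed
  with r show ?thesis by (intro that)
qed

context diff_path
begin

lemma exists_shorter:
  assumes \<theta>: "0 \<le> \<theta>" and g: "continuous_on {0..T} g" and \<epsilon>: "0 < \<epsilon>"
    and moving: "\<exists>t\<in>{0<..<T}. \<theta> * (g t - cocycle_density T \<phi> t) \<noteq> 0 \<or> (\<exists>x. U t x \<noteq> 0)"
  shows "\<exists>\<psi>. Diff_path T \<psi> \<and> \<psi> 0 = \<phi> 0 \<and> \<psi> T = \<phi> T \<and>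
    schwartz_norm T k m n (\<lambda>t x. \<phi> t x - \<psi> t x) < \<epsilon> \<and> weighted_length T \<theta> g \<psi> < weighted_length T \<theta> g \<phi>"
proof (cases "\<exists>t\<in>{0<..<T}. \<theta> * (g t - cocycle_density T \<phi> t) \<noteq> 0")
  case True
  then obtain t0 where t0: "0 < t0" "t0 < T" "\<theta> * (g t0 - cocycle_density T \<phi> t0) \<noteq> 0" by auto
  \<comment> \<open>With this choice the required product is a square at \<open>t0\<close>, hence
    positive there and nearby.\<close>
  define l where "l = \<theta> * (g t0 - cocycle_density T \<phi> t0)"
  have "0 < \<theta> * (g t0 - cocycle_density T \<phi> t0) * l"
    using t0(3) unfolding l_def by (metis not_real_square_gt_zero)
  moreover have "continuous_on {0..T} (\<lambda>t. \<theta> * (g t - cocycle_density T \<phi> t) * l)"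
    by (intro continuous_intros g continuous_cocycle)
  ultimately obtain r where r: "0 < r" "0 < t0 - r" "t0 + r < T"
    "\<And>t r'. r' \<le> r \<Longrightarrow> t \<in> {t0 - r'..t0 + r'} \<Longrightarrow> 0 < \<theta> * (g t - cocycle_density T \<phi> t) * l"
    using positive_near t0 by (metis (no_types, lifting))
  \<comment> \<open>The sign of the leading central term does not depend on the place of the wave,
    so the centre 0 will do.\<close>
  interpret w: wave T \<phi> t0 0 l r using r by unfold_locales
  have pos: "0 < F \<theta> g t" if t: "t \<in> {t0 - r..t0 + r}" for t
  proof -
    have "\<theta> * (g t - cocycle_density T \<phi> t) * l \<noteq> 0"
      by (rule less_imp_neq[OF r(4)[OF order_refl t], symmetric])
    then have "0 < \<theta>" "0 < (g t - cocycle_density T \<phi> t)\<^sup>2" using \<theta> by auto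
    then have "0 < \<theta> * (g t - cocycle_density T \<phi> t)\<^sup>2" by simp
    moreover have "0 \<le> Diff_energy_density T \<phi> t" using t w.J_subset by (intro energy_nonneg) blast
    ultimately show ?thesis by linarith
  qed
  show ?thesis by (rule w.central_shortening[OF \<theta> g pos r(4)[OF order_refl] \<epsilon>])
next
  case False
  then obtain t0 x0 where t0: "0 < t0" "t0 < T" "U t0 x0 \<noteq> 0" using moving by auto
  have t0T: "t0 \<in> {0..T}" using t0 by simp
  have X0: "0 < X t0 x0" by (rule X_pos[OF t0T])
  \<comment> \<open>The minimiser of the quadratic \<open>l^2 X + 2 l U\<close> at the chosen point,
    with minimum \<open>- U^2 / X\<close>.\<close>
  define l where "l = - U t0 x0 / X t0 x0"
  have "0 < F \<theta> g t0"
    using energy_pos[OF t0T t0(3)] \<theta> by (intro add_pos_nonneg) auto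
  then obtain r1 where r1: "0 < r1" "0 < t0 - r1" "t0 + r1 < T"
    "\<And>t r'. r' \<le> r1 \<Longrightarrow> t \<in> {t0 - r'..t0 + r'} \<Longrightarrow> 0 < F \<theta> g t"
    using positive_near[OF F_continuous[OF g, of \<theta>] t0(1,2)] by blast
  define f where "f = (\<lambda>t. - (l\<^sup>2 * X t (x0 - l * (t - t0)) + 2 * l * U t (x0 - l * (t - t0))))"
  have cy: "continuous_on {0..T} (\<lambda>t. x0 - l * (t - t0))" by (intro continuous_intros)
  note c = cont_UXPQ[THEN continuous_on_strip_compose, OF continuous_on_id cy]
  have "continuous_on {0..T} f"
    unfolding f_def by (intro continuous_intros c)
  moreover have "0 < f t0"
  proof -
    have "f t0 = (U t0 x0)\<^sup>2 / X t0 x0"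
      unfolding f_def l_def using X0 by (simp add: field_simps power2_eq_square)
    then show ?thesis using X0 t0(3) by simp
  qed
  ultimately obtain r2 where r2: "0 < r2" "0 < t0 - r2" "t0 + r2 < T"
    "\<And>t r'. r' \<le> r2 \<Longrightarrow> t \<in> {t0 - r'..t0 + r'} \<Longrightarrow> 0 < f t"
    using positive_near[OF _ t0(1,2)] by blast
  define r where "r = min r1 r2"
  interpret w: wave T \<phi> t0 x0 l r
    using r1 r2 by unfold_locales (auto simp: r_def)
  show ?thesis
  proof (rule w.horizontal_shortening[OF \<theta> g _ _ _ \<epsilon>])
    fix t assume t: "t \<in> {t0 - r..t0 + r}"
    show "0 < F \<theta> g t" using r1(4)[OF _ t] by (simp add: r_def)
    show "\<theta> * (g t - cocycle_density T \<phi> t) = 0" using False t w.r by auto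
    have "0 < f t" using r2(4)[OF _ t] by (simp add: r_def)
    then show "l\<^sup>2 * X t (w.y t) + 2 * l * U t (w.y t) < 0" by (simp add: f_def w.y_def)
  qed
qed

end

section \<open>Nonconstant paths and the two lengths\<close>

lemma constant_if_dt_zero:
  assumes f: "\<And>t. t \<in> {0..T} \<Longrightarrow> (f has_vector_derivative f' t) (at t within {0..T})"
    and z: "\<And>t. 0 < t \<Longrightarrow> t < T \<Longrightarrow> f' t = (0::real)" and t: "t \<in> {0..T}"
  shows "f t = f 0"
proof (cases "t = 0")
  case False
  then have "0 < T" "0 < t" using t by auto
  show ?thesis
  proof (rule DERIV_isconst2[OF \<open>0 < T\<close>])
    show "continuous_on {0..T} f"
      using f has_vector_derivative_continuous continuous_on_eq_continuous_within by blast
    fix s assume s: "0 < s" "s < T"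
    then have "(f has_vector_derivative 0) (at s within {0..T})" using f[of s] z by simp
    moreover have "at s within {0..T} = at s" using s by (intro at_within_interior) simp
    ultimately show "(f has_real_derivative 0) (at s)"
      by (simp add: has_real_derivative_iff_has_vector_derivative)
  qed (use t in auto)
qed simp

text \<open>Zero velocity at all interior times would make the path constant, by continuity also at
  the end points. An interior time is needed to leave room for a perturbation with fixed
  ends.\<close>

lemma (in diff_path) moving_point:
  assumes "t \<in> {0..T}" "\<phi> t \<noteq> \<phi> 0"
  shows "\<exists>t\<in>{0<..<T}. \<exists>x. U t x \<noteq> 0"
proof (rule ccontr)
  assume "\<not> ?thesis"
  then have "\<phi> t x = \<phi> 0 x" for x
    using smooth_strip_has_partial_t[OF smooth] assms(1)
    by (intro constant_if_dt_zero[of T "\<lambda>t. \<phi> t x" "\<lambda>t. U t x"]) (auto simp: U_def)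
  with assms(2) show False by auto
qed

lemma Diff_length_eq: "Diff_length T \<phi> = weighted_length T 0 (\<lambda>_. 0) \<phi>"
  by (simp add: Diff_length_def weighted_length_def)

lemma VB_length_eq: "VB_length T \<phi> \<alpha> = weighted_length T 1 (dt T \<alpha>) \<phi>"
  by (simp add: VB_length_def weighted_length_def cocycle_density_def)

text \<open>Needed for \<alpha> - \<alpha>. The iterates are claimed to vanish only on the interval,
  since \<open>dt\<close> is unspecified outside it.\<close>

lemma C_norm_zero:
  assumes "0 < T"
  shows "C_norm T n (\<lambda>t. 0) = 0"
proof -
  have z: "\<forall>t\<in>{0..T}. (dt T ^^ j) (\<lambda>t. 0) t = 0" for j
  proof (induction j)
    case (Suc j)
    show ?case
    proof
      fix t assume t: "t \<in> {0..T}"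
      have "dt T ((dt T ^^ j) (\<lambda>t. 0)) t = dt T (\<lambda>t. 0) t" using Suc t by (intro dt_cong) auto
      also have "\<dots> = 0" using assms t by (intro dt_eqI) auto
      finally show "(dt T ^^ Suc j) (\<lambda>t. 0) t = 0" by simp
    qed
  qed simp
  have "sup_norm {0..T} ((dt T ^^ j) (\<lambda>t. 0)) = 0" for j
  proof -
    have "(\<lambda>t. \<bar>(dt T ^^ j) (\<lambda>t. 0) t\<bar>) ` {0..T} = {0}" using z[of j] assms by force
    then show ?thesis by (simp add: sup_norm_def)
  qed
  then show ?thesis by (simp add: C_norm_def)
qed

lemma smooth_interval_dt:
  assumes "smooth_interval T \<alpha>"
  shows "t \<in> {0..T} \<Longrightarrow> (\<alpha> has_vector_derivative dt T \<alpha> t) (at t within {0..T})"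
    and "continuous_on {0..T} (dt T \<alpha>)"
proof -
  have d: "(dt T ^^ j) \<alpha> differentiable at t within {0..T}" if "t \<in> {0..T}" for j t
    using assms that by (simp add: smooth_interval_def)
  show "(\<alpha> has_vector_derivative dt T \<alpha> t) (at t within {0..T})" if "t \<in> {0..T}"
    using d[OF that, of 0] by (intro dt_has_vector_derivative) simp
  show "continuous_on {0..T} (dt T \<alpha>)"
    using d[of _ 1] by (intro differentiable_imp_continuous_on) (simp add: differentiable_on_def)
qed

theorem corollary3p6:
  fixes T :: real and k m n :: nat
  assumes "T > 0"
  shows "(\<forall>\<phi>. Diff_path T \<phi> \<and> (\<exists>t\<in>{0..T}. \<phi> t \<noteq> \<phi> 0) \<longrightarrow>
            (\<forall>\<^sub>F \<epsilon> in at_right 0. \<exists>\<psi>. Diff_path T \<psi> \<and> \<psi> 0 = \<phi> 0 \<and> \<psi> T = \<phi> T \<and>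
               schwartz_norm T k m n (\<lambda>t x. \<phi> t x - \<psi> t x) < \<epsilon> \<and>
               Diff_length T \<psi> < Diff_length T \<phi>))
       \<and> (\<forall>\<phi> \<alpha>. VB_path T \<phi> \<alpha> \<and> (\<exists>t\<in>{0..T}. (\<phi> t, \<alpha> t) \<noteq> (\<phi> 0, \<alpha> 0)) \<longrightarrow>
            (\<forall>\<^sub>F \<epsilon> in at_right 0. \<exists>\<psi> \<beta>. VB_path T \<psi> \<beta> \<and>
               (\<psi> 0, \<beta> 0) = (\<phi> 0, \<alpha> 0) \<and> (\<psi> T, \<beta> T) = (\<phi> T, \<alpha> T) \<and>
               schwartz_norm T k m n (\<lambda>t x. \<phi> t x - \<psi> t x) + C_norm T n (\<lambda>t. \<alpha> t - \<beta> t) < \<epsilon> \<and>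
               VB_length T \<psi> \<beta> < VB_length T \<phi> \<alpha>))"
proof (intro conjI allI impI; elim conjE)
  fix \<phi> assume \<phi>: "Diff_path T \<phi>" and move: "\<exists>t\<in>{0..T}. \<phi> t \<noteq> \<phi> 0"
  interpret diff_path T \<phi> using assms \<phi> by unfold_locales
  \<comment> \<open>The weight 0 voids the first alternative, so the moving point has to come from
    \<open>U\<close>.\<close>
  have mv: "\<exists>t\<in>{0<..<T}. 0 * (0 - cocycle_density T \<phi> t) \<noteq> 0 \<or> (\<exists>x. U t x \<noteq> 0)"
    using moving_point move by auto
  show "\<forall>\<^sub>F \<epsilon> in at_right 0. \<exists>\<psi>. Diff_path T \<psi> \<and> \<psi> 0 = \<phi> 0 \<and> \<psi> T = \<phi> T \<and>
      schwartz_norm T k m n (\<lambda>t x. \<phi> t x - \<psi> t x) < \<epsilon> \<and> Diff_length T \<psi> < Diff_length T \<phi>"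
    unfolding Diff_length_eq
    \<comment> \<open>Every positive \<epsilon> is admissible, in particular all small ones.\<close>
    by (rule eventually_mono[OF eventually_at_right_less[of 0]])
       (intro exists_shorter mv continuous_on_const order_refl)
next
  fix \<phi> \<alpha> assume \<phi>: "VB_path T \<phi> \<alpha>" and move: "\<exists>t\<in>{0..T}. (\<phi> t, \<alpha> t) \<noteq> (\<phi> 0, \<alpha> 0)"
  have \<alpha>: "smooth_interval T \<alpha>" using \<phi> by (simp add: VB_path_def)
  interpret diff_path T \<phi> using assms \<phi> by unfold_locales (simp_all add: VB_path_def)
  \<comment> \<open>If \<open>U\<close> vanishes at all interior times, so do \<open>P\<close> and
    the cocycle term; a vanishing central velocity then forces \<alpha> to be constant as
    well.\<close>
  have mv: "\<exists>t\<in>{0<..<T}. 1 * (dt T \<alpha> t - cocycle_density T \<phi> t) \<noteq> 0 \<or> (\<exists>x. U t x \<noteq> 0)"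
  proof (rule ccontr)
    assume n: "\<not> ?thesis"
    have "dt T \<alpha> t = 0" if t: "0 < t" "t < T" for t
    proof -
      have "U t = (\<lambda>x. 0)" using n t by auto
      then have "P t = (\<lambda>x. 0)" by (auto simp: P_def U_def partial_x_def)
      then have "cocycle_density T \<phi> t = 0" by (simp add: cocycle_eq)
      then show ?thesis using n t by auto
    qed
    then have "\<alpha> t = \<alpha> 0" if "t \<in> {0..T}" for t
      using constant_if_dt_zero[OF smooth_interval_dt(1)[OF \<alpha>]] that by blast
    moreover have "\<phi> t = \<phi> 0" if "t \<in> {0..T}" for t
      using moving_point[OF that] n by blast
    ultimately show False using move by (metis (lifting))
  qed
  show "\<forall>\<^sub>F \<epsilon> in at_right 0. \<exists>\<psi> \<beta>. VB_path T \<psi> \<beta> \<and>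
      (\<psi> 0, \<beta> 0) = (\<phi> 0, \<alpha> 0) \<and> (\<psi> T, \<beta> T) = (\<phi> T, \<alpha> T) \<and>
      schwartz_norm T k m n (\<lambda>t x. \<phi> t x - \<psi> t x) + C_norm T n (\<lambda>t. \<alpha> t - \<beta> t) < \<epsilon> \<and>
      VB_length T \<psi> \<beta> < VB_length T \<phi> \<alpha>"
  proof (rule eventually_mono[OF eventually_at_right_less[of 0]])
    fix \<epsilon> :: real assume "0 < \<epsilon>"
    then obtain \<psi> where \<psi>: "Diff_path T \<psi>" "\<psi> 0 = \<phi> 0" "\<psi> T = \<phi> T"
      "schwartz_norm T k m n (\<lambda>t x. \<phi> t x - \<psi> t x) < \<epsilon>"
      "weighted_length T 1 (dt T \<alpha>) \<psi> < weighted_length T 1 (dt T \<alpha>) \<phi>"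
      using exists_shorter[OF zero_le_one smooth_interval_dt(2)[OF \<alpha>] _ mv] by blast
    then show "\<exists>\<psi> \<beta>. VB_path T \<psi> \<beta> \<and>
      (\<psi> 0, \<beta> 0) = (\<phi> 0, \<alpha> 0) \<and> (\<psi> T, \<beta> T) = (\<phi> T, \<alpha> T) \<and>
      schwartz_norm T k m n (\<lambda>t x. \<phi> t x - \<psi> t x) + C_norm T n (\<lambda>t. \<alpha> t - \<beta> t) < \<epsilon> \<and>
      VB_length T \<psi> \<beta> < VB_length T \<phi> \<alpha>"
      using \<alpha> C_norm_zero[OF assms] by (intro exI[of _ \<psi>] exI[of _ \<alpha>]) (simp add: VB_path_def VB_length_eq)
  qed
qed

end
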